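(* Let $P_\theta^{(n)}$ be the distribution of $(X_0,X_1,\dots,X_n)$ for a stationary Markov chain $X_0,X_1,\dots$ with transition densities $p_\theta(y|x)$ and stationary density $q_\theta$ (relative to $\mu$), $\theta\in\Theta$. Assume that there exist a finite measure $\nu$ on $(\mathfrak{X},\mathcal{A})$ and $k,l\in\mathbb{N}$ such that for every $\theta\in\Theta$, $x\in\mathfrak{X}$ and $A\in\mathcal{A}$, $$P_\theta(X_l\in A\mid X_0=x)\lesssim\nu(A)\lesssim\frac1k\sum_{j=1}^kP_\theta(X_j\in A\mid X_0=x),$$ and let $$d^2(\theta,\theta')=\iint\Bigl[\sqrt{p_\theta(y|x)}-\sqrt{p_{\theta'}(y|x)}\Bigr]^2d\mu(y)\,d\nu(x).$$ Assume further that under $\theta_0$ the chain is $\alpha$-mixing with coefficients $\alpha_h$ satisfying $\sum_{h=0}^\infty\alpha_h^{1-2/s}<\infty$ for some $s>2$. Suppose that for a sequence $\varepsilon_n\to0$ ($\varepsilon_n>0$) such that $n\varepsilon_n^2\ge2$, this $s>2$, every sufficiently large $j\in\mathbb{N}$ and sets $\Theta_n\subset\Theta$, the following conditions are satisfied: $$\sup_{\varepsilon>\varepsilon_n}\log N\bigl(\varepsilon/16,\{\theta\in\Theta_n:d(\theta,\theta_0)<\varepsilon\},d\bigr)\le n\varepsilon_n^2;$$ $$\frac{\Pi_n(\Theta\setminus\Theta_n)}{\Pi_n(B^*(\theta_0,\varepsilon_n;s))}=o(e^{-2n\varepsilon_n^2});$$ $$\frac{\Pi_n(\theta\in\Theta_n:(j-1)\varepsilon_n<d(\theta,\theta_0)\le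 j\varepsilon_n)}{\Pi_n(B^*(\theta_0,\varepsilon_n;s))}\le e^{Kn\varepsilon_n^2j^2/8},$$ where $K$ is the testing constant specified in the context. Then $P_{\theta_0}^{(n)}\Pi_n(\theta:d(\theta,\theta_0)\ge M_n\varepsilon_n\mid X^{(n)})\to0$ for every $M_n\to\infty$.
   Context: $(x,y)\mapsto p_\theta(y|x)$, $\theta\in\Theta$, are measurable transition densities from a measurable space $(\mathfrak{X},\mathcal{A})$ into itself relative to a reference measure $\mu$; for each $\theta$ there is a stationary distribution $Q_\theta$ with $\mu$-density $q_\theta$, and the chain is started in stationarity. $P_\theta$ is generic notation for probability (and expectation) governed by $\theta$; $Pf=\int f\,dP$. $X^{(n)}=(X_0,\dots,X_n)$; $\Pi_n$ is a prior probability measure on $\Theta$ and $\Pi_n(\cdot\mid X^{(n)})$ the posterior given by Bayes' formula (likelihood $q_\theta(X_0)\prod_{i=1}^np_\theta(X_i|X_{i-1})$); $\theta_0\in\Theta$ is the fixed true parameter. Densities are jointly measurable in observations and parameter and all relevant sets are taken measurable. $\lesssim$ denotes inequality up to a fixed multiplicative constant. Mixing coefficients (under $\theta_0$): $\alpha_h=\sup\{|\Pr(X_0\in A,X_h\in B)-\Pr(X_0\in A)\Pr(X_h\in B)|:A,B\in\mathcal{A}\}$. Testing constant (known result of Birgé): under the displayed two-sided bound with $\nu,k,l$, there is a constant $K>0$ depending only on $(k,l)$ such that for every $n$ and every $\theta_1\in\Theta$ there exist tests $\phi_n$ (measurable, $[0,1]$-valued) with $P_{\theta_0}^{(n)}\phi_n\le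 e^{-Knd^2(\theta_0,\theta_1)}$ and $\sup_{\theta\in\Theta:d(\theta,\theta_1)\le d(\theta_0,\theta_1)/8}P_\theta^{(n)}(1-\phi_n)\le e^{-Knd^2(\theta_0,\theta_1)}$. $K$ denotes this constant. Neighborhoods: with $K(f,g)=\int f\log(f/g)\,d\mu$ (the Kullback–Leibler divergence, when written with two arguments) and $V(f,g)=\int f|\log(f/g)|^2d\mu$, let $\Theta_1=\{\theta\in\Theta:K(q_{\theta_0},q_\theta)\le1,\ V(q_{\theta_0},q_\theta)\le1\}$, let $C_s$ be defined by $C_s^{-2/s}=16s(s-2)^{-1}\sum_{h=0}^\infty\alpha_h^{1-2/s}$, and $$B^*(\theta_0,\varepsilon;s)=\Bigl\{\theta\in\Theta_1:P_{\theta_0}\log\frac{p_{\theta_0}}{p_\theta}(X_1|X_0)\le\tfrac12\varepsilon^2,\ P_{\theta_0}\Bigl|\log\frac{p_{\theta_0}}{p_\theta}(X_1|X_0)\Bigr|^s\le C_s\varepsilon^s\Bigr\}.$$ $N(\varepsilon,A,d)$ is the minimal number of $d$-balls of radius $\varepsilon$ needed to cover $A$. *)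

theory Defs
  imports "HOL-Probability.Probability" "HOL-Library.Landau_Symbols" "HOL-Library.Extended_Nat"
begin

(* Conventions: "mu" is the reference measure on the sample space, "T" only carries the sigma-algebra on
   the parameter set (which is "space T"), and p_theta(y|x) is written "p \<theta> x y". *)

definition likelihood ::
  "('p \<Rightarrow> 'a \<Rightarrow> 'a \<Rightarrow> real) \<Rightarrow> ('p \<Rightarrow> 'a \<Rightarrow> real) \<Rightarrow> nat \<Rightarrow> 'p \<Rightarrow> (nat \<Rightarrow> 'a) \<Rightarrow> real" where
  "likelihood p q n \<theta> x = q \<theta> (x 0) * (\<Prod>i=1..n. p \<theta> (x (i - 1)) (x i))"

(* Law of (X_0,...,X_n); samples are functions on {..n}. *)
definition chain_law ::
  "'a measure \<Rightarrow> ('p \<Rightarrow> 'a \<Rightarrow> 'a \<Rightarrow> real) \<Rightarrow> ('p \<Rightarrow> 'a \<Rightarrow> real) \<Rightarrow> nat \<Rightarrow> 'p \<Rightarrow> (nat \<Rightarrow> 'a) measure" where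
  "chain_law mu p q n \<theta> =
     density (Pi\<^sub>M {..n} (\<lambda>_. mu)) (\<lambda>x. ennreal (likelihood p q n \<theta> x))"

(* "trans_law mu r j x" is the conditional law of X_j given X_0 = x under the one-step
   transition density r. *)
primrec trans_law :: "'a measure \<Rightarrow> ('a \<Rightarrow> 'a \<Rightarrow> real) \<Rightarrow> nat \<Rightarrow> 'a \<Rightarrow> 'a measure" where
  "trans_law mu r 0 = return mu"
| "trans_law mu r (Suc j) = (\<lambda>x. density mu (\<lambda>y. ennreal (r x y)) \<bind> trans_law mu r j)"

definition transition_density :: "'a measure \<Rightarrow> ('a \<Rightarrow> 'a \<Rightarrow> real) \<Rightarrow> bool" where
  "transition_density mu r \<longleftrightarrow>
     (\<lambda>(x, y). r x y) \<in> borel_measurable (mu \<Otimes>\<^sub>M mu) \<and>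
     (\<forall>x\<in>space mu. \<forall>y\<in>space mu. 0 \<le> r x y) \<and>
     (\<forall>x\<in>space mu. prob_space (density mu (\<lambda>y. ennreal (r x y))))"

definition stationary_density ::
  "'a measure \<Rightarrow> ('a \<Rightarrow> 'a \<Rightarrow> real) \<Rightarrow> ('a \<Rightarrow> real) \<Rightarrow> bool" where
  "stationary_density mu r f \<longleftrightarrow>
     f \<in> borel_measurable mu \<and>
     (\<forall>x\<in>space mu. 0 \<le> f x) \<and>
     prob_space (density mu (\<lambda>x. ennreal (f x))) \<and>
     density mu (\<lambda>x. ennreal (f x)) \<bind> (\<lambda>x. density mu (\<lambda>y. ennreal (r x y)))
       = density mu (\<lambda>x. ennreal (f x))"

(* For a prior that charges the neighbourhood Bstar below, the normalising integral is positive and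
   finite almost surely under \<theta>0, so the HOL values of division by 0 and \<infinity> play no role. *)
definition posterior ::
  "('p \<Rightarrow> 'a \<Rightarrow> 'a \<Rightarrow> real) \<Rightarrow> ('p \<Rightarrow> 'a \<Rightarrow> real) \<Rightarrow> 'p measure \<Rightarrow> nat \<Rightarrow> (nat \<Rightarrow> 'a) \<Rightarrow> 'p measure" where
  "posterior p q Pr n x =
     density Pr (\<lambda>\<theta>. ennreal (likelihood p q n \<theta> x) / (\<integral>\<^sup>+ t. ennreal (likelihood p q n t x) \<partial>Pr))"

definition trans_dist ::
  "'a measure \<Rightarrow> 'a measure \<Rightarrow> ('p \<Rightarrow> 'a \<Rightarrow> 'a \<Rightarrow> real) \<Rightarrow> 'p \<Rightarrow> 'p \<Rightarrow> real" where
  "trans_dist mu nu p \<theta> \<theta>' =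
     sqrt (\<integral>x. (\<integral>y. (sqrt (p \<theta> x y) - sqrt (p \<theta>' x y))\<^sup>2 \<partial>mu) \<partial>nu)"

definition mixing_coeff ::
  "'a measure \<Rightarrow> ('p \<Rightarrow> 'a \<Rightarrow> 'a \<Rightarrow> real) \<Rightarrow> ('p \<Rightarrow> 'a \<Rightarrow> real) \<Rightarrow> 'p \<Rightarrow> nat \<Rightarrow> real" where
  "mixing_coeff mu p q \<theta> h =
     (SUP (A, B)\<in>sets mu \<times> sets mu.
        \<bar>\<P>(x in chain_law mu p q h \<theta>. x 0 \<in> A \<and> x h \<in> B)
         - \<P>(x in chain_law mu p q h \<theta>. x 0 \<in> A) * \<P>(x in chain_law mu p q h \<theta>. x h \<in> B)\<bar>)"

(* log (a/b) for densities a, b \<ge> 0.  Since ln 0 = 0 and a/0 = 0 in HOL, the value \<infinity> for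
   b = 0 < a has to be given explicitly; the value for a = 0 is irrelevant because the function is
   only integrated against measures with density a. *)
definition log_ratio :: "real \<Rightarrow> real \<Rightarrow> ereal" where
  "log_ratio a b = (if a = 0 then 0 else if b = 0 then \<infinity> else ereal (ln (a / b)))"

(* Integral of an extended real function; it is only applied to log likelihood ratios, whose
   negative part always has a finite integral, so \<infinity> - \<infinity> does not occur. *)
definition ext_integral :: "'b measure \<Rightarrow> ('b \<Rightarrow> ereal) \<Rightarrow> ereal" where
  "ext_integral M f =
     enn2ereal (\<integral>\<^sup>+ x. e2ennreal (f x) \<partial>M) - enn2ereal (\<integral>\<^sup>+ x. e2ennreal (- f x) \<partial>M)"

definition abs_powr :: "ereal \<Rightarrow> real \<Rightarrow> ennreal" where
  "abs_powr z s = (if \<bar>z\<bar> = \<infinity> then \<infinity> else ennreal (\<bar>real_of_ereal z\<bar> powr s))"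

definition KL :: "'a measure \<Rightarrow> ('a \<Rightarrow> real) \<Rightarrow> ('a \<Rightarrow> real) \<Rightarrow> ereal" where
  "KL mu f g = ext_integral (density mu (\<lambda>x. ennreal (f x))) (\<lambda>x. log_ratio (f x) (g x))"

definition KL_var :: "'a measure \<Rightarrow> ('a \<Rightarrow> real) \<Rightarrow> ('a \<Rightarrow> real) \<Rightarrow> ennreal" where
  "KL_var mu f g = (\<integral>\<^sup>+ x. abs_powr (log_ratio (f x) (g x)) 2 \<partial>density mu (\<lambda>x. ennreal (f x)))"

(* The constant C_s with C_s powr (-2/s) = c.  It is \<infinity> in the degenerate case c = 0, where all
   mixing coefficients vanish (including that of lag 0). *)
definition C_const ::
  "'a measure \<Rightarrow> ('p \<Rightarrow> 'a \<Rightarrow> 'a \<Rightarrow> real) \<Rightarrow> ('p \<Rightarrow> 'a \<Rightarrow> real) \<Rightarrow> 'p \<Rightarrow> real \<Rightarrow> ennreal" where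
  "C_const mu p q \<theta>0 s =
     (let c = 16 * s / (s - 2) * (\<Sum>h. mixing_coeff mu p q \<theta>0 h powr (1 - 2 / s))
      in if c = 0 then \<infinity> else ennreal (c powr (- s / 2)))"

definition Theta1 ::
  "'a measure \<Rightarrow> 'p measure \<Rightarrow> ('p \<Rightarrow> 'a \<Rightarrow> real) \<Rightarrow> 'p \<Rightarrow> 'p set" where
  "Theta1 mu T q \<theta>0 = {\<theta>\<in>space T. KL mu (q \<theta>0) (q \<theta>) \<le> 1 \<and> KL_var mu (q \<theta>0) (q \<theta>) \<le> 1}"

definition Bstar ::
  "'a measure \<Rightarrow> 'p measure \<Rightarrow> ('p \<Rightarrow> 'a \<Rightarrow> 'a \<Rightarrow> real) \<Rightarrow> ('p \<Rightarrow> 'a \<Rightarrow> real) \<Rightarrow> 'p \<Rightarrow> real \<Rightarrow> real \<Rightarrow> 'p set" where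
  "Bstar mu T p q \<theta>0 e s =
     {\<theta>\<in>Theta1 mu T q \<theta>0.
        ext_integral (chain_law mu p q 1 \<theta>0) (\<lambda>x. log_ratio (p \<theta>0 (x 0) (x 1)) (p \<theta> (x 0) (x 1)))
          \<le> ereal (e\<^sup>2 / 2) \<and>
        (\<integral>\<^sup>+ x. abs_powr (log_ratio (p \<theta>0 (x 0) (x 1)) (p \<theta> (x 0) (x 1))) s \<partial>chain_law mu p q 1 \<theta>0)
          \<le> C_const mu p q \<theta>0 s * ennreal (e powr s)}"

(* Open balls with centres anywhere in the ambient set S; \<infinity> if there is no finite cover. *)
definition covering_number :: "'p set \<Rightarrow> real \<Rightarrow> 'p set \<Rightarrow> ('p \<Rightarrow> 'p \<Rightarrow> real) \<Rightarrow> enat" where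
  "covering_number S r A d =
     (INF F\<in>{F. finite F \<and> F \<subseteq> S \<and> A \<subseteq> (\<Union>c\<in>F. {t\<in>S. d t c < r})}. enat (card F))"

definition ln_enat :: "enat \<Rightarrow> ereal" where
  "ln_enat N = (case N of enat m \<Rightarrow> if m = 0 then - \<infinity> else ereal (ln (real m)) | \<infinity> \<Rightarrow> \<infinity>)"

(* For every alternative \<theta>1 there is a test of \<theta>0 against the d-ball of radius d \<theta>0 \<theta>1 / 8 around
   \<theta>1 with both errors at most exp (-K n d^2); existence of such a K is a theorem of Birge. *)
definition testing_constant ::
  "'a measure \<Rightarrow> 'p measure \<Rightarrow> ('p \<Rightarrow> 'a \<Rightarrow> 'a \<Rightarrow> real) \<Rightarrow> ('p \<Rightarrow> 'a \<Rightarrow> real) \<Rightarrow> ('p \<Rightarrow> 'p \<Rightarrow> real)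
     \<Rightarrow> 'p \<Rightarrow> real \<Rightarrow> bool" where
  "testing_constant mu T p q d \<theta>0 K \<longleftrightarrow> 0 < K \<and>
     (\<forall>n. \<forall>\<theta>1\<in>space T. \<exists>\<phi>\<in>borel_measurable (Pi\<^sub>M {..n} (\<lambda>_. mu)).
        (\<forall>x. 0 \<le> \<phi> x \<and> \<phi> x \<le> 1) \<and>
        (\<integral>x. \<phi> x \<partial>chain_law mu p q n \<theta>0) \<le> exp (- K * real n * (d \<theta>0 \<theta>1)\<^sup>2) \<and>
        (\<forall>\<theta>\<in>space T. d \<theta> \<theta>1 \<le> d \<theta>0 \<theta>1 / 8 \<longrightarrow>
           (\<integral>x. 1 - \<phi> x \<partial>chain_law mu p q n \<theta>) \<le> exp (- K * real n * (d \<theta>0 \<theta>1)\<^sup>2)))"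

end

theory Submission
  imports Defs
begin

text \<open>Write \<open>x = n eps\<^sup>2\<close>. If for every \<open>\<theta>\<close> in \<open>Bstar\<close> the likelihood ratio of \<open>\<theta>\<close> to \<open>\<theta>0\<close> exceeds
  \<open>exp (- (2 x + L))\<close> with probability at least \<open>1 - C / L\<close>, then by Markov's inequality and Fubini the
  normalising integral of the posterior exceeds half the prior mass of \<open>Bstar\<close> times
  \<open>exp (- (2 x + L))\<close> times the likelihood of \<open>\<theta>0\<close>, up to probability \<open>2 C / L\<close>. The bound on the
  likelihood ratio is Chebyshev's inequality: the variance of the log-likelihood is of order \<open>x\<close>, because covariances of
  the log transition ratios decay like \<open>\<alpha>\<^sub>h\<close> to the power \<open>1 - 2/s\<close> (truncation at a level depending on
  the lag, plus the Markov property). On the good event the posterior mass of \<open>\<Theta> - \<Theta>\<^sub>n\<close> is controlled by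
  the prior mass condition, and that of the \<open>j\<close>-th annulus by a union of tests over a minimal cover,
  which leaves a geometrically small term in \<open>j\<close>. First let \<open>n\<close>, then \<open>L\<close> tend to infinity; this is
  why \<open>x\<close> may stay bounded.\<close>

section \<open>Stationary Markov chains\<close>

text \<open>The slack \<open>L\<close> is kept apart from x because a slack proportional to x alone
  would leave a failure probability of order 1 / x, which need not vanish when x stays bounded. With
  the extra \<open>L\<close>, Chebyshev's inequality leads to x / (x + L)^2, and this is at most 1 /
  (4 L) whatever x is. For this the variance must be of order x and not merely of order n. The power
  in C_s serves exactly that purpose: raised to the power 2 / s, the moment bound C_s eps^s becomes
  eps^2 divided by a multiple of the mixing sum, so every covariance is eps^2 times a summable
  weight. On the testing side, annulus j loses exp (2 x) to the evidence and exp (K x j^2 / 8) to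
  the ratio of prior masses, and gains exp (- K x j^2 / 4) from the tests. As x is at least 2, the
  balance is geometrically small in j, uniformly in x.\<close>

lemma likelihood_lessThan:
  "likelihood p q n \<theta> x = q \<theta> (x 0) * (\<Prod>i<n. p \<theta> (x i) (x (Suc i)))"
  unfolding likelihood_def by (simp add: prod.atLeast1_atMost_eq)

text \<open>\<open>p\<close> and \<open>q\<close> remain whole families with one distinguished
  parameter, so that \<open>chain_law\<close>, \<open>mixing_coeff\<close> and
  \<open>C_const\<close> apply to them as they stand.\<close>

locale stationary_chain = sigma_finite_measure mu
  for mu :: "'a measure" +
  fixes p :: "'p \<Rightarrow> 'a \<Rightarrow> 'a \<Rightarrow> real" and q :: "'p \<Rightarrow> 'a \<Rightarrow> real" and \<theta> :: 'p
  assumes transition: "transition_density mu (p \<theta>)"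
    and stationary: "stationary_density mu (p \<theta>) (q \<theta>)"
begin

abbreviation chain :: "nat \<Rightarrow> (nat \<Rightarrow> 'a) measure" where
  "chain n \<equiv> chain_law mu p q n \<theta>"

definition Q :: "'a measure" where
  "Q = density mu (\<lambda>x. ennreal (q \<theta> x))"

text \<open>The transition operator of the chain. On \<open>ennreal\<close>-valued functions its
  powers serve as conditional expectations several steps ahead, free of integrability
  conditions.\<close>

definition kernel :: "('a \<Rightarrow> ennreal) \<Rightarrow> 'a \<Rightarrow> ennreal" where
  "kernel g x = (\<integral>\<^sup>+ y. ennreal (p \<theta> x y) * g y \<partial>mu)"

lemma p_measurable': "(\<lambda>(x, y). p \<theta> x y) \<in> borel_measurable (mu \<Otimes>\<^sub>M mu)"
  using transition by (simp add: transition_density_def)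

lemma p_measurable [measurable (raw)]:
  assumes "f \<in> measurable N mu" "g \<in> measurable N mu"
  shows "(\<lambda>w. p \<theta> (f w) (g w)) \<in> borel_measurable N"
  using measurable_compose[OF measurable_Pair[OF assms] p_measurable'] by simp

lemma p_nonneg: "x \<in> space mu \<Longrightarrow> y \<in> space mu \<Longrightarrow> 0 \<le> p \<theta> x y"
  using transition by (simp add: transition_density_def)

lemma q_measurable [measurable]: "q \<theta> \<in> borel_measurable mu"
  using stationary by (simp add: stationary_density_def)

lemma q_nonneg: "x \<in> space mu \<Longrightarrow> 0 \<le> q \<theta> x"
  using stationary by (simp add: stationary_density_def)

lemma prob_space_Q: "prob_space Q"
  using stationary by (simp add: stationary_density_def Q_def)

lemma sets_Q [measurable_cong, simp]: "sets Q = sets mu"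
  by (simp add: Q_def)

lemma space_Q [simp]: "space Q = space mu"
  by (simp add: Q_def)

lemma kernel_1: "x \<in> space mu \<Longrightarrow> kernel (\<lambda>_. 1) x = 1"
  using transition prob_space.emeasure_space_1[of "density mu (\<lambda>y. ennreal (p \<theta> x y))"]
  by (auto simp: transition_density_def kernel_def emeasure_density cong: nn_integral_cong)

lemma kernel_measurable [measurable]:
  assumes [measurable]: "g \<in> borel_measurable mu"
  shows "kernel g \<in> borel_measurable mu"
  unfolding kernel_def by measurable

lemma kernel_pow_measurable [measurable]:
  "g \<in> borel_measurable mu \<Longrightarrow> (kernel ^^ m) g \<in> borel_measurable mu"
  by (induction m) auto

lemma kernel_mono_1:
  assumes "\<And>x. x \<in> space mu \<Longrightarrow> g x \<le> 1" and x: "x \<in> space mu"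
  shows "kernel g x \<le> 1"
proof -
  have "kernel g x \<le> kernel (\<lambda>_. 1) x"
    unfolding kernel_def by (intro nn_integral_mono mult_left_mono assms) auto
  then show ?thesis using kernel_1[OF x] by simp
qed

lemma kernel_pow_le_1:
  assumes "\<And>x. x \<in> space mu \<Longrightarrow> g x \<le> 1" and x: "x \<in> space mu"
  shows "(kernel ^^ m) g x \<le> 1"
  using x by (induction m arbitrary: x) (auto intro!: kernel_mono_1 assms)

text \<open>Stationarity is given through \<open>bind\<close>; here it is tested against functions.
  \<open>nn_integral_bind\<close> asks for measurability of the kernel into
  \<open>subprob_algebra\<close>, which occupies the first half of the proof.\<close>

lemma nn_integral_kernel_Q:
  assumes [measurable]: "g \<in> borel_measurable mu"
  shows "(\<integral>\<^sup>+ x. kernel g x \<partial>Q) = (\<integral>\<^sup>+ x. g x \<partial>Q)"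
proof -
  let ?K = "\<lambda>x. density mu (\<lambda>y. ennreal (p \<theta> x y))"
  have K: "?K \<in> measurable Q (subprob_algebra mu)"
  proof (rule measurable_subprob_algebra)
    fix A assume A [measurable]: "A \<in> sets mu"
    have "(\<lambda>x. kernel (indicator A) x) \<in> borel_measurable Q" by measurable
    moreover have "emeasure (?K x) A = kernel (indicator A) x" if "x \<in> space Q" for x
      using that by (simp add: kernel_def emeasure_density)
    ultimately show "(\<lambda>x. emeasure (?K x) A) \<in> borel_measurable Q"
      by (subst measurable_cong) auto
  qed (use transition in \<open>auto simp: transition_density_def intro: prob_space_imp_subprob_space\<close>)
  have "(\<integral>\<^sup>+ x. g x \<partial>Q) = (\<integral>\<^sup>+ x. g x \<partial>(Q \<bind> ?K))"
    using stationary by (simp add: stationary_density_def Q_def)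
  also have "\<dots> = (\<integral>\<^sup>+ x. \<integral>\<^sup>+ y. g y \<partial>?K x \<partial>Q)"
    by (rule nn_integral_bind[OF _ K]) measurable
  also have "\<dots> = (\<integral>\<^sup>+ x. kernel g x \<partial>Q)"
    by (intro nn_integral_cong) (simp add: kernel_def nn_integral_density)
  finally show ?thesis by simp
qed

section \<open>Path laws and the Markov property\<close>

lemma sets_chain [measurable_cong, simp]: "sets (chain n) = sets (Pi\<^sub>M {..n} (\<lambda>_. mu))"
  by (simp add: chain_law_def)

lemma space_chain [simp]: "space (chain n) = space (Pi\<^sub>M {..n} (\<lambda>_. mu))"
  by (simp add: chain_law_def)

lemma likelihood_measurable [measurable]:
  "likelihood p q n \<theta> \<in> borel_measurable (Pi\<^sub>M {..n} (\<lambda>_. mu))"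
  unfolding likelihood_lessThan by measurable

lemma likelihood_nonneg: "x \<in> space (Pi\<^sub>M {..n} (\<lambda>_. mu)) \<Longrightarrow> 0 \<le> likelihood p q n \<theta> x"
  unfolding likelihood_lessThan
  by (intro mult_nonneg_nonneg prod_nonneg q_nonneg ballI p_nonneg)
    (auto simp: space_PiM PiE_iff)

lemma nn_integral_chain:
  assumes "F \<in> borel_measurable (Pi\<^sub>M {..n} (\<lambda>_. mu))"
  shows "(\<integral>\<^sup>+ x. F x \<partial>chain n)
    = (\<integral>\<^sup>+ x. ennreal (likelihood p q n \<theta> x) * F x \<partial>Pi\<^sub>M {..n} (\<lambda>_. mu))"
  unfolding chain_law_def using assms by (intro nn_integral_density) measurable

lemma nn_integral_chain_0:
  assumes [measurable]: "g \<in> borel_measurable mu"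
  shows "(\<integral>\<^sup>+ x. g (x 0) \<partial>chain 0) = (\<integral>\<^sup>+ x. g x \<partial>Q)"
proof -
  interpret product_sigma_finite "\<lambda>_::nat. mu"
    by standard
  have "(\<integral>\<^sup>+ x. g (x 0) \<partial>chain 0) = (\<integral>\<^sup>+ x. ennreal (q \<theta> (x 0)) * g (x 0) \<partial>Pi\<^sub>M {0::nat} (\<lambda>_. mu))"
    by (subst nn_integral_chain) (simp_all add: likelihood_lessThan atMost_0)
  also have "\<dots> = (\<integral>\<^sup>+ x. ennreal (q \<theta> x) * g x \<partial>mu)"
    by (rule product_nn_integral_singleton) measurable
  also have "\<dots> = (\<integral>\<^sup>+ x. g x \<partial>Q)"
    by (simp add: Q_def nn_integral_density)
  finally show ?thesis .
qed

text \<open>The one-step Markov property: the last factor of the likelihood is the transition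
  density from coordinate n, so integrating out the last coordinate is an application of
  \<open>kernel\<close>.\<close>

lemma nn_integral_chain_Suc:
  assumes F: "F \<in> borel_measurable (Pi\<^sub>M {..Suc n} (\<lambda>_. mu))"
  shows "(\<integral>\<^sup>+ x. F x \<partial>chain (Suc n)) =
    (\<integral>\<^sup>+ x. kernel (\<lambda>y. F (x(Suc n := y))) (x n) \<partial>chain n)"
proof -
  interpret product_sigma_finite "\<lambda>_::nat. mu"
    by standard
  have F' [measurable]: "F \<in> borel_measurable (Pi\<^sub>M (insert (Suc n) {..n}) (\<lambda>_. mu))"
    using F by (simp add: atMost_Suc)
  have lik_m [measurable]:
    "likelihood p q (Suc n) \<theta> \<in> borel_measurable (Pi\<^sub>M (insert (Suc n) {..n}) (\<lambda>_. mu))"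
    using likelihood_measurable[of "Suc n"] by (simp add: atMost_Suc)
  have lik: "ennreal (likelihood p q (Suc n) \<theta> (x(Suc n := y)))
      = ennreal (likelihood p q n \<theta> x) * ennreal (p \<theta> (x n) y)"
    if "x \<in> space (Pi\<^sub>M {..n} (\<lambda>_. mu))" "y \<in> space mu" for x y
  proof -
    have "likelihood p q (Suc n) \<theta> (x(Suc n := y)) = likelihood p q n \<theta> x * p \<theta> (x n) y"
      by (simp add: likelihood_lessThan)
    moreover have "x n \<in> space mu" using that by (auto simp: space_PiM)
    ultimately show ?thesis
      using likelihood_nonneg[OF that(1)] by (simp add: ennreal_mult p_nonneg that)
  qed
  have upd [measurable]: "(\<lambda>(x, y). F (x(Suc n := y))) \<in> borel_measurable (Pi\<^sub>M {..n} (\<lambda>_. mu) \<Otimes>\<^sub>M mu)"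
    by measurable
  have "(\<integral>\<^sup>+ x. F x \<partial>chain (Suc n)) = (\<integral>\<^sup>+ x. ennreal (likelihood p q (Suc n) \<theta> x) * F x
      \<partial>Pi\<^sub>M (insert (Suc n) {..n}) (\<lambda>_. mu))"
    by (subst nn_integral_chain[OF F]) (simp add: atMost_Suc)
  also have "\<dots> = (\<integral>\<^sup>+ x. \<integral>\<^sup>+ y. ennreal (likelihood p q (Suc n) \<theta> (x(Suc n := y))) * F (x(Suc n := y))
      \<partial>mu \<partial>Pi\<^sub>M {..n} (\<lambda>_. mu))"
    by (rule product_nn_integral_insert) auto
  also have "\<dots> = (\<integral>\<^sup>+ x. ennreal (likelihood p q n \<theta> x) * kernel (\<lambda>y. F (x(Suc n := y))) (x n)
      \<partial>Pi\<^sub>M {..n} (\<lambda>_. mu))"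
  proof (rule nn_integral_cong)
    fix x assume x: "x \<in> space (Pi\<^sub>M {..n} (\<lambda>_. mu))"
    have [measurable]: "(\<lambda>y. F (x(Suc n := y))) \<in> borel_measurable mu"
      using x by measurable
    have [simp]: "x n \<in> space mu" using x by (auto simp: space_PiM)
    show "(\<integral>\<^sup>+ y. ennreal (likelihood p q (Suc n) \<theta> (x(Suc n := y))) * F (x(Suc n := y)) \<partial>mu)
      = ennreal (likelihood p q n \<theta> x) * kernel (\<lambda>y. F (x(Suc n := y))) (x n)"
      unfolding kernel_def
      by (subst nn_integral_cmult[symmetric], simp) (auto intro!: nn_integral_cong
          simp: lik x mult.assoc)
  qed
  also have "\<dots> = (\<integral>\<^sup>+ x. kernel (\<lambda>y. F (x(Suc n := y))) (x n) \<partial>chain n)"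
    by (subst nn_integral_chain) (auto simp: kernel_def)
  finally show ?thesis .
qed

lemma nn_integral_chain_marginal:
  assumes "g \<in> borel_measurable mu"
  shows "(\<integral>\<^sup>+ x. g (x n) \<partial>chain n) = (\<integral>\<^sup>+ x. g x \<partial>Q)"
  using assms
proof (induction n arbitrary: g)
  case 0
  then show ?case by (rule nn_integral_chain_0)
next
  case (Suc n)
  note [measurable] = Suc.prems
  have "(\<integral>\<^sup>+ x. g (x (Suc n)) \<partial>chain (Suc n)) = (\<integral>\<^sup>+ x. kernel g (x n) \<partial>chain n)"
    by (subst nn_integral_chain_Suc) (simp_all add: kernel_def)
  also have "\<dots> = (\<integral>\<^sup>+ x. kernel g x \<partial>Q)"
    by (rule Suc.IH) measurable
  finally show ?case using nn_integral_kernel_Q Suc.prems by simp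
qed

lemma prob_space_chain: "prob_space (chain n)"
proof
  have "emeasure (chain n) (space (chain n)) = (\<integral>\<^sup>+ x. 1 \<partial>chain n)" by simp
  also have "\<dots> = (\<integral>\<^sup>+ x. 1 \<partial>Q)" by (rule nn_integral_chain_marginal) simp
  also have "\<dots> = 1" using prob_space.emeasure_space_1[OF prob_space_Q] by simp
  finally show "emeasure (chain n) (space (chain n)) = 1" .
qed

text \<open>\<open>G\<close> is a function of the past up to time i. It is described by invariance
  under later updates, together with measurability on every longer product, because the same
  \<open>G\<close> is integrated over path spaces of different lengths.\<close>

lemma nn_integral_chain_forward:
  fixes G :: "(nat \<Rightarrow> 'a) \<Rightarrow> ennreal"
  assumes G: "\<And>x j y. i < j \<Longrightarrow> G (x(j := y)) = G x"
    and Gm: "\<And>n. i \<le> n \<Longrightarrow> G \<in> borel_measurable (Pi\<^sub>M {..n} (\<lambda>_. mu))"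
    and g: "g \<in> borel_measurable mu"
  shows "(\<integral>\<^sup>+ x. G x * g (x (i + m)) \<partial>chain (i + m)) = (\<integral>\<^sup>+ x. G x * (kernel ^^ m) g (x i) \<partial>chain i)"
  using g
proof (induction m arbitrary: g)
  case 0
  then show ?case by simp
next
  case (Suc m)
  note [measurable] = Suc.prems
  have [measurable]: "G \<in> borel_measurable (Pi\<^sub>M {..i + m} (\<lambda>_. mu))" 
    "G \<in> borel_measurable (Pi\<^sub>M {..Suc (i + m)} (\<lambda>_. mu))" using Gm by auto
  have "(\<integral>\<^sup>+ x. G x * g (x (i + Suc m)) \<partial>chain (i + Suc m))
      = (\<integral>\<^sup>+ x. kernel (\<lambda>y. G (x(Suc (i+m) := y)) * g y) (x (i + m)) \<partial>chain (i + m))"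
    by (simp, subst nn_integral_chain_Suc) simp_all
  also have "\<dots> = (\<integral>\<^sup>+ x. G x * kernel g (x (i + m)) \<partial>chain (i + m))"
  proof (rule nn_integral_cong)
    fix x assume "x \<in> space (chain (i + m))"
    then have [simp]: "x (i + m) \<in> space mu" by (auto simp: space_PiM)
    show "kernel (\<lambda>y. G (x(Suc (i+m) := y)) * g y) (x (i + m)) = G x * kernel g (x (i + m))"
      unfolding kernel_def using G[of "Suc (i + m)" x]
      by (subst nn_integral_cmult[symmetric]) (auto intro!: nn_integral_cong simp: mult_ac)
  qed
  also have "\<dots> = (\<integral>\<^sup>+ x. G x * (kernel ^^ m) (kernel g) (x i) \<partial>chain i)"
    by (rule Suc.IH) measurable
  finally show ?case by (simp add: funpow_swap1)
qed

end

section \<open>Covariance inequalities\<close>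

text \<open>The sum counts the k with k / n at most t, and there are floor (n t) of them.\<close>

lemma floor_step_approx:
  fixes t :: real
  assumes "0 \<le> t" "t \<le> 1" "0 < n"
  shows "\<bar>t - (\<Sum>k=1..n. indicator {real k / real n..} t) / real n\<bar> \<le> 1 / real n"
proof -
  define m where "m = nat \<lfloor>real n * t\<rfloor>"
  have "real n * t \<le> real n" using assms by (simp add: mult_left_le)
  then have mn: "m \<le> n" unfolding m_def by linarith
  have m: "real m \<le> real n * t" "real n * t < real m + 1"
    using assms unfolding m_def by (simp_all add: floor_less_cancel)
  have "real k / real n \<le> t \<longleftrightarrow> k \<le> m" for k
  proof -
    have "real k / real n \<le> t \<longleftrightarrow> real k \<le> real n * t" using assms by (simp add: field_simps)
    also have "\<dots> \<longleftrightarrow> k \<le> m" using m by linarith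
    finally show ?thesis .
  qed
  then have "(\<Sum>k=1..n. indicator {real k / real n..} t :: real) = (\<Sum>k=1..n. if k \<le> m then 1 else 0)"
    by (intro sum.cong) (auto simp: indicator_def)
  also have "\<dots> = real m"
  proof -
    have "{1..n} \<inter> {k. k \<le> m} = {1..m}" using mn by auto
    then show ?thesis by (simp add: sum.If_cases)
  qed
  finally have eq: "(\<Sum>k=1..n. indicator {real k / real n..} t :: real) = real m" .
  have "t - real m / real n = (real n * t - real m) / real n" using assms by (simp add: field_simps)
  then show ?thesis using m unfolding eq by (simp add: divide_right_mono)
qed

text \<open>A weight with values in $[0,1]$ is an average of indicators of its superlevel sets.\<close>

lemma (in finite_measure) abs_integral_weight_le:
  fixes G :: "'a \<Rightarrow> real" and u :: "'b \<Rightarrow> real"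
  assumes X [measurable]: "X \<in> measurable M N" and G: "integrable M G"
    and u [measurable]: "u \<in> borel_measurable N"
    and u01: "\<And>x. x \<in> space N \<Longrightarrow> 0 \<le> u x \<and> u x \<le> 1"
    and bound: "\<And>A. A \<in> sets N \<Longrightarrow> \<bar>\<integral>\<omega>. indicator A (X \<omega>) * G \<omega> \<partial>M\<bar> \<le> \<alpha>"
  shows "\<bar>\<integral>\<omega>. u (X \<omega>) * G \<omega> \<partial>M\<bar> \<le> \<alpha>"
proof (rule field_le_epsilon)
  fix e :: real assume "0 < e"
  define c where "c = (\<integral>\<omega>. \<bar>G \<omega>\<bar> \<partial>M)"
  have c: "0 \<le> c" by (simp add: c_def)
  \<comment> \<open>The staircase with n steps differs from the weight by at most 1 / n, which costs
    c / n after integration against \<open>G\<close>.\<close>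
  obtain n where n: "0 < n" "c / e < real n"
    using reals_Archimedean2[of "c / e"] c \<open>0 < e\<close>
    by (metis divide_nonneg_pos gr0I linorder_not_less of_nat_0)
  define A where "A k = {x \<in> space N. real k / real n \<le> u x}" for k
  have A [measurable]: "A k \<in> sets N" for k unfolding A_def by measurable
  have [measurable]: "G \<in> borel_measurable M" using G by auto
  have XN: "X \<omega> \<in> space N" if "\<omega> \<in> space M" for \<omega> using measurable_space[OF X that] .
  let ?U = "\<lambda>\<omega>. (\<Sum>k=1..n. indicator (A k) (X \<omega>)) / real n :: real"
  have approx: "\<bar>u (X \<omega>) - ?U \<omega>\<bar> \<le> 1 / real n" if "\<omega> \<in> space M" for \<omega>
    using floor_step_approx[of "u (X \<omega>)" n] u01[OF XN[OF that]] n XN[OF that]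
    by (simp add: A_def indicator_def)
  have int_ind: "integrable M (\<lambda>\<omega>. indicator (A k) (X \<omega>) * G \<omega>)" for k
    by (rule Bochner_Integration.integrable_bound[OF G]) (auto simp: indicator_def)
  have int_u: "integrable M (\<lambda>\<omega>. u (X \<omega>) * G \<omega>)"
    using u01[OF XN] by (intro Bochner_Integration.integrable_bound[OF G])
      (auto intro!: AE_I2 simp: abs_mult mult_left_le_one_le)
  have int_U: "integrable M (\<lambda>\<omega>. ?U \<omega> * G \<omega>)"
    using int_ind by (simp add: sum_divide_distrib sum_distrib_right)
  have "\<bar>\<integral>\<omega>. ?U \<omega> * G \<omega> \<partial>M\<bar> = \<bar>(\<Sum>k=1..n. \<integral>\<omega>. indicator (A k) (X \<omega>) * G \<omega> \<partial>M) / real n\<bar>"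
    by (simp only: times_divide_eq_left sum_distrib_right integral_divide_zero
        Bochner_Integration.integral_sum[OF int_ind])
  also have "\<dots> \<le> (\<Sum>k=1..n. \<alpha>) / real n"
    unfolding abs_divide using n
    by (simp only: abs_of_nat) (intro divide_right_mono order_trans[OF sum_abs] sum_mono bound A
        of_nat_0_le_iff)
  also have "\<dots> = \<alpha>" using n by simp
  finally have 1: "\<bar>\<integral>\<omega>. ?U \<omega> * G \<omega> \<partial>M\<bar> \<le> \<alpha>" .
  have "\<bar>(\<integral>\<omega>. u (X \<omega>) * G \<omega> \<partial>M) - (\<integral>\<omega>. ?U \<omega> * G \<omega> \<partial>M)\<bar> = \<bar>\<integral>\<omega>. (u (X \<omega>) - ?U \<omega>) * G \<omega> \<partial>M\<bar>"
    using int_u int_U by (simp add: left_diff_distrib)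
  also have "\<dots> \<le> (\<integral>\<omega>. \<bar>(u (X \<omega>) - ?U \<omega>) * G \<omega>\<bar> \<partial>M)"
    using integral_abs_bound by blast
  also have "\<dots> \<le> (\<integral>\<omega>. 1 / real n * \<bar>G \<omega>\<bar> \<partial>M)"
  proof (rule integral_mono)
    show "integrable M (\<lambda>\<omega>. \<bar>(u (X \<omega>) - ?U \<omega>) * G \<omega>\<bar>)"
      using Bochner_Integration.integrable_diff[OF int_u int_U] by (simp add: left_diff_distrib)
    show "integrable M (\<lambda>\<omega>. 1 / real n * \<bar>G \<omega>\<bar>)" using G by simp
  qed (simp only: abs_mult, intro mult_right_mono approx, auto)
  also have "\<dots> = c / real n" by (simp add: c_def)
  also have "\<dots> \<le> e" using n \<open>0 < e\<close> by (simp add: field_simps)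
  finally show "\<bar>\<integral>\<omega>. u (X \<omega>) * G \<omega> \<partial>M\<bar> \<le> \<alpha> + e" using 1 by linarith
qed

section \<open>Truncation of covariances under moment bounds\<close>

definition covariance :: "'a measure \<Rightarrow> ('a \<Rightarrow> real) \<Rightarrow> ('a \<Rightarrow> real) \<Rightarrow> real" where
  "covariance M Y Z = (\<integral>\<omega>. Y \<omega> * Z \<omega> \<partial>M) - (\<integral>\<omega>. Y \<omega> \<partial>M) * (\<integral>\<omega>. Z \<omega> \<partial>M)"

lemma (in prob_space) integrable_bdd:
  fixes Y :: "'a \<Rightarrow> real"
  assumes [measurable]: "Y \<in> borel_measurable M" and "\<And>\<omega>. \<omega> \<in> space M \<Longrightarrow> \<bar>Y \<omega>\<bar> \<le> c"
  shows "integrable M Y"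
  using assms(2) by (intro integrable_const_bound[where B=c]) auto

text \<open>Split off the power s; what remains has the exponent 1 - s, which is not positive, and
  is therefore largest at the cut \<open>R\<close>.\<close>

lemma powr_truncation_1:
  fixes y R s :: real
  assumes "1 \<le> s" "0 < R" "R < \<bar>y\<bar>"
  shows "\<bar>y\<bar> \<le> \<bar>y\<bar> powr s * R powr (1 - s)"
proof -
  have "\<bar>y\<bar> = \<bar>y\<bar> powr s * \<bar>y\<bar> powr (1 - s)" using assms by (simp flip: powr_add)
  also have "\<dots> \<le> \<bar>y\<bar> powr s * R powr (1 - s)"
    using assms by (intro mult_left_mono powr_mono2') auto
  finally show ?thesis .
qed

lemma powr_truncation_2:
  fixes y R s :: real
  assumes "2 \<le> s" "0 < R" "R < \<bar>y\<bar>"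
  shows "y\<^sup>2 \<le> \<bar>y\<bar> powr s * R powr (2 - s)"
proof -
  have "y\<^sup>2 = \<bar>y\<bar> powr 2" using assms by (simp add: powr_numeral)
  also have "\<dots> = \<bar>y\<bar> powr s * \<bar>y\<bar> powr (2 - s)" using assms by (simp flip: powr_add)
  also have "\<dots> \<le> \<bar>y\<bar> powr s * R powr (2 - s)"
    using assms by (intro mult_left_mono powr_mono2') auto
  finally show ?thesis .
qed

text \<open>Large values are replaced by 0 rather than clipped to R: the remainder is then either 0
  or the full value, and the two truncation inequalities apply to it directly.\<close>

definition trunc :: "real \<Rightarrow> real \<Rightarrow> real" where
  "trunc R y = (if \<bar>y\<bar> \<le> R then y else 0)"

lemma trunc_measurable [measurable]: "trunc R \<in> borel_measurable borel"
  unfolding trunc_def by measurable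

lemma abs_trunc_le: "0 \<le> R \<Longrightarrow> \<bar>trunc R y\<bar> \<le> R"
  by (simp add: trunc_def)

lemma abs_sum_diff_le:
  fixes a b c :: real
  assumes "\<bar>a\<bar> \<le> c" "\<bar>b1\<bar> \<le> b" "\<bar>b2\<bar> \<le> b" "\<bar>b3\<bar> \<le> b" "\<bar>b4\<bar> \<le> b" "\<bar>b5\<bar> \<le> b" "\<bar>b6\<bar> \<le> b"
  shows "\<bar>a + b1 + b2 + b3 - b4 - b5 - b6\<bar> \<le> c + 6 * b"
  using assms unfolding abs_le_iff by simp

context prob_space
begin

text \<open>Below the cut the square is at most R^2; above it, and this is the only place where the
  remainder \<open>Z\<close> lives, the s-th moment takes over. \<open>R\<close> is left free
  because it will be tuned to each lag.\<close>

lemma moment_facts: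
  fixes Y :: "'a \<Rightarrow> real"
  assumes [measurable]: "Y \<in> borel_measurable M" and s: "2 \<le> s" and R: "0 < R"
    and int: "integrable M (\<lambda>\<omega>. \<bar>Y \<omega>\<bar> powr s)" and m: "(\<integral>\<omega>. \<bar>Y \<omega>\<bar> powr s \<partial>M) \<le> m"
  defines "Z \<equiv> \<lambda>\<omega>. Y \<omega> - trunc R (Y \<omega>)"
  shows "integrable M (\<lambda>\<omega>. (Y \<omega>)\<^sup>2)" and "integrable M Y"
    and "(\<integral>\<omega>. (Y \<omega>)\<^sup>2 \<partial>M) \<le> R\<^sup>2 + m * R powr (2 - s)"
    and "integrable M Z" and "integrable M (\<lambda>\<omega>. (Z \<omega>)\<^sup>2)"
    and "(\<integral>\<omega>. \<bar>Z \<omega>\<bar> \<partial>M) \<le> m * R powr (1 - s)"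
    and "(\<integral>\<omega>. (Z \<omega>)\<^sup>2 \<partial>M) \<le> m * R powr (2 - s)"
proof -
  have [measurable]: "Z \<in> borel_measurable M" unfolding Z_def by measurable
  let ?S = "\<lambda>\<omega>. \<bar>Y \<omega>\<bar> powr s"
  have sq: "(Y \<omega>)\<^sup>2 \<le> R\<^sup>2 + ?S \<omega> * R powr (2 - s)" for \<omega>
  proof (cases "\<bar>Y \<omega>\<bar> \<le> R")
    case True
    then have "(Y \<omega>)\<^sup>2 \<le> R\<^sup>2" using R by (simp add: abs_le_square_iff[symmetric])
    then show ?thesis by (smt (verit) powr_ge_zero mult_nonneg_nonneg)
  next
    case False
    then show ?thesis using powr_truncation_2[OF s R, of "Y \<omega>"] by (smt (verit) zero_le_power2)
  qed
  show int2: "integrable M (\<lambda>\<omega>. (Y \<omega>)\<^sup>2)"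
  proof (rule Bochner_Integration.integrable_bound[where f="\<lambda>\<omega>. R\<^sup>2 + ?S \<omega> * R powr (2 - s)"])
    show "AE \<omega> in M. norm ((Y \<omega>)\<^sup>2) \<le> norm (R\<^sup>2 + ?S \<omega> * R powr (2 - s))"
      using sq by (intro AE_I2) (auto intro: order_trans[OF _ abs_ge_self])
  qed (use int in auto)
  show "integrable M Y"
    by (rule square_integrable_imp_integrable[OF _ int2]) measurable
  have "(\<integral>\<omega>. (Y \<omega>)\<^sup>2 \<partial>M) \<le> (\<integral>\<omega>. R\<^sup>2 + ?S \<omega> * R powr (2 - s) \<partial>M)"
    using int int2 sq by (intro integral_mono) auto
  also have "\<dots> = R\<^sup>2 + (\<integral>\<omega>. ?S \<omega> \<partial>M) * R powr (2 - s)"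
    using int by (simp add: prob_space)
  also have "\<dots> \<le> R\<^sup>2 + m * R powr (2 - s)"
    using m by (intro add_left_mono mult_right_mono) auto
  finally show "(\<integral>\<omega>. (Y \<omega>)\<^sup>2 \<partial>M) \<le> R\<^sup>2 + m * R powr (2 - s)" .
  have z1: "\<bar>Z \<omega>\<bar> \<le> ?S \<omega> * R powr (1 - s)" for \<omega>
    unfolding Z_def trunc_def using powr_truncation_1[OF _ R, of s "Y \<omega>"] s by auto
  have z2: "(Z \<omega>)\<^sup>2 \<le> ?S \<omega> * R powr (2 - s)" for \<omega>
    unfolding Z_def trunc_def using powr_truncation_2[OF s R, of "Y \<omega>"] by auto
  show iz1: "integrable M Z"
    by (rule Bochner_Integration.integrable_bound[where f="\<lambda>\<omega>. ?S \<omega> * R powr (1 - s)"])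
      (use int z1 in \<open>auto intro!: AE_I2 simp: abs_mult\<close>)
  show iz2: "integrable M (\<lambda>\<omega>. (Z \<omega>)\<^sup>2)"
    by (rule Bochner_Integration.integrable_bound[where f="\<lambda>\<omega>. ?S \<omega> * R powr (2 - s)"])
      (use int z2 in \<open>auto intro!: AE_I2 simp: abs_mult\<close>)
  have "(\<integral>\<omega>. \<bar>Z \<omega>\<bar> \<partial>M) \<le> (\<integral>\<omega>. ?S \<omega> * R powr (1 - s) \<partial>M)"
    using int iz1 z1 by (intro integral_mono) auto
  also have "\<dots> \<le> m * R powr (1 - s)" using int m by (simp add: mult_right_mono)
  finally show "(\<integral>\<omega>. \<bar>Z \<omega>\<bar> \<partial>M) \<le> m * R powr (1 - s)" .
  have "(\<integral>\<omega>. (Z \<omega>)\<^sup>2 \<partial>M) \<le> (\<integral>\<omega>. ?S \<omega> * R powr (2 - s) \<partial>M)"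
    using int iz2 z2 by (intro integral_mono) auto
  also have "\<dots> \<le> m * R powr (2 - s)" using int m by (simp add: mult_right_mono)
  finally show "(\<integral>\<omega>. (Z \<omega>)\<^sup>2 \<partial>M) \<le> m * R powr (2 - s)" .
qed

text \<open>By bilinearity the covariance of the truncated parts is accompanied by three mixed
  expectations and three products of means, which is the origin of the factor 6. A bounded part
  times a remainder is estimated in L1, two remainders by the arithmetic-geometric mean
  inequality.\<close>

lemma covariance_truncation:
  fixes Y Z :: "'a \<Rightarrow> real"
  assumes [measurable]: "Y \<in> borel_measurable M" "Z \<in> borel_measurable M"
    and s: "2 \<le> s" and R: "0 < R"
    and Y: "integrable M (\<lambda>\<omega>. \<bar>Y \<omega>\<bar> powr s)" "(\<integral>\<omega>. \<bar>Y \<omega>\<bar> powr s \<partial>M) \<le> m"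
    and Z: "integrable M (\<lambda>\<omega>. \<bar>Z \<omega>\<bar> powr s)" "(\<integral>\<omega>. \<bar>Z \<omega>\<bar> powr s \<partial>M) \<le> m"
    and tr: "\<bar>covariance M (\<lambda>\<omega>. trunc R (Y \<omega>)) (\<lambda>\<omega>. trunc R (Z \<omega>))\<bar> \<le> c"
  shows "\<bar>covariance M Y Z\<bar> \<le> c + 6 * (m * R powr (2 - s))"
proof -
  define Y1 Z1 Y2 Z2 where "Y1 = (\<lambda>\<omega>. trunc R (Y \<omega>))" "Z1 = (\<lambda>\<omega>. trunc R (Z \<omega>))"
    "Y2 = (\<lambda>\<omega>. Y \<omega> - trunc R (Y \<omega>))" "Z2 = (\<lambda>\<omega>. Z \<omega> - trunc R (Z \<omega>))"
  note defs = this
  have [measurable]: "Y1 \<in> borel_measurable M" "Z1 \<in> borel_measurable M" 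
    "Y2 \<in> borel_measurable M" "Z2 \<in> borel_measurable M" unfolding defs by measurable
  note mY = moment_facts[OF assms(1) s R Y, folded fun_cong[OF defs(3)]]
  note mZ = moment_facts[OF assms(2) s R Z, folded fun_cong[OF defs(4)]]
  define b where "b = m * R powr (2 - s)"
  \<comment> \<open>The bounded factor contributes R and the L1 norm of the remainder m R^(1 - s);
    their product is again \<open>b\<close>, so that all six errors share one bound.\<close>
  have bR: "R * (m * R powr (1 - s)) = b"
    using R by (simp add: b_def powr_diff field_simps power2_eq_square)
  have Y1b: "\<bar>Y1 \<omega>\<bar> \<le> R" and Z1b: "\<bar>Z1 \<omega>\<bar> \<le> R" for \<omega>
    using R by (auto simp: defs intro!: abs_trunc_le)
  have iY1: "integrable M Y1" and iZ1: "integrable M Z1"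
    by (rule integrable_bdd[where c=R]; use Y1b Z1b in simp)+
  have mult_int: "integrable M (\<lambda>\<omega>. f \<omega> * g \<omega>)" and mult_le: "\<bar>\<integral>\<omega>. f \<omega> * g \<omega> \<partial>M\<bar> \<le> b"
    if [measurable]: "f \<in> borel_measurable M" and f: "\<And>\<omega>. \<bar>f \<omega>\<bar> \<le> R"
        and g: "integrable M g" "(\<integral>\<omega>. \<bar>g \<omega>\<bar> \<partial>M) \<le> m * R powr (1 - s)"
    for f g :: "'a \<Rightarrow> real"
  proof -
    have [measurable]: "g \<in> borel_measurable M" using g by auto
    have le: "\<bar>f \<omega> * g \<omega>\<bar> \<le> R * \<bar>g \<omega>\<bar>" for \<omega> using f[of \<omega>] by (simp add: abs_mult mult_right_mono)
    show i: "integrable M (\<lambda>\<omega>. f \<omega> * g \<omega>)"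
      by (rule Bochner_Integration.integrable_bound[where f="\<lambda>\<omega>. R * \<bar>g \<omega>\<bar>"])
        (use g le R in \<open>auto intro!: AE_I2 simp: abs_mult\<close>)
    have "\<bar>\<integral>\<omega>. f \<omega> * g \<omega> \<partial>M\<bar> \<le> (\<integral>\<omega>. \<bar>f \<omega> * g \<omega>\<bar> \<partial>M)" using integral_abs_bound by blast
    also have "\<dots> \<le> (\<integral>\<omega>. R * \<bar>g \<omega>\<bar> \<partial>M)"
      using i g le by (intro integral_mono) auto
    also have "\<dots> \<le> b" using g R bR by (simp add: mult_left_mono flip: bR)
    finally show "\<bar>\<integral>\<omega>. f \<omega> * g \<omega> \<partial>M\<bar> \<le> b" .
  qed
  have prod_le: "\<bar>(\<integral>\<omega>. f \<omega> \<partial>M) * (\<integral>\<omega>. g \<omega> \<partial>M)\<bar> \<le> b"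
    if [measurable]: "f \<in> borel_measurable M" and f: "\<And>\<omega>. \<bar>f \<omega>\<bar> \<le> R"
        and g: "integrable M g" "(\<integral>\<omega>. \<bar>g \<omega>\<bar> \<partial>M) \<le> m * R powr (1 - s)"
    for f g :: "'a \<Rightarrow> real"
  proof -
    have "\<bar>\<integral>\<omega>. f \<omega> \<partial>M\<bar> \<le> (\<integral>\<omega>. \<bar>f \<omega>\<bar> \<partial>M)" using integral_abs_bound by blast
    also have "\<dots> \<le> (\<integral>\<omega>. R \<partial>M)"
      using f R by (intro integral_mono) (auto intro: integrable_bdd[where c=R])
    also have "\<dots> = R" by (simp add: prob_space)
    finally have "\<bar>\<integral>\<omega>. f \<omega> \<partial>M\<bar> \<le> R" .
    moreover have "\<bar>\<integral>\<omega>. g \<omega> \<partial>M\<bar> \<le> m * R powr (1 - s)" using integral_abs_bound g(2) by (rule order_trans)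
    ultimately show ?thesis unfolding abs_mult bR[symmetric] using R by (intro mult_mono) auto
  qed
  have Y2Z2: "\<bar>Y2 \<omega> * Z2 \<omega>\<bar> \<le> ((Y2 \<omega>)\<^sup>2 + (Z2 \<omega>)\<^sup>2) / 2" for \<omega>
    using sum_squares_bound[of "\<bar>Y2 \<omega>\<bar>" "\<bar>Z2 \<omega>\<bar>"] by (simp add: abs_mult)
  have i22: "integrable M (\<lambda>\<omega>. Y2 \<omega> * Z2 \<omega>)"
    by (rule Bochner_Integration.integrable_bound[where f="\<lambda>\<omega>. ((Y2 \<omega>)\<^sup>2 + (Z2 \<omega>)\<^sup>2) / 2"])
      (use mY mZ Y2Z2 in \<open>auto intro!: AE_I2\<close>)
  have b22: "\<bar>\<integral>\<omega>. Y2 \<omega> * Z2 \<omega> \<partial>M\<bar> \<le> b"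
  proof -
    have "\<bar>\<integral>\<omega>. Y2 \<omega> * Z2 \<omega> \<partial>M\<bar> \<le> (\<integral>\<omega>. \<bar>Y2 \<omega> * Z2 \<omega>\<bar> \<partial>M)" using integral_abs_bound by blast
    also have "\<dots> \<le> (\<integral>\<omega>. ((Y2 \<omega>)\<^sup>2 + (Z2 \<omega>)\<^sup>2) / 2 \<partial>M)"
      using i22 mY mZ Y2Z2 by (intro integral_mono) auto
    also have "\<dots> \<le> b" using mY mZ by (simp add: b_def)
    finally show ?thesis .
  qed
  have sqmean: "(\<integral>\<omega>. f \<omega> \<partial>M)\<^sup>2 \<le> b"
    if "integrable M f" "integrable M (\<lambda>\<omega>. (f \<omega>)\<^sup>2)" "(\<integral>\<omega>. (f \<omega>)\<^sup>2 \<partial>M) \<le> b" for f :: "'a \<Rightarrow> real"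
    using variance_positive[of f] variance_eq[OF that(1,2)] that(3) by linarith
  have p22: "\<bar>(\<integral>\<omega>. Y2 \<omega> \<partial>M) * (\<integral>\<omega>. Z2 \<omega> \<partial>M)\<bar> \<le> b"
    using sum_squares_bound[of "\<bar>\<integral>\<omega>. Y2 \<omega> \<partial>M\<bar>" "\<bar>\<integral>\<omega>. Z2 \<omega> \<partial>M\<bar>"]
      sqmean[OF mY(4,5)] sqmean[OF mZ(4,5)] mY(7) mZ(7) by (simp add: abs_mult b_def)
  have i11: "integrable M (\<lambda>\<omega>. Y1 \<omega> * Z1 \<omega>)"
    by (rule integrable_bdd[where c="R * R"]) (use Y1b Z1b R in \<open>auto simp: abs_mult intro!: mult_mono\<close>)
  note i12 = mult_int[of Y1, OF _ Y1b mZ(4,6)] and i21 = mult_int[of Z1, OF _ Z1b mY(4,6)]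
  have YZ: "Y \<omega> * Z \<omega> = Y1 \<omega> * Z1 \<omega> + Y1 \<omega> * Z2 \<omega> + Z1 \<omega> * Y2 \<omega> + Y2 \<omega> * Z2 \<omega>" for \<omega>
    by (simp add: defs algebra_simps)
  have EYZ: "(\<integral>\<omega>. Y \<omega> * Z \<omega> \<partial>M) = (\<integral>\<omega>. Y1 \<omega> * Z1 \<omega> \<partial>M) + (\<integral>\<omega>. Y1 \<omega> * Z2 \<omega> \<partial>M)
      + (\<integral>\<omega>. Z1 \<omega> * Y2 \<omega> \<partial>M) + (\<integral>\<omega>. Y2 \<omega> * Z2 \<omega> \<partial>M)"
    unfolding YZ using i11 i12 i21 i22 by simp
  have EY: "(\<integral>\<omega>. Y \<omega> \<partial>M) = (\<integral>\<omega>. Y1 \<omega> \<partial>M) + (\<integral>\<omega>. Y2 \<omega> \<partial>M)"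
    using iY1 mY(4) by (subst Bochner_Integration.integral_add[symmetric]) (auto simp: defs)
  have EZ: "(\<integral>\<omega>. Z \<omega> \<partial>M) = (\<integral>\<omega>. Z1 \<omega> \<partial>M) + (\<integral>\<omega>. Z2 \<omega> \<partial>M)"
    using iZ1 mZ(4) by (subst Bochner_Integration.integral_add[symmetric]) (auto simp: defs)
  have "covariance M Y Z = covariance M Y1 Z1 + (\<integral>\<omega>. Y1 \<omega> * Z2 \<omega> \<partial>M)
      + (\<integral>\<omega>. Z1 \<omega> * Y2 \<omega> \<partial>M) + (\<integral>\<omega>. Y2 \<omega> * Z2 \<omega> \<partial>M)
      - (\<integral>\<omega>. Y1 \<omega> \<partial>M) * (\<integral>\<omega>. Z2 \<omega> \<partial>M) - (\<integral>\<omega>. Z1 \<omega> \<partial>M) * (\<integral>\<omega>. Y2 \<omega> \<partial>M)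
      - (\<integral>\<omega>. Y2 \<omega> \<partial>M) * (\<integral>\<omega>. Z2 \<omega> \<partial>M)"
    unfolding covariance_def EYZ EY EZ by (simp add: algebra_simps)
  moreover have "\<bar>covariance M Y1 Z1\<bar> \<le> c" using tr by (simp add: defs)
  ultimately show ?thesis
    unfolding b_def[symmetric]
    using abs_sum_diff_le[OF _ mult_le[of Y1, OF _ Y1b mZ(4,6)] mult_le[of Z1, OF _ Z1b mY(4,6)] b22
      prod_le[of Y1, OF _ Y1b mZ(4,6)] prod_le[of Z1, OF _ Z1b mY(4,6)] p22]
    by simp
qed

lemma variance_sum_le:
  fixes Y :: "'b \<Rightarrow> 'a \<Rightarrow> real"
  assumes "finite I" and [measurable]: "\<And>i. i \<in> I \<Longrightarrow> Y i \<in> borel_measurable M"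
    and sq: "\<And>i. i \<in> I \<Longrightarrow> integrable M (\<lambda>\<omega>. (Y i \<omega>)\<^sup>2)"
  shows "integrable M (\<lambda>\<omega>. (\<Sum>i\<in>I. Y i \<omega>)\<^sup>2)"
    and "variance (\<lambda>\<omega>. \<Sum>i\<in>I. Y i \<omega>) = (\<Sum>i\<in>I. \<Sum>j\<in>I. covariance M (Y i) (Y j))"
proof -
  have int1: "integrable M (Y i)" if "i \<in> I" for i
    using square_integrable_imp_integrable[OF assms(2) sq] that by auto
  have prod: "integrable M (\<lambda>\<omega>. Y i \<omega> * Y j \<omega>)" if "i \<in> I" "j \<in> I" for i j
  proof (rule Bochner_Integration.integrable_bound[where f="\<lambda>\<omega>. ((Y i \<omega>)\<^sup>2 + (Y j \<omega>)\<^sup>2) / 2"])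
    have "norm (Y i \<omega> * Y j \<omega>) \<le> norm (((Y i \<omega>)\<^sup>2 + (Y j \<omega>)\<^sup>2) / 2)" for \<omega>
      using sum_squares_bound[of "\<bar>Y i \<omega>\<bar>" "\<bar>Y j \<omega>\<bar>"] by (simp add: abs_mult)
    then show "AE \<omega> in M. norm (Y i \<omega> * Y j \<omega>) \<le> norm (((Y i \<omega>)\<^sup>2 + (Y j \<omega>)\<^sup>2) / 2)" by simp
  qed (use that sq in auto)
  have sq_eq: "(\<Sum>i\<in>I. Y i \<omega>)\<^sup>2 = (\<Sum>i\<in>I. \<Sum>j\<in>I. Y i \<omega> * Y j \<omega>)" for \<omega>
    by (simp add: power2_eq_square sum_product)
  show int_sq: "integrable M (\<lambda>\<omega>. (\<Sum>i\<in>I. Y i \<omega>)\<^sup>2)"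
    unfolding sq_eq using prod by auto
  have "variance (\<lambda>\<omega>. \<Sum>i\<in>I. Y i \<omega>)
      = (\<integral>\<omega>. (\<Sum>i\<in>I. Y i \<omega>)\<^sup>2 \<partial>M) - (\<integral>\<omega>. (\<Sum>i\<in>I. Y i \<omega>) \<partial>M)\<^sup>2"
    using int1 int_sq by (intro variance_eq) auto
  also have "\<dots> = (\<Sum>i\<in>I. \<Sum>j\<in>I. covariance M (Y i) (Y j))"
    unfolding sq_eq covariance_def using prod int1
    by (simp add: sum_subtractf power2_eq_square sum_product)
  finally show "variance (\<lambda>\<omega>. \<Sum>i\<in>I. Y i \<omega>) = (\<Sum>i\<in>I. \<Sum>j\<in>I. covariance M (Y i) (Y j))" .
qed

end

section \<open>Covariances along a mixing chain\<close>

context stationary_chain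
begin

lemma chain_component_measurable [measurable]:
  "i \<le> n \<Longrightarrow> (\<lambda>x. x i) \<in> measurable (chain n) mu"
  by measurable

lemma chain_coord_space: "x \<in> space (chain n) \<Longrightarrow> i \<le> n \<Longrightarrow> x i \<in> space mu"
  by (auto simp: space_PiM)

lemma PiM_component_measurable [measurable]:
  "i \<le> n \<Longrightarrow> (\<lambda>x. x i) \<in> measurable (Pi\<^sub>M {..n} (\<lambda>_. mu)) mu"
  by measurable

lemma nn_integral_coord_forward:
  assumes [measurable]: "u \<in> borel_measurable mu" "g \<in> borel_measurable mu"
  shows "(\<integral>\<^sup>+ x. u (x i) * g (x (i + m)) \<partial>chain (i + m)) = (\<integral>\<^sup>+ y. u y * (kernel ^^ m) g y \<partial>Q)"
proof -
  have "(\<integral>\<^sup>+ x. u (x i) * g (x (i + m)) \<partial>chain (i + m))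
      = (\<integral>\<^sup>+ x. u (x i) * (kernel ^^ m) g (x i) \<partial>chain i)"
    by (rule nn_integral_chain_forward) auto
  also have "\<dots> = (\<integral>\<^sup>+ y. u y * (kernel ^^ m) g y \<partial>Q)"
    by (rule nn_integral_chain_marginal) measurable
  finally show ?thesis .
qed

text \<open>By stationarity every pair of consecutive states has this law, so mean and moment
  conditions on the log transition ratio can be stated once, without reference to time.\<close>

definition pair_law :: "('a \<times> 'a) measure" where
  "pair_law = distr (chain 1) (mu \<Otimes>\<^sub>M mu) (\<lambda>x. (x 0, x 1))"

lemma sets_pair_law [measurable_cong, simp]: "sets pair_law = sets (mu \<Otimes>\<^sub>M mu)"
  by (simp add: pair_law_def)

lemma prob_space_pair_law: "prob_space pair_law"
  unfolding pair_law_def by (rule prob_space.prob_space_distr[OF prob_space_chain]) simp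

lemma kernel_section:
  assumes [measurable]: "case_prod u \<in> borel_measurable (mu \<Otimes>\<^sub>M mu)"
  shows "(\<lambda>x. kernel (u x) x) \<in> borel_measurable mu"
  unfolding kernel_def by measurable

text \<open>A function of the last two states is replaced by its conditional mean given the earlier
  of them, which is then carried back m steps to time i.\<close>

lemma nn_integral_pair_last:
  fixes u :: "'a \<Rightarrow> 'a \<Rightarrow> ennreal"
  assumes [measurable]: "case_prod u \<in> borel_measurable (mu \<Otimes>\<^sub>M mu)"
    and G: "\<And>x j y. i < j \<Longrightarrow> G (x(j := y)) = G x"
    and Gm: "\<And>n. i \<le> n \<Longrightarrow> G \<in> borel_measurable (Pi\<^sub>M {..n} (\<lambda>_. mu))"
  shows "(\<integral>\<^sup>+ x. G x * u (x (i + m)) (x (Suc (i + m))) \<partial>chain (Suc (i + m))) =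
     (\<integral>\<^sup>+ x. G x * (kernel ^^ m) (\<lambda>y. kernel (u y) y) (x i) \<partial>chain i)"
proof -
  have [measurable]: "G \<in> borel_measurable (Pi\<^sub>M {..i + m} (\<lambda>_. mu))"
    "G \<in> borel_measurable (Pi\<^sub>M {..Suc (i + m)} (\<lambda>_. mu))" using Gm by auto
  have "(\<integral>\<^sup>+ x. G x * u (x (i + m)) (x (Suc (i + m))) \<partial>chain (Suc (i + m)))
     = (\<integral>\<^sup>+ x. kernel (\<lambda>y. G (x(Suc (i + m) := y)) * u (x (i + m)) y) (x (i + m)) \<partial>chain (i + m))"
    by (subst nn_integral_chain_Suc) simp_all
  also have "\<dots> = (\<integral>\<^sup>+ x. G x * kernel (u (x (i + m))) (x (i + m)) \<partial>chain (i + m))"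
  proof (rule nn_integral_cong)
    fix x assume "x \<in> space (chain (i + m))"
    then have [measurable]: "x (i + m) \<in> space mu" by (auto simp: space_PiM)
    show "kernel (\<lambda>y. G (x(Suc (i+m) := y)) * u (x (i + m)) y) (x (i + m))
        = G x * kernel (u (x (i + m))) (x (i + m))"
      unfolding kernel_def using G[of "Suc (i + m)" x]
      by (subst nn_integral_cmult[symmetric]) (auto intro!: nn_integral_cong simp: mult_ac)
  qed
  also have "\<dots> = (\<integral>\<^sup>+ x. G x * (kernel ^^ m) (\<lambda>y. kernel (u y) y) (x i) \<partial>chain i)"
    by (rule nn_integral_chain_forward[OF G Gm kernel_section]) auto
  finally show ?thesis .
qed

lemma nn_integral_chain_extend:
  assumes G: "\<And>x j y. i < j \<Longrightarrow> G (x(j := y)) = G x"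
    and Gm: "\<And>n. i \<le> n \<Longrightarrow> G \<in> borel_measurable (Pi\<^sub>M {..n} (\<lambda>_. mu))"
    and "i \<le> n"
  shows "(\<integral>\<^sup>+ x. G x \<partial>chain n) = (\<integral>\<^sup>+ x. G x \<partial>chain i)"
proof -
  obtain m where n: "n = i + m" using \<open>i \<le> n\<close> le_Suc_ex by blast
  have one: "x \<in> space mu \<Longrightarrow> (kernel ^^ m) (\<lambda>_. 1) x = 1" for x
  proof (induction m arbitrary: x)
    case (Suc m)
    have "kernel ((kernel ^^ m) (\<lambda>_. 1)) x = kernel (\<lambda>_. 1) x"
      by (subst (1 2) kernel_def) (intro nn_integral_cong, simp add: Suc.IH)
    then show ?case using kernel_1[OF Suc.prems] by simp
  qed simp
  have "(\<integral>\<^sup>+ x. G x * 1 \<partial>chain (i + m)) = (\<integral>\<^sup>+ x. G x * (kernel ^^ m) (\<lambda>_. 1) (x i) \<partial>chain i)"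
    by (rule nn_integral_chain_forward[OF G Gm]) auto
  also have "\<dots> = (\<integral>\<^sup>+ x. G x * 1 \<partial>chain i)"
    by (intro nn_integral_cong) (simp add: one chain_coord_space)
  finally show ?thesis by (simp add: n)
qed

lemma nn_integral_chain_coord:
  assumes [measurable]: "g \<in> borel_measurable mu" and "i \<le> n"
  shows "(\<integral>\<^sup>+ x. g (x i) \<partial>chain n) = (\<integral>\<^sup>+ x. g x \<partial>Q)"
  using \<open>i \<le> n\<close> nn_integral_chain_marginal[of g i]
  by (subst nn_integral_chain_extend[where i=i]) auto

lemma nn_integral_chain_pair:
  assumes [measurable]: "g \<in> borel_measurable (mu \<Otimes>\<^sub>M mu)" and "i < n"
  shows "(\<integral>\<^sup>+ x. g (x i, x (Suc i)) \<partial>chain n) = (\<integral>\<^sup>+ z. g z \<partial>pair_law)"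
proof -
  let ?u = "\<lambda>x y. g (x, y)"
  have pair: "(\<integral>\<^sup>+ x. g (x i, x (Suc i)) \<partial>chain (Suc i)) = (\<integral>\<^sup>+ y. kernel (?u y) y \<partial>Q)" for i
  proof -
    have "(\<integral>\<^sup>+ x. g (x i, x (Suc i)) \<partial>chain (Suc i)) = (\<integral>\<^sup>+ x. kernel (?u (x i)) (x i) \<partial>chain i)"
      using nn_integral_pair_last[of ?u i "\<lambda>_. 1" 0] by simp
    also have "\<dots> = (\<integral>\<^sup>+ y. kernel (?u y) y \<partial>Q)"
      using kernel_section[of ?u] by (intro nn_integral_chain_marginal) simp
    finally show ?thesis .
  qed
  have "(\<integral>\<^sup>+ x. g (x i, x (Suc i)) \<partial>chain n) = (\<integral>\<^sup>+ x. g (x i, x (Suc i)) \<partial>chain (Suc i))"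
  proof (rule nn_integral_chain_extend)
    show "(\<lambda>x. g (x i, x (Suc i))) \<in> borel_measurable (Pi\<^sub>M {..n} (\<lambda>_. mu))" if "Suc i \<le> n" for n
    proof -
      have [simp]: "i \<le> n" using that by simp
      show ?thesis using that by measurable
    qed
  qed (use \<open>i < n\<close> in auto)
  also have "\<dots> = (\<integral>\<^sup>+ y. kernel (?u y) y \<partial>Q)" by (rule pair)
  also have "\<dots> = (\<integral>\<^sup>+ x. g (x 0, x (Suc 0)) \<partial>chain (Suc 0))" by (rule pair[symmetric])
  also have "\<dots> = (\<integral>\<^sup>+ z. g z \<partial>pair_law)"
    unfolding pair_law_def by (subst nn_integral_distr) auto
  finally show ?thesis .
qed

lemma distr_chain_pair:
  assumes "i < n"
  shows "distr (chain n) (mu \<Otimes>\<^sub>M mu) (\<lambda>x. (x i, x (Suc i))) = pair_law"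
proof (rule measure_eqI)
  fix A assume "A \<in> sets (distr (chain n) (mu \<Otimes>\<^sub>M mu) (\<lambda>x. (x i, x (Suc i))))"
  then have [measurable]: "A \<in> sets (mu \<Otimes>\<^sub>M mu)" by simp
  have [simp]: "i \<le> n" "Suc i \<le> n" using assms by auto
  have [measurable]: "(\<lambda>x. (x i, x (Suc i))) \<in> measurable (chain n) (mu \<Otimes>\<^sub>M mu)" by simp
  have "emeasure (distr (chain n) (mu \<Otimes>\<^sub>M mu) (\<lambda>x. (x i, x (Suc i)))) A
    = (\<integral>\<^sup>+ z. indicator A z \<partial>distr (chain n) (mu \<Otimes>\<^sub>M mu) (\<lambda>x. (x i, x (Suc i))))" by simp
  also have "\<dots> = (\<integral>\<^sup>+ x. indicator A (x i, x (Suc i)) \<partial>chain n)"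
    by (rule nn_integral_distr) auto
  also have "\<dots> = emeasure pair_law A"
    using assms by (subst nn_integral_chain_pair) auto
  finally show "emeasure (distr (chain n) (mu \<Otimes>\<^sub>M mu) (\<lambda>x. (x i, x (Suc i)))) A = emeasure pair_law A" .
qed simp

lemma integral_chain_pair:
  fixes g :: "'a \<times> 'a \<Rightarrow> real"
  assumes [measurable]: "g \<in> borel_measurable (mu \<Otimes>\<^sub>M mu)" and "i < n"
  shows "(\<integral> x. g (x i, x (Suc i)) \<partial>chain n) = (\<integral> z. g z \<partial>pair_law)"
    and "integrable (chain n) (\<lambda>x. g (x i, x (Suc i))) \<longleftrightarrow> integrable pair_law g"
proof -
  have [simp]: "i \<le> n" "Suc i \<le> n" using assms by auto
  have [measurable]: "(\<lambda>x. (x i, x (Suc i))) \<in> measurable (chain n) (mu \<Otimes>\<^sub>M mu)" by simp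
  show "(\<integral> x. g (x i, x (Suc i)) \<partial>chain n) = (\<integral> z. g z \<partial>pair_law)"
    unfolding distr_chain_pair[OF \<open>i < n\<close>, symmetric] by (subst integral_distr) auto
  show "integrable (chain n) (\<lambda>x. g (x i, x (Suc i))) \<longleftrightarrow> integrable pair_law g"
    unfolding distr_chain_pair[OF \<open>i < n\<close>, symmetric] by (subst integrable_distr_eq) auto
qed

section \<open>Mixing inequalities, from events to functions of pairs\<close>

abbreviation mixing :: "nat \<Rightarrow> real" where
  "mixing h \<equiv> mixing_coeff mu p q \<theta> h"

lemma mixing_bound:
  assumes A [measurable]: "A \<in> sets mu" and B [measurable]: "B \<in> sets mu"
  shows "\<bar>(\<integral>x. indicator A (x 0) * indicator B (x h) \<partial>chain h)
    - (\<integral>x. indicator A (x 0) \<partial>chain h) * (\<integral>x. indicator B (x h) \<partial>chain h)\<bar> \<le> mixing h"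
proof -
  interpret C: prob_space "chain h" by (rule prob_space_chain)
  let ?f = "\<lambda>(A, B). \<bar>\<P>(x in chain h. x 0 \<in> A \<and> x h \<in> B)
      - \<P>(x in chain h. x 0 \<in> A) * \<P>(x in chain h. x h \<in> B)\<bar>"
  have "?f (A, B) \<le> mixing h"
    unfolding mixing_coeff_def
  proof (rule cSUP_upper)
    \<comment> \<open>A real supremum bounds its members only if the set is bounded above; here each
      member compares a number in [0,1] with a product of two such numbers.\<close>
    show "bdd_above (?f ` (sets mu \<times> sets mu))"
    proof (rule bdd_aboveI2)
      fix z assume "z \<in> sets mu \<times> sets mu"
      have "\<bar>a - b * c\<bar> \<le> 1" if "0 \<le> a" "a \<le> 1" "0 \<le> b" "b \<le> 1" "0 \<le> c" "c \<le> 1" for a b c :: real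
        using that mult_le_one[of b c] by (simp add: abs_le_iff) (smt (verit) mult_nonneg_nonneg)
      then show "?f z \<le> 1" by (auto split: prod.split)
    qed
  qed (use assms in auto)
  moreover have "(\<integral>x. indicator A (x 0) * indicator B (x h) \<partial>chain h :: real)
      = \<P>(x in chain h. x 0 \<in> A \<and> x h \<in> B)"
  proof -
    have "(\<integral>x. indicator A (x 0) * indicator B (x h) \<partial>chain h :: real)
        = (\<integral>x. indicator {x \<in> space (chain h). x 0 \<in> A \<and> x h \<in> B} x \<partial>chain h)"
      by (intro Bochner_Integration.integral_cong) (auto simp: indicator_def)
    then show ?thesis by simp
  qed
  moreover have "(\<integral>x. indicator D (x i) \<partial>chain h :: real) = \<P>(x in chain h. x i \<in> D)" for D i
  proof -
    have "(\<integral>x. indicator D (x i) \<partial>chain h :: real)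
        = (\<integral>x. indicator {x \<in> space (chain h). x i \<in> D} x \<partial>chain h)"
      by (intro Bochner_Integration.integral_cong) (auto simp: indicator_def)
    then show ?thesis by (simp add: Int_absorb2 Collect_conj_eq)
  qed
  ultimately show ?thesis by simp
qed

lemma mixing_nonneg: "0 \<le> mixing h"
  using mixing_bound[of "{}" "{}" h] by simp

text \<open>For fixed \<open>A\<close> the difference is linear in \<open>v\<close>: it is the mean
  of v (X_h) against the centred indicator of \<open>A\<close>. So
  \<open>abs_integral_weight_le\<close> reduces it to indicators, which \<open>mixing_bound\<close>
  handles.\<close>

lemma mixing_bound_fun:
  fixes v :: "'a \<Rightarrow> real"
  assumes A [measurable]: "A \<in> sets mu" and v [measurable]: "v \<in> borel_measurable mu"
    and v01: "\<And>x. x \<in> space mu \<Longrightarrow> 0 \<le> v x \<and> v x \<le> 1"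
  shows "\<bar>(\<integral>x. indicator A (x 0) * v (x h) \<partial>chain h)
    - (\<integral>x. indicator A (x 0) \<partial>chain h) * (\<integral>x. v (x h) \<partial>chain h)\<bar> \<le> mixing h"
proof -
  interpret C: prob_space "chain h" by (rule prob_space_chain)
  define c where "c = (\<integral>x. indicator A (x 0) \<partial>chain h :: real)"
  have int: "integrable (chain h) (\<lambda>x. w (x h) * indicator A (x 0))" "integrable (chain h) (\<lambda>x. w (x h))"
    if [measurable]: "w \<in> borel_measurable mu" and "\<And>x. x \<in> space mu \<Longrightarrow> 0 \<le> w x \<and> w x \<le> 1"
        for w :: "'a \<Rightarrow> real"
    by (rule C.integrable_bdd[where c=1]; use that(2) in \<open>force simp: indicator_def space_PiM\<close>)+
  have eq: "(\<integral>x. w (x h) * (indicator A (x 0) - c) \<partial>chain h) = (\<integral>x. indicator A (x 0) * w (x h) \<partial>chain h)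
      - c * (\<integral>x. w (x h) \<partial>chain h)"
    if [measurable]: "w \<in> borel_measurable mu" and "\<And>x. x \<in> space mu \<Longrightarrow> 0 \<le> w x \<and> w x \<le> 1"
        for w :: "'a \<Rightarrow> real"
    using int[OF that] by (simp add: right_diff_distrib mult.commute)
  have "\<bar>\<integral>x. v (x h) * (indicator A (x 0) - c) \<partial>chain h\<bar> \<le> mixing h"
  proof (rule C.abs_integral_weight_le[where N=mu and X="\<lambda>x. x h"])
    show "\<bar>\<integral>x. indicator B (x h) * (indicator A (x 0) - c) \<partial>chain h\<bar> \<le> mixing h"
        if [measurable]: "B \<in> sets mu" for B
      using mixing_bound[OF A that, of h] unfolding c_def[symmetric]
      by (subst eq) (auto simp: indicator_def)
    show "integrable (chain h) (\<lambda>x. indicator A (x 0) - c :: real)"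
      by (rule Bochner_Integration.integrable_diff) (auto intro!: C.integrable_bdd[where c=1])
  qed (use v01 in auto)
  then show ?thesis unfolding c_def[symmetric] by (subst (asm) eq[OF v v01]) auto
qed

text \<open>By the Markov property only the conditional mean \<open>H\<close> of the later pair given the last
  coordinate of the earlier one enters, and the extremal weight on the earlier pair is the indicator of
  a superlevel set of \<open>H\<close>.\<close>

lemma covariance_pairs_01:
  fixes u v :: "'a \<times> 'a \<Rightarrow> real"
  assumes u [measurable]: "u \<in> borel_measurable (mu \<Otimes>\<^sub>M mu)"
      and v [measurable]: "v \<in> borel_measurable (mu \<Otimes>\<^sub>M mu)"
    and u01: "\<And>z. 0 \<le> u z \<and> u z \<le> 1" and v01: "\<And>z. 0 \<le> v z \<and> v z \<le> 1"
    and j: "j = Suc i + h" and n: "j < n"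
  shows "\<bar>covariance (chain n) (\<lambda>x. u (x i, x (Suc i))) (\<lambda>x. v (x j, x (Suc j)))\<bar> \<le> mixing h"
proof -
  interpret C: prob_space "chain n" by (rule prob_space_chain)
  have le [simp]: "i \<le> n" "Suc i \<le> n" "j \<le> n" "Suc j \<le> n" "i \<le> j" "Suc i \<le> j" using j n by auto
  \<comment> \<open>\<open>g\<close> is the conditional mean of v (X_j, X_(j+1)) given X_j;
    \<open>H\<close> below is the conditional mean given X_(i+1), h steps earlier.\<close>
  define g where "g x = kernel (\<lambda>y. ennreal (v (x, y))) x" for x
  have g [measurable]: "g \<in> borel_measurable mu"
    unfolding g_def by (rule kernel_section) measurable
  have g1: "g x \<le> 1" if "x \<in> space mu" for x
  proof -
    have "g x \<le> kernel (\<lambda>_. 1) x" unfolding g_def kernel_def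
      by (intro nn_integral_mono mult_left_mono) (auto simp: v01)
    then show ?thesis using kernel_1[OF that] by simp
  qed
  have g_real: "ennreal (enn2real (g x)) = g x" if "x \<in> space mu" for x
    using g1[OF that] by (auto simp: ennreal_enn2real_if top_unique)
  define H where "H x = enn2real ((kernel ^^ h) g x)" for x
  have H [measurable]: "H \<in> borel_measurable mu" unfolding H_def by measurable
  have enH: "ennreal (H x) = (kernel ^^ h) g x" and H01: "0 \<le> H x \<and> H x \<le> 1" if "x \<in> space mu" for x
  proof -
    have "(kernel ^^ h) g x \<le> 1" by (rule kernel_pow_le_1[OF g1 that])
    then show "ennreal (H x) = (kernel ^^ h) g x" "0 \<le> H x \<and> H x \<le> 1"
      unfolding H_def by (auto simp: ennreal_enn2real_if top.extremum_unique enn2real_leI dest: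
          neq_top_trans[rotated])
  qed
  \<comment> \<open>The Markov property is available for \<open>nn_integral\<close> only;
    nonnegative integrands carry its identities over to Bochner integrals.\<close>
  have real_eq: "(\<integral>x. f x \<partial>M) = (\<integral>x. f' x \<partial>M')"
    if "(\<integral>\<^sup>+ x. ennreal (f x) \<partial>M) = (\<integral>\<^sup>+ x. ennreal (f' x)
        \<partial>M')" "f \<in> borel_measurable M" "f' \<in> borel_measurable M'"
      "\<And>x. x \<in> space M \<Longrightarrow> 0 \<le> f x" "\<And>x. x \<in> space M' \<Longrightarrow> 0 \<le> f' x" for f f' :: "(nat \<Rightarrow> 'a) \<Rightarrow> real" and M M'
    using that by (simp add: integral_eq_nn_integral)
  have EH: "(\<integral>x. w (x i, x (Suc i)) * v (x j, x (Suc j)) \<partial>chain n)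
      = (\<integral>x. w (x i, x (Suc i)) * H (x (Suc i)) \<partial>chain n)"
    if w [measurable]: "w \<in> borel_measurable (mu \<Otimes>\<^sub>M mu)" and w01: "\<And>z. 0 \<le> w z"
        for w :: "'a \<times> 'a \<Rightarrow> real"
  proof (rule real_eq)
    let ?G = "\<lambda>x. ennreal (w (x i, x (Suc i)))"
    have Gm: "?G \<in> borel_measurable (Pi\<^sub>M {..n} (\<lambda>_. mu))" if "Suc i \<le> n" for n
    proof -
      have [simp]: "i \<le> n" using that by simp
      show ?thesis using that by measurable
    qed
    have "(\<integral>\<^sup>+ x. ennreal (w (x i, x (Suc i)) * v (x j, x (Suc j))) \<partial>chain n)
      = (\<integral>\<^sup>+ x. ?G x * ennreal (v (x j, x (Suc j))) \<partial>chain n)"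
      by (simp add: ennreal_mult v01 w01)
    also have "\<dots> = (\<integral>\<^sup>+ x. ?G x * ennreal (v (x j, x (Suc j))) \<partial>chain (Suc j))"
    proof (rule nn_integral_chain_extend)
      show "(\<lambda>x. ?G x * ennreal (v (x j, x (Suc j)))) \<in> borel_measurable (Pi\<^sub>M {..n} (\<lambda>_. mu))"
          if "Suc j \<le> n" for n
      proof -
        have [simp]: "i \<le> n" "Suc i \<le> n" "j \<le> n" using that j by auto
        show ?thesis using that by measurable
      qed
    qed (use j n in auto)
    also have "\<dots> = (\<integral>\<^sup>+ x. ?G x * (kernel ^^ h) g (x (Suc i)) \<partial>chain (Suc i))"
      unfolding j g_def
      by (rule nn_integral_pair_last[where u="\<lambda>x y. ennreal (v (x, y))", OF _ _ Gm]) auto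
    also have "\<dots> = (\<integral>\<^sup>+ x. ?G x * (kernel ^^ h) g (x (Suc i)) \<partial>chain n)"
    proof (rule nn_integral_chain_extend[symmetric])
      show "(\<lambda>x. ?G x * (kernel ^^ h) g (x (Suc i))) \<in> borel_measurable (Pi\<^sub>M {..n} (\<lambda>_. mu))"
          if "Suc i \<le> n" for n
        using Gm[OF that] that by measurable
    qed auto
    also have "\<dots> = (\<integral>\<^sup>+ x. ennreal (w (x i, x (Suc i)) * H (x (Suc i))) \<partial>chain n)"
    proof (rule nn_integral_cong)
      fix x assume "x \<in> space (chain n)"
      then have "x (Suc i) \<in> space mu" by (auto simp: space_PiM)
      then show "?G x * (kernel ^^ h) g (x (Suc i)) = ennreal (w (x i, x (Suc i)) * H (x (Suc i)))"
        using enH H01 by (simp add: ennreal_mult w01)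
    qed
    finally show "(\<integral>\<^sup>+ x. ennreal (w (x i, x (Suc i)) * v (x j, x (Suc j))) \<partial>chain n)
      = (\<integral>\<^sup>+ x. ennreal (w (x i, x (Suc i)) * H (x (Suc i))) \<partial>chain n)" .
  qed (auto simp: w01 v01 intro!: mult_nonneg_nonneg conjunct1[OF H01] simp del: space_chain intro:
      chain_coord_space[of _ n])
  define c where "c = (\<integral>x. v (x j, x (Suc j)) \<partial>chain n)"
  have cH: "(\<integral>x. H (x (Suc i)) \<partial>chain n) = c"
    using EH[of "\<lambda>_. 1"] by (simp add: c_def)
  define D where "D x = H (x (Suc i)) - c" for x
  have intH: "integrable (chain n) (\<lambda>x. w x * H (x (Suc i)))" "integrable (chain n) w"
    if [measurable]: "w \<in> borel_measurable (chain n)" and w01: "\<And>x. 0 \<le> w x \<and> w x \<le> 1"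
        for w :: "(nat \<Rightarrow> 'a) \<Rightarrow> real"
  proof -
    have "\<bar>w x * H (x (Suc i))\<bar> \<le> 1" if "x \<in> space (chain n)" for x
      using H01[OF chain_coord_space[OF that, of "Suc i"]] w01 by (simp add: abs_mult mult_le_one)
    then show "integrable (chain n) (\<lambda>x. w x * H (x (Suc i)))"
      by (intro C.integrable_bdd[where c=1]) auto
    show "integrable (chain n) w"
      by (rule C.integrable_bdd[where c=1]) (use w01 in auto)
  qed
  have ED: "(\<integral>x. w x * D x \<partial>chain n) = (\<integral>x. w x * H (x (Suc i)) \<partial>chain n) - (\<integral>x. w x \<partial>chain n) * c"
    if "w \<in> borel_measurable (chain n)" "\<And>x. 0 \<le> w x \<and> w x \<le> 1" for w :: "(nat \<Rightarrow> 'a) \<Rightarrow> real"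
    using intH[OF that] by (simp add: D_def right_diff_distrib)
  have intD: "integrable (chain n) (\<lambda>x. w x * D x)"
    if "w \<in> borel_measurable (chain n)" "\<And>x. 0 \<le> w x \<and> w x \<le> 1" for w :: "(nat \<Rightarrow> 'a) \<Rightarrow> real"
    using intH[OF that] by (simp add: D_def right_diff_distrib)
  \<comment> \<open>By stationarity (X_(i+1), X_j) is distributed like (X_0, X_h), and for the
    latter pair \<open>mixing_bound_fun\<close> applies to the indicator of \<open>A\<close> and
    \<open>g\<close>.\<close>
  have key: "\<bar>\<integral>x. indicator A (x (Suc i)) * D x \<partial>chain n\<bar> \<le> mixing h"
      if A [measurable]: "A \<in> sets mu" for A
  proof -
    have i1: "(\<integral>x. indicator A (x (Suc i)) * H (x (Suc i)) \<partial>chain n)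
        = (\<integral>x. indicator A (x 0) * enn2real (g (x h)) \<partial>chain h)"
    proof (rule real_eq)
      have "(\<integral>\<^sup>+ x. ennreal (indicator A (x (Suc i)) * H (x (Suc i))) \<partial>chain n)
        = (\<integral>\<^sup>+ x. indicator A (x (Suc i)) * (kernel ^^ h) g (x (Suc i)) \<partial>chain n)"
        by (intro nn_integral_cong) (auto simp: indicator_def enH[OF chain_coord_space[of _ n]] simp
            del: space_chain)
      also have "\<dots> = (\<integral>\<^sup>+ y. indicator A y * (kernel ^^ h) g y \<partial>Q)"
        by (rule nn_integral_chain_coord[where g="\<lambda>y. indicator A y * (kernel ^^ h) g y"]) auto
      also have "\<dots> = (\<integral>\<^sup>+ x. indicator A (x 0) * g (x (0 + h)) \<partial>chain (0 + h))"
        by (rule nn_integral_coord_forward[symmetric]) auto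
      also have "\<dots> = (\<integral>\<^sup>+ x. ennreal (indicator A (x 0) * enn2real (g (x h))) \<partial>chain h)"
        unfolding add_0 by (intro nn_integral_cong) (auto simp: indicator_def
            intro!: g_real[symmetric] chain_coord_space simp del: space_chain)
      finally show "(\<integral>\<^sup>+ x. ennreal (indicator A (x (Suc i)) * H (x (Suc i))) \<partial>chain n) = 
        (\<integral>\<^sup>+ x. ennreal (indicator A (x 0) * enn2real (g (x h))) \<partial>chain h)" .
    qed (auto simp: indicator_def H01[OF chain_coord_space[of _ n]] simp del: space_chain)
    have i2: "(\<integral>x. indicator A (x (Suc i)) \<partial>chain n) = (\<integral>x. indicator A (x 0) \<partial>chain h :: real)"
      using nn_integral_chain_coord[of "indicator A" "Suc i" n] nn_integral_chain_coord[of
          "indicator A" 0 h]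
      by (intro real_eq) (auto simp: ennreal_indicator)
    have i3: "c = (\<integral>x. enn2real (g (x h)) \<partial>chain h)"
      unfolding cH[symmetric]
    proof (rule real_eq)
      have "(\<integral>\<^sup>+ x. ennreal (H (x (Suc i))) \<partial>chain n) = (\<integral>\<^sup>+ x. (kernel ^^ h) g (x (Suc i)) \<partial>chain n)"
        by (intro nn_integral_cong) (simp add: enH[OF chain_coord_space[of _ n]] del: space_chain)
      also have "\<dots> = (\<integral>\<^sup>+ y. (kernel ^^ h) g y \<partial>Q)"
        by (rule nn_integral_chain_coord) auto
      also have "\<dots> = (\<integral>\<^sup>+ x. g (x (0 + h)) \<partial>chain (0 + h))"
        using nn_integral_coord_forward[of "\<lambda>_. 1" g 0 h] by simp
      also have "\<dots> = (\<integral>\<^sup>+ x. ennreal (enn2real (g (x h))) \<partial>chain h)"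
        unfolding add_0 by (intro nn_integral_cong) (auto
            intro!: g_real[symmetric] chain_coord_space simp del: space_chain)
      finally show "(\<integral>\<^sup>+ x. ennreal (H (x (Suc i))) \<partial>chain n)
          = (\<integral>\<^sup>+ x. ennreal (enn2real (g (x h))) \<partial>chain h)" .
    qed (auto simp: indicator_def H01[OF chain_coord_space[of _ n]] simp del: space_chain)
    have "\<bar>(\<integral>x. indicator A (x 0) * enn2real (g (x h)) \<partial>chain h) - (\<integral>x. indicator A (x 0)
        \<partial>chain h) * c\<bar> \<le> mixing h"
      unfolding i3
      by (rule mixing_bound_fun) (use g1 in \<open>auto intro!: enn2real_leI\<close>)
    then show ?thesis by (subst ED) (auto simp: i1 i2 indicator_le_1)
  qed
  have cov: "covariance (chain n) (\<lambda>x. u (x i, x (Suc i))) (\<lambda>x. v (x j, x (Suc j)))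
      = (\<integral>x. u (x i, x (Suc i)) * D x \<partial>chain n)"
    unfolding covariance_def using u01 by (subst ED) (auto simp: EH c_def)
  let ?P = "{y \<in> space mu. c \<le> H y}" and ?N = "{y \<in> space mu. H y < c}"
  have ind_m: "(\<lambda>x. indicator ?P (x (Suc i)) :: real) \<in> borel_measurable (chain n)"
    "(\<lambda>x. indicator ?N (x (Suc i)) :: real) \<in> borel_measurable (chain n)" by measurable
  have "(\<integral>x. u (x i, x (Suc i)) * D x \<partial>chain n) \<le> (\<integral>x. indicator ?P (x (Suc i)) * D x \<partial>chain n)"
    using u01 ind_m by (intro integral_mono intD)
      (auto simp: indicator_def D_def space_PiM mult_left_le_one_le mult_nonneg_nonpos)
  moreover have "(\<integral>x. indicator ?N (x (Suc i)) * D x \<partial>chain n) \<le> (\<integral>x. u (x i, x (Suc i)) * D x \<partial>chain n)"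
  proof (intro integral_mono intD)
    fix x assume "x \<in> space (chain n)"
    then have "x (Suc i) \<in> space mu" by (auto simp: space_PiM)
    moreover have "D x \<le> u (x i, x (Suc i)) * D x" if "D x < 0"
      using that u01[of "(x i, x (Suc i))"] by (simp add: mult_le_cancel_right1)
    ultimately show "indicator ?N (x (Suc i)) * D x \<le> u (x i, x (Suc i)) * D x"
      using u01[of "(x i, x (Suc i))"] by (auto simp: indicator_def D_def)
  qed (use u01 ind_m in \<open>auto simp: indicator_def\<close>)
  moreover have "?P \<in> sets mu" "?N \<in> sets mu" by measurable
  ultimately show ?thesis unfolding cov using key[of ?P] key[of ?N] by (simp add: abs_le_iff)
qed

text \<open>The affine map from [-R, R] onto [0, 1] reduces this to
  \<open>covariance_pairs_01\<close>: shifts leave a covariance unchanged, and the scale 2 R of each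
  factor gives 4 R^2.\<close>

lemma covariance_pairs_bdd:
  fixes u v :: "'a \<times> 'a \<Rightarrow> real"
  assumes u [measurable]: "u \<in> borel_measurable (mu \<Otimes>\<^sub>M mu)"
      and v [measurable]: "v \<in> borel_measurable (mu \<Otimes>\<^sub>M mu)"
    and R: "0 < R" and uR: "\<And>z. \<bar>u z\<bar> \<le> R" and vR: "\<And>z. \<bar>v z\<bar> \<le> R"
    and j: "j = Suc i + h" and n: "j < n"
  shows "\<bar>covariance (chain n) (\<lambda>x. u (x i, x (Suc i))) (\<lambda>x. v (x j, x (Suc j)))\<bar> \<le> 4 * R\<^sup>2 * mixing h"
proof -
  interpret C: prob_space "chain n" by (rule prob_space_chain)
  have le [simp]: "i \<le> n" "Suc i \<le> n" "j \<le> n" "Suc j \<le> n" using j n by auto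
  define u' v' where "u' z = (u z + R) / (2 * R)" and "v' z = (v z + R) / (2 * R)" for z
  have [measurable]: "u' \<in> borel_measurable (mu \<Otimes>\<^sub>M mu)" "v' \<in> borel_measurable (mu \<Otimes>\<^sub>M mu)"
    unfolding u'_def v'_def by measurable
  have u01: "0 \<le> u' z \<and> u' z \<le> 1" and v01: "0 \<le> v' z \<and> v' z \<le> 1" for z
    using uR[of z] vR[of z] R by (auto simp: u'_def v'_def field_simps abs_le_iff)
  have uu: "u z = 2 * R * u' z - R" and vv: "v z = 2 * R * v' z - R" for z
    using R by (auto simp: u'_def v'_def)
  let ?U = "\<lambda>x. u' (x i, x (Suc i))" and ?V = "\<lambda>x. v' (x j, x (Suc j))"
  have iU: "integrable (chain n) ?U" and iV: "integrable (chain n) ?V"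
      and iUV: "integrable (chain n) (\<lambda>x. ?U x * ?V x)"
    by (rule C.integrable_bdd[where c=1]; use u01 v01 in \<open>auto simp: abs_mult mult_le_one\<close>)+
  have "covariance (chain n) (\<lambda>x. u (x i, x (Suc i))) (\<lambda>x. v (x j, x (Suc j)))
      = 4 * R\<^sup>2 * covariance (chain n) ?U ?V"
  proof -
    have 1: "(2 * R * ?U x - R) * (2 * R * ?V x - R)
        = 4 * R\<^sup>2 * (?U x * ?V x) - 2 * R\<^sup>2 * ?U x - 2 * R\<^sup>2 * ?V x + R\<^sup>2" for x
      by (simp add: algebra_simps power2_eq_square)
    show ?thesis
      unfolding uu vv covariance_def 1 using iU iV iUV C.prob_space
      by (simp add: algebra_simps power2_eq_square)
  qed
  moreover have "\<bar>covariance (chain n) ?U ?V\<bar> \<le> mixing h"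
    by (rule covariance_pairs_01[OF _ _ u01 v01 j n]) auto
  ultimately show ?thesis by (simp add: abs_mult mult_left_mono)
qed

end

section \<open>Log ratios with infinite values, and laws with only the probabilities 0 and 1\<close>

lemma real_log_ratio: "real_of_ereal (log_ratio a b) = ln (a / b)"
  \<comment> \<open>The special cases agree by default values: \<open>ln 0\<close>, division by 0
    and \<open>real_of_ereal \<infinity>\<close> are all 0.\<close>
  by (simp add: log_ratio_def)

lemma log_ratio_finite: "0 \<noteq> a \<Longrightarrow> log_ratio a b \<noteq> \<infinity> \<Longrightarrow> b \<noteq> 0"
  by (auto simp: log_ratio_def split: if_splits)

lemma log_ratio_measurable [measurable (raw)]:
  assumes [measurable]: "f \<in> borel_measurable M" "g \<in> borel_measurable M"
  shows "(\<lambda>x. log_ratio (f x) (g x)) \<in> borel_measurable M"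
  unfolding log_ratio_def by measurable

lemma abs_powr_ge: "ennreal (\<bar>real_of_ereal z\<bar> powr s) \<le> abs_powr z s"
  by (simp add: abs_powr_def)

lemma abs_powr_measurable [measurable (raw)]:
  assumes [measurable]: "f \<in> borel_measurable M"
  shows "(\<lambda>x. abs_powr (f x) s) \<in> borel_measurable M"
  unfolding abs_powr_def by measurable

lemma ext_integral_eq_integral:
  assumes g: "integrable N g" and F: "AE z in N. F z = ereal (g z)"
  shows "ext_integral N F = ereal (\<integral>z. g z \<partial>N)"
proof -
  have "(\<integral>\<^sup>+ z. e2ennreal (F z) \<partial>N) = (\<integral>\<^sup>+ z. ennreal (g z) \<partial>N)"
    "(\<integral>\<^sup>+ z. e2ennreal (- F z) \<partial>N) = (\<integral>\<^sup>+ z. ennreal (- g z) \<partial>N)"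
    using F by (auto intro!: nn_integral_cong_AE simp: ennreal.abs_eq)
  moreover have "(\<integral>\<^sup>+ z. ennreal (g z) \<partial>N) < \<infinity>" "(\<integral>\<^sup>+ z. ennreal (- g z) \<partial>N) < \<infinity>"
    using g by (auto simp: real_integrable_def top.not_eq_extremum)
  ultimately show ?thesis
    unfolding ext_integral_def real_lebesgue_integral_def[OF g]
    by (cases "\<integral>\<^sup>+ z. ennreal (g z) \<partial>N"; cases "\<integral>\<^sup>+ z. ennreal (- g z) \<partial>N") auto
qed

text \<open>If F exceeded c with positive probability, it would exceed c by some fixed margin with
  positive probability, hence almost surely, and its integral would exceed c as well.\<close>

lemma (in prob_space) zero_one_AE_le:
  fixes F :: "'a \<Rightarrow> ereal"
  assumes zo: "\<And>A. A \<in> events \<Longrightarrow> prob A = 0 \<or> prob A = 1"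
    and [measurable]: "F \<in> borel_measurable M"
    and le: "ext_integral M F \<le> ereal c" and c: "0 \<le> c"
  shows "AE z in M. F z \<le> ereal c"
proof (rule ccontr)
  assume not: "\<not> (AE z in M. F z \<le> ereal c)"
  define E where "E k = {z \<in> space M. ereal (c + 1 / Suc k) < F z}" for k
  have E [measurable]: "E k \<in> events" for k unfolding E_def by measurable
  have "\<exists>k. prob (E k) \<noteq> 0"
  proof (rule ccontr)
    assume "\<not> (\<exists>k. prob (E k) \<noteq> 0)"
    then have "AE z in M. z \<notin> E k" for k
      by (intro AE_not_in) (auto simp: null_sets_def emeasure_eq_measure)
    then have "AE z in M. \<forall>k. z \<notin> E k" by (simp add: AE_all_countable)
    then have "AE z in M. F z \<le> ereal c"
    proof (rule AE_mp, intro AE_I2 impI)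
      fix z assume z: "z \<in> space M" "\<forall>k. z \<notin> E k"
      show "F z \<le> ereal c"
      proof (rule ccontr)
        assume "\<not> F z \<le> ereal c"
        then obtain r where r: "ereal c < ereal r" "ereal r < F z"
          using ereal_dense2[of "ereal c" "F z"] by (auto simp: not_le)
        obtain k where "inverse (real (Suc k)) < r - c" using reals_Archimedean[of "r - c"] r by auto
        then have "ereal (c + 1 / Suc k) < F z"
          using r by (intro less_trans[OF _ r(2)]) (simp add: inverse_eq_divide)
        then show False using z by (auto simp: E_def)
      qed
    qed
    with not show False by simp
  qed
  then obtain k where "prob (E k) = 1" using zo[OF E] by auto
  then have ae: "AE z in M. ereal (c + 1 / Suc k) < F z"
    using prob_eq_1[OF E] by (auto simp: E_def elim: AE_mp)
  \<comment> \<open>As c is nonnegative, F is positive almost surely; \<open>ext_integral\<close>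
    therefore reduces to the integral of the positive part, even if that is infinite.\<close>
  have "(\<integral>\<^sup>+ z. e2ennreal (- F z) \<partial>M) = (\<integral>\<^sup>+ z. 0 \<partial>M)"
  proof (rule nn_integral_cong_AE, use ae in \<open>rule AE_mp\<close>, intro AE_I2 impI)
    fix z assume "ereal (c + 1 / Suc k) < F z"
    then have "0 \<le> F z" using c by (smt (verit, best) ereal_less(2) divide_nonneg_nonneg
        less_ereal.simps(1) less_le_trans not_le of_nat_0_le_iff order_less_imp_le ereal_less_eq(3)
        zero_ereal_def)
    then show "e2ennreal (- F z) = 0" by (intro e2ennreal_neg) simp
  qed
  moreover have "ennreal (c + 1 / Suc k) \<le> (\<integral>\<^sup>+ z. e2ennreal (F z) \<partial>M)"
  proof -
    have "(\<integral>\<^sup>+ z. ennreal (c + 1 / Suc k) \<partial>M) \<le> (\<integral>\<^sup>+ z. e2ennreal (F z) \<partial>M)"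
    proof (rule nn_integral_mono_AE, use ae in \<open>rule AE_mp\<close>, intro AE_I2 impI)
      fix z assume "ereal (c + 1 / Suc k) < F z"
      then have "e2ennreal (ereal (c + 1 / Suc k)) \<le> e2ennreal (F z)" by (intro e2ennreal_mono) simp
      then show "ennreal (c + 1 / Suc k) \<le> e2ennreal (F z)" by (simp add: ennreal.abs_eq)
    qed
    then show ?thesis by (simp add: emeasure_space_1)
  qed
  ultimately have "ereal (c + 1 / Suc k) \<le> ext_integral M F"
    using c unfolding ext_integral_def
    by (metis enn2ereal_ennreal ereal_minus(7) add_nonneg_nonneg divide_nonneg_nonneg
        less_eq_ennreal.rep_eq nn_integral_0_iff_AE of_nat_0_le_iff zero_ennreal.rep_eq zero_le_one
        nn_integral_const mult_zero_left)
  then have "ereal (c + 1 / Suc k) \<le> ereal c" using le by (rule order_trans)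
  then show False by simp
qed

lemma covariance_commute: "covariance M Y Z = covariance M Z Y"
  by (simp add: covariance_def mult.commute)

section \<open>Variance and deviations of sums along the chain\<close>

context stationary_chain
begin

text \<open>Each covariance is truncated at its own level, at which the mixing error 4 R^2 a_h and
  the truncation error 6 m R^(2 - s) are both multiples of m^(2/s) a_h^(1 - 2/s). The strictly
  positive majorant \<open>a\<close> replaces the mixing coefficients because the level divides by
  it.\<close>

lemma variance_chain_sum_le:
  fixes f :: "'a \<times> 'a \<Rightarrow> real" and a :: "nat \<Rightarrow> real" and n :: nat
  assumes f [measurable]: "f \<in> borel_measurable (mu \<Otimes>\<^sub>M mu)"
    and s: "2 < s" and m: "0 < m"
    and int: "integrable pair_law (\<lambda>z. \<bar>f z\<bar> powr s)" "(\<integral>z. \<bar>f z\<bar> powr s \<partial>pair_law) \<le> m"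
    and a: "\<And>h. 0 < a h" "\<And>h. mixing h \<le> a h"
    and S: "\<And>N. (\<Sum>h<N. a h powr (1 - 2 / s)) \<le> S"
  defines "W \<equiv> \<lambda>x. \<Sum>i<n. f (x i, x (Suc i))"
  shows "integrable (chain n) (\<lambda>x. (W x)\<^sup>2)"
    and "(\<integral>x. (W x - (\<integral>x. W x \<partial>chain n))\<^sup>2 \<partial>chain n) \<le> real n * ((2 + 20 * S) * m powr (2 / s))"
proof -
  interpret C: prob_space "chain n" by (rule prob_space_chain)
  define Y where "Y i x = f (x i, x (Suc i))" for i and x :: "nat \<Rightarrow> 'a"
  have Ym [measurable]: "Y i \<in> borel_measurable (chain n)" if "i < n" for i
  proof -
    have [simp]: "i \<le> n" "Suc i \<le> n" using that by auto
    show ?thesis unfolding Y_def by measurable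
  qed
  have Ys: "integrable (chain n) (\<lambda>x. \<bar>Y i x\<bar> powr s)" "(\<integral>x. \<bar>Y i x\<bar> powr s \<partial>chain n) \<le> m"
      if "i < n" for i
    using integral_chain_pair[of "\<lambda>z. \<bar>f z\<bar> powr s", OF _ that] int unfolding Y_def by auto
  have s2: "2 \<le> s" using s by simp
  have Ysq: "integrable (chain n) (\<lambda>x. (Y i x)\<^sup>2)" if "i < n" for i
    using C.moment_facts(1)[OF Ym[OF that] s2 zero_less_one Ys[OF that]] .
  \<comment> \<open>The factor 10 adds the 4 of \<open>covariance_pairs_bdd\<close> to the 6 of
    \<open>covariance_truncation\<close>.\<close>
  define w where "w h = 10 * a h powr (1 - 2 / s)" for h
  define B where "B = m powr (2 / s)"
  have w0: "0 \<le> w h" for h by (simp add: w_def)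
  have B0: "0 \<le> B" by (simp add: B_def)
  have off: "\<bar>covariance (chain n) (Y i) (Y j)\<bar> \<le> w (j - Suc i) * B" if "i < j" "j < n" for i j
  proof -
    \<comment> \<open>The gap is measured from the end of the earlier pair to the start of the later
      one. Neighbouring pairs share a state and have gap 0, which is how lag 0 enters.\<close>
    define h where "h = j - Suc i"
    have j: "j = Suc i + h" using that by (simp add: h_def)
    have [simp]: "i < n" using that by simp
    \<comment> \<open>This solves R^2 a_h = m R^(2 - s).\<close>
    define R where "R = (m / a h) powr (1 / s)"
    have R: "0 < R" using m a(1)[of h] by (simp add: R_def)
    have tr: "\<bar>covariance (chain n) (\<lambda>x. trunc R (Y i x)) (\<lambda>x. trunc R (Y j x))\<bar> \<le> 4 * R\<^sup>2 * mixing h"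
      unfolding Y_def
      using R by (intro covariance_pairs_bdd[where u="\<lambda>z. trunc R (f z)"
          and v="\<lambda>z. trunc R (f z)"] j that abs_trunc_le) auto
    have "\<bar>covariance (chain n) (Y i) (Y j)\<bar> \<le> 4 * R\<^sup>2 * mixing h + 6 * (m * R powr (2 - s))"
      by (rule C.covariance_truncation[OF Ym Ym s2 R Ys Ys tr]) (use that in auto)
    also have "\<dots> \<le> 4 * (R\<^sup>2 * a h) + 6 * (m * R powr (2 - s))"
      using a(2)[of h] by (simp add: mult_left_mono)
    also have "R\<^sup>2 * a h = a h powr (1 - 2 / s) * B"
    proof -
      have "R\<^sup>2 = (m / a h) powr (2 / s)" using R by (simp add: R_def powr_powr flip: powr_numeral)
      then show ?thesis using m a(1)[of h] by (simp add: powr_divide B_def powr_diff)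
    qed
    also have "m * R powr (2 - s) = a h powr (1 - 2 / s) * B"
    proof -
      have "R powr (2 - s) = (m / a h) powr (2 / s - 1)" using s
          by (simp add: R_def powr_powr diff_divide_distrib)
      then show ?thesis using m a(1)[of h] by (simp add: powr_divide B_def powr_diff)
    qed
    finally show ?thesis by (simp add: w_def h_def mult_ac)
  qed
  have diag: "\<bar>covariance (chain n) (Y i) (Y i)\<bar> \<le> 2 * B" if "i < n" for i
  proof -
    \<comment> \<open>No mixing is involved on the diagonal; this level makes R^2 and m R^(2 - s)
      both equal to \<open>B\<close>.\<close>
    define R where "R = m powr (1 / s)"
    have R: "0 < R" using m by (simp add: R_def)
    have "(\<integral>x. (Y i x)\<^sup>2 \<partial>chain n) \<le> R\<^sup>2 + m * R powr (2 - s)"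
      by (rule C.moment_facts(3)[OF Ym s2 R Ys]) (use that in auto)
    also have "R\<^sup>2 = B" using R by (simp add: R_def B_def powr_powr flip: powr_numeral)
    also have "m * R powr (2 - s) = B"
      using m s by (simp add: R_def B_def powr_powr diff_divide_distrib powr_diff)
    finally have "(\<integral>x. (Y i x)\<^sup>2 \<partial>chain n) \<le> 2 * B" by simp
    moreover have "integrable (chain n) (Y i)"
      by (rule C.moment_facts(2)[OF Ym s2 R Ys]) (use that in auto)
    then have "covariance (chain n) (Y i) (Y i) = C.variance (Y i)"
      using Ysq[OF that] by (subst C.variance_eq) (auto simp: covariance_def power2_eq_square)
    then have "0 \<le> covariance (chain n) (Y i) (Y i)"
      using C.variance_positive[of "Y i"] by simp
    moreover have "covariance (chain n) (Y i) (Y i) = (\<integral>x. (Y i x)\<^sup>2 \<partial>chain n) - (C.expectation (Y i))\<^sup>2"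
      by (simp add: covariance_def power2_eq_square)
    ultimately show ?thesis
      using zero_le_power2[of "C.expectation (Y i)"] by linarith
  qed
  \<comment> \<open>Both directions of time contribute at most 10 S, and the diagonal contributes
    2.\<close>
  have row: "(\<Sum>j<n. covariance (chain n) (Y i) (Y j)) \<le> (2 + 20 * S) * B" if i: "i < n" for i
  proof -
    have below: "covariance (chain n) (Y i) (Y j) \<le> w (i - Suc j) * B" if "j < i" for j
      using off[OF that i] by (subst covariance_commute) (rule abs_le_D1)
    have "{..<n} = {..<i} \<union> {i} \<union> {Suc i..<n}" "{..<i} \<inter> {Suc i..<n} = {}" using i by auto
    then have "(\<Sum>j<n. covariance (chain n) (Y i) (Y j))
        = (\<Sum>j<i. covariance (chain n) (Y i) (Y j)) + covariance (chain n) (Y i) (Y i)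
          + (\<Sum>j=Suc i..<n. covariance (chain n) (Y i) (Y j))"
      by (simp add: sum.union_disjoint ivl_disj_int)
    also have "\<dots> \<le> (\<Sum>j<i. w (i - Suc j) * B) + 2 * B + (\<Sum>j=Suc i..<n. w (j - Suc i) * B)"
      using off[THEN abs_le_D1] i diag[OF i, THEN abs_le_D1]
      by (intro add_mono sum_mono) (auto simp only: lessThan_iff atLeastLessThan_iff Suc_le_eq below)
    also have "(\<Sum>j<i. w (i - Suc j) * B) = (\<Sum>h<i. w h * B)"
      by (rule sum.nat_diff_reindex)
    also have "(\<Sum>j=Suc i..<n. w (j - Suc i) * B) = (\<Sum>h<n - Suc i. w h * B)"
      by (subst sum.atLeastLessThan_shift_0) (simp add: atLeast0LessThan)
    also have "(\<Sum>h<i. w h * B) + 2 * B + (\<Sum>h<n - Suc i. w h * B)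
        = ((\<Sum>h<i. w h) + 2 + (\<Sum>h<n - Suc i. w h)) * B"
      by (simp add: sum_distrib_right distrib_right)
    also have "\<dots> \<le> (10 * S + 2 + 10 * S) * B"
      using S unfolding w_def sum_distrib_left[symmetric]
      by (intro mult_right_mono add_mono B0) auto
    finally show ?thesis by (simp add: algebra_simps)
  qed
  have W: "W = (\<lambda>x. \<Sum>i<n. Y i x)" by (simp add: W_def Y_def)
  show "integrable (chain n) (\<lambda>x. (W x)\<^sup>2)"
    unfolding W by (rule C.variance_sum_le(1)) (auto intro: Ysq)
  have "C.variance W = (\<Sum>i<n. \<Sum>j<n. covariance (chain n) (Y i) (Y j))"
    unfolding W by (rule C.variance_sum_le(2)) (auto intro: Ysq)
  also have "\<dots> \<le> (\<Sum>i<n. (2 + 20 * S) * B)" by (intro sum_mono row) auto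
  finally show "C.variance W \<le> real n * ((2 + 20 * S) * m powr (2 / s))" by (simp add: B_def)
qed

lemma chain_sum_tail:
  fixes f :: "'a \<times> 'a \<Rightarrow> real" and a :: "nat \<Rightarrow> real" and n :: nat
  assumes f [measurable]: "f \<in> borel_measurable (mu \<Otimes>\<^sub>M mu)"
    and s: "2 < s" and m: "0 < m"
    and int: "integrable pair_law (\<lambda>z. \<bar>f z\<bar> powr s)" "(\<integral>z. \<bar>f z\<bar> powr s \<partial>pair_law) \<le> m"
    and a: "\<And>h. 0 < a h" "\<And>h. mixing h \<le> a h"
    and S: "\<And>N. (\<Sum>h<N. a h powr (1 - 2 / s)) \<le> S"
    and mean: "(\<integral>z. f z \<partial>pair_law) \<le> c" and z: "0 < z"
  shows "measure (chain n) {x \<in> space (chain n). real n * c + z \<le> (\<Sum>i<n. f (x i, x (Suc i)))}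
    \<le> real n * ((2 + 20 * S) * m powr (2 / s)) / z\<^sup>2"
proof -
  interpret C: prob_space "chain n" by (rule prob_space_chain)
  interpret R: prob_space pair_law by (rule prob_space_pair_law)
  let ?W = "\<lambda>x. \<Sum>i<n. f (x i, x (Suc i))"
  have s2: "2 \<le> s" using s by simp
  have Wm [measurable]: "?W \<in> borel_measurable (chain n)"
  proof (rule borel_measurable_sum)
    fix i assume "i \<in> {..<n}"
    then have [simp]: "i \<le> n" "Suc i \<le> n" by auto
    show "(\<lambda>x. f (x i, x (Suc i))) \<in> borel_measurable (chain n)" by measurable
  qed
  have intf: "integrable pair_law f"
    by (rule R.moment_facts(2)[OF _ s2 zero_less_one int]) measurable
  have "C.expectation ?W = (\<Sum>i<n. \<integral>x. f (x i, x (Suc i)) \<partial>chain n)"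
    using integral_chain_pair(2)[of f _ n] intf by (intro Bochner_Integration.integral_sum) auto
  also have "\<dots> = real n * (\<integral>z. f z \<partial>pair_law)"
    using integral_chain_pair(1)[of f _ n] by simp
  finally have EW: "C.expectation ?W \<le> real n * c" using mean by (simp add: mult_left_mono)
  have "{x \<in> space (chain n). real n * c + z \<le> ?W x} \<subseteq> {x \<in> space (chain n). z
      \<le> \<bar>?W x - C.expectation ?W\<bar>}"
    using EW by auto
  then have "C.prob {x \<in> space (chain n). real n * c + z \<le> ?W x}
    \<le> C.prob {x \<in> space (chain n). z \<le> \<bar>?W x - C.expectation ?W\<bar>}"
    by (intro C.finite_measure_mono) measurable
  also have "\<dots> \<le> C.variance ?W / z\<^sup>2"
    by (rule C.Chebyshev_inequality[OF Wm variance_chain_sum_le(1)[OF f s m int a S] z])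
  also have "\<dots> \<le> real n * ((2 + 20 * S) * m powr (2 / s)) / z\<^sup>2"
    by (intro divide_right_mono variance_chain_sum_le(2)[OF f s m int a S]) simp
  finally show ?thesis .
qed

text \<open>Lag 0 makes X_0 independent of itself, so each \<open>Q\<close>-probability equals its
  own square. Lag 1 makes rectangles multiply. The events of probability 0 or 1 are closed under
  complements and countable unions, so they include everything generated by the rectangles.\<close>

lemma zero_one_pair_law:
  assumes mix: "\<And>h. mixing h = 0" and E: "E \<in> sets pair_law"
  shows "measure pair_law E = 0 \<or> measure pair_law E = 1"
proof -
  interpret R: prob_space pair_law by (rule prob_space_pair_law)
  have ind: "(\<integral>x. indicator D (x i) \<partial>chain n :: real) = measure Q D" if [measurable]: "D \<in> sets mu"
      and "i \<le> n" for D i n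
  proof -
    have "(\<integral>\<^sup>+ x. ennreal (indicator D (x i)) \<partial>chain n) = (\<integral>\<^sup>+ x. ennreal (indicator D x) \<partial>Q)"
      by (rule nn_integral_chain_coord[OF _ \<open>i \<le> n\<close>]) measurable
    then have "(\<integral>x. indicator D (x i) \<partial>chain n :: real) = (\<integral>x. indicator D x \<partial>Q)"
      using \<open>i \<le> n\<close> by (simp only: integral_eq_nn_integral[OF _ AE_I2] indicator_pos_le
          borel_measurable_indicator that sets_Q
          measurable_compose[OF chain_component_measurable borel_measurable_indicator])
    moreover have "D \<inter> space mu = D" using sets.sets_into_space[OF that(1)] by auto
    ultimately show ?thesis by simp
  qed
  have Q01: "measure Q A = 0 \<or> measure Q A = 1" if [measurable]: "A \<in> sets mu" for A
  proof -
    have eq: "indicator A (x (0::nat)) * indicator A (x 0) = (indicator A (x 0) :: real)" for x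
      by (simp add: indicator_def)
    have "(measure Q A) * (1 - measure Q A) = 0"
      using mixing_bound[OF that that, of 0] unfolding eq mix ind[OF that order_refl]
          by (simp add: algebra_simps)
    then show ?thesis by simp
  qed
  have "E \<in> sigma_sets (space mu \<times> space mu) {A \<times> B |A B. A \<in> sets mu \<and> B \<in> sets mu}"
    using E by (simp add: sets_pair_measure)
  then show ?thesis
  proof (induction rule: sigma_sets.induct)
    case (Basic E)
    then obtain A B where AB: "E = A \<times> B" and [measurable]: "A \<in> sets mu" "B \<in> sets mu" by auto
    have "measure pair_law E = (\<integral>z. indicator E z \<partial>pair_law)"
      using AB sets.Int_space_eq2[of E pair_law] by simp
    also have "\<dots> = (\<integral>x. indicator E (x 0, x (Suc 0)) \<partial>chain 1)"
      using AB by (subst integral_chain_pair) auto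
    also have "\<dots> = (\<integral>x. indicator A (x 0) * indicator B (x 1) \<partial>chain 1)"
      unfolding AB by (intro Bochner_Integration.integral_cong) (auto simp: indicator_def)
    also have "\<dots> = measure Q A * measure Q B"
      using mixing_bound[of A B 1] by (simp add: mix ind)
    finally show ?case using Q01[of A] Q01[of B] by auto
  next
    case Empty
    then show ?case by simp
  next
    case (Compl E)
    then have Es: "E \<in> sets pair_law" by (simp add: sets_pair_measure)
    have "space mu \<times> space mu - E = space pair_law - E"
      using sets_eq_imp_space_eq[OF sets_pair_law] by (simp add: space_pair_measure)
    then show ?case using Compl Es by (auto simp: R.prob_compl)
  next
    case (Union A)
    then have A: "range A \<subseteq> sets pair_law" by (auto simp: sets_pair_measure)
    show ?case
    proof (cases "\<forall>i. measure pair_law (A i) = 0")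
      case True
      then have "(\<Union>i. A i) \<in> null_sets pair_law"
        using A by (intro null_sets_UN) (auto simp: null_sets_def R.emeasure_eq_measure)
      then show ?thesis by (simp add: null_sets_def R.emeasure_eq_measure)
    next
      case False
      then obtain i where "measure pair_law (A i) = 1" using Union by auto
      moreover have "measure pair_law (A i) \<le> measure pair_law (\<Union>i. A i)"
        using A by (intro R.finite_measure_mono) auto
      ultimately show ?thesis using R.prob_le_1[of "\<Union>i. A i"] by (metis order_antisym)
    qed
  qed
qed

end

section \<open>Likelihood ratios on the Kullback-Leibler neighbourhood\<close>

lemma powr_max_le:
  fixes a b r :: real
  assumes "0 \<le> a" "0 \<le> b" "0 \<le> r"
  shows "max a b powr r \<le> a powr r + b powr r"
  using assms by (cases "a \<le> b") (auto simp: max_def)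

context stationary_chain
begin

lemma AE_chain_likelihood_pos: "AE x in chain n. 0 < likelihood p q n \<theta> x"
  unfolding chain_law_def by (subst AE_density) auto

lemma distr_chain_coord:
  assumes "i \<le> n"
  shows "distr (chain n) mu (\<lambda>x. x i) = Q"
proof (rule measure_eqI)
  fix A assume "A \<in> sets (distr (chain n) mu (\<lambda>x. x i))"
  then have A: "A \<in> sets mu" by simp
  have m: "(\<lambda>x. x i) \<in> measurable (chain n) mu" using assms by simp
  have "emeasure (distr (chain n) mu (\<lambda>x. x i)) A = (\<integral>\<^sup>+ z. indicator A z \<partial>distr (chain n) mu (\<lambda>x. x i))"
    using A by simp
  also have "\<dots> = (\<integral>\<^sup>+ x. indicator A (x i) \<partial>chain n)"
    by (rule nn_integral_distr[OF m]) (simp add: borel_measurable_indicator[OF A])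
  also have "\<dots> = emeasure Q A"
    using A assms by (subst nn_integral_chain_coord) auto
  finally show "emeasure (distr (chain n) mu (\<lambda>x. x i)) A = emeasure Q A" .
qed simp

lemma AE_chain_coord:
  assumes P: "AE y in Q. P y" and pm: "Measurable.pred mu P" and "i \<le> n"
  shows "AE x in chain n. P (x i)"
proof -
  have m: "(\<lambda>x. x i) \<in> measurable (chain n) mu" using \<open>i \<le> n\<close> by simp
  have "AE y in distr (chain n) mu (\<lambda>x. x i). P y"
    unfolding distr_chain_coord[OF \<open>i \<le> n\<close>] by (rule P)
  moreover have "{y \<in> space mu. P y} \<in> sets mu" using pm by measurable
  ultimately show ?thesis by (simp only: AE_distr_iff[OF m])
qed

lemma AE_chain_pair:
  assumes P: "AE z in pair_law. P z" and [measurable]: "Measurable.pred (mu \<Otimes>\<^sub>M mu) P" and "i < n"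
  shows "AE x in chain n. P (x i, x (Suc i))"
proof -
  have [simp]: "i \<le> n" "Suc i \<le> n" using \<open>i < n\<close> by auto
  have "AE z in distr (chain n) (mu \<Otimes>\<^sub>M mu) (\<lambda>x. (x i, x (Suc i))). P z"
    unfolding distr_chain_pair[OF \<open>i < n\<close>] by (rule P)
  moreover have "{z \<in> space (mu \<Otimes>\<^sub>M mu). P z} \<in> sets (mu \<Otimes>\<^sub>M mu)" using assms(2) by measurable
  moreover have "(\<lambda>x. (x i, x (Suc i))) \<in> measurable (chain n) (mu \<Otimes>\<^sub>M mu)" by simp
  ultimately show ?thesis by (simp only: AE_distr_iff)
qed

text \<open>Factor by factor, b = a exp (- ln (a / b)) once a is positive, b is nonnegative and the
  log ratio is not infinite. Almost sure positivity of the likelihood under \<theta> makes every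
  factor of it nonzero at once.\<close>

lemma AE_likelihood_ratio:
  assumes q': "AE x in Q. log_ratio (q \<theta> x) (q t x) \<noteq> \<infinity>"
    and p': "AE (x, y) in pair_law. log_ratio (p \<theta> x y) (p t x y) \<noteq> \<infinity>"
    and [measurable]: "q t \<in> borel_measurable mu" "case_prod (p t) \<in> borel_measurable (mu \<Otimes>\<^sub>M mu)"
    and nonneg: "\<And>x. x \<in> space mu \<Longrightarrow> 0 \<le> q t x" "\<And>x y. x \<in> space mu \<Longrightarrow> y \<in> space mu \<Longrightarrow> 0 \<le> p t x y"
  shows "AE x in chain n. likelihood p q n t x = likelihood p q n \<theta> x *
    exp (- (ln (q \<theta> (x 0) / q t (x 0)) + (\<Sum>i<n. ln (p \<theta> (x i) (x (Suc i)) / p t (x i) (x (Suc i))))))"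
proof -
  have [measurable]: "(\<lambda>z. p \<theta> (fst z) (snd z)) \<in> borel_measurable (mu \<Otimes>\<^sub>M mu)"
    "(\<lambda>z. p t (fst z) (snd z)) \<in> borel_measurable (mu \<Otimes>\<^sub>M mu)"
    using assms(4) by (simp_all add: case_prod_beta')
  have aeq: "AE x in chain n. log_ratio (q \<theta> (x 0)) (q t (x 0)) \<noteq> \<infinity>"
    by (rule AE_chain_coord[OF q']) auto
  have "AE x in chain n. \<forall>i\<in>{..<n}. log_ratio (p \<theta> (x i) (x (Suc i))) (p t (x i) (x (Suc i))) \<noteq> \<infinity>"
  proof (rule AE_finite_allI)
    fix i assume "i \<in> {..<n}"
    then show "AE x in chain n. log_ratio (p \<theta> (x i) (x (Suc i))) (p t (x i) (x (Suc i))) \<noteq> \<infinity>"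
      using AE_chain_pair[of "\<lambda>z. log_ratio (p \<theta> (fst z) (snd z)) (p t (fst z) (snd z)) \<noteq> \<infinity>" i n] p'
      by (auto simp: case_prod_beta')
  qed simp
  with aeq AE_chain_likelihood_pos AE_space show ?thesis
  proof eventually_elim
    case (elim x)
    have sp: "x i \<in> space mu" if "i \<le> n" for i using chain_coord_space[OF elim(3) that] .
    have ratio: "b = a * exp (- ln (a / b))" if "a \<noteq> 0" "0 \<le> a" "0 \<le> b" "log_ratio a b \<noteq> \<infinity>"
        for a b :: real
    proof -
      have "b \<noteq> 0" using log_ratio_finite[OF _ that(4)] that(1) by auto
      then show ?thesis using that by (simp add: exp_minus)
    qed
    have pos: "q \<theta> (x 0) \<noteq> 0" "\<And>i. i < n \<Longrightarrow> p \<theta> (x i) (x (Suc i)) \<noteq> 0"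
      using less_imp_neq[OF elim(2)] unfolding likelihood_lessThan by (auto simp: prod_zero_iff)
    have q: "q t (x 0) = q \<theta> (x 0) * exp (- ln (q \<theta> (x 0) / q t (x 0)))"
      by (rule ratio) (use pos sp elim q_nonneg nonneg in auto)
    have pp: "p t (x i) (x (Suc i)) = p \<theta> (x i) (x (Suc i)) * exp (- ln (p \<theta> (x i) (x (Suc i)) / p t
        (x i) (x (Suc i))))"
      if "i < n" for i
      by (rule ratio) (use pos sp elim p_nonneg nonneg that in auto)
    have "likelihood p q n t x = (q \<theta> (x 0) * exp (- ln (q \<theta> (x 0) / q t (x 0)))) *
      (\<Prod>i<n. p \<theta> (x i) (x (Suc i)) * exp (- ln (p \<theta> (x i) (x (Suc i)) / p t (x i) (x (Suc i)))))"
      unfolding likelihood_lessThan using q pp by (metis (no_types, lifting) lessThan_iff prod.cong)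
    also have "\<dots> = likelihood p q n \<theta> x *
      exp (- (ln (q \<theta> (x 0) / q t (x 0)) + (\<Sum>i<n. ln (p \<theta> (x i) (x (Suc i)) / p t (x i) (x (Suc i))))))"
      by (simp add: likelihood_lessThan prod.distrib exp_diff exp_sum exp_minus divide_inverse
          mult_ac flip: prod_inversef)
    finally show ?case .
  qed
qed

text \<open>Markov's inequality for the squared log ratio of the stationary densities. The same
  finite second moment excludes the value infinity.\<close>

lemma initial_tail:
  assumes V: "KL_var mu (q \<theta>) (q t) \<le> 1" and [measurable]: "q t \<in> borel_measurable mu" and y: "0 < y"
  shows "measure (chain n) {x \<in> space (chain n). y \<le> ln (q \<theta> (x 0) / q t (x 0))} \<le> 1 / y\<^sup>2"
    and "AE x in Q. log_ratio (q \<theta> x) (q t x) \<noteq> \<infinity>"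
proof -
  interpret C: prob_space "chain n" by (rule prob_space_chain)
  let ?L = "\<lambda>x. abs_powr (log_ratio (q \<theta> x) (q t x)) 2"
  have L: "(\<integral>\<^sup>+ x. ?L x \<partial>Q) \<le> 1" using V by (simp add: KL_var_def Q_def)
  have "?L \<in> borel_measurable mu" by measurable
  then have Lm: "?L \<in> borel_measurable Q" by (simp only: measurable_cong_sets[OF sets_Q refl])
  have "(\<integral>\<^sup>+ x. ?L x \<partial>Q) < \<infinity>" using L by (rule order_le_less_trans) simp
  then have "AE x in Q. ?L x \<noteq> \<infinity>" using nn_integral_PInf_AE[OF Lm] by simp
  then show "AE x in Q. log_ratio (q \<theta> x) (q t x) \<noteq> \<infinity>"
    by eventually_elim (auto simp: abs_powr_def)
  define A where "A = {z \<in> space mu. y \<le> ln (q \<theta> z / q t z)}"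
  have [measurable]: "A \<in> sets mu" unfolding A_def by measurable
  have le: "ennreal (y\<^sup>2) * indicator A z \<le> ?L z" for z
  proof (cases "z \<in> A")
    case True
    then have "y\<^sup>2 \<le> \<bar>real_of_ereal (log_ratio (q \<theta> z) (q t z))\<bar> powr 2"
      using y by (simp add: A_def real_log_ratio powr_numeral power_mono)
    then show ?thesis using abs_powr_ge[of "log_ratio (q \<theta> z) (q t z)" 2]
      by (simp add: True) (meson ennreal_leI order_trans)
  qed simp
  have "ennreal (y\<^sup>2) * emeasure (chain n) {x \<in> space (chain n). y \<le> ln (q \<theta> (x 0) / q t (x 0))}
    = (\<integral>\<^sup>+ x. ennreal (y\<^sup>2) * indicator A (x 0) \<partial>chain n)"
  proof -
    have "(\<integral>\<^sup>+ x. ennreal (y\<^sup>2) * indicator A (x 0) \<partial>chain n)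
      = (\<integral>\<^sup>+ x. ennreal (y\<^sup>2) * indicator {x \<in> space (chain n). y
          \<le> ln (q \<theta> (x 0) / q t (x 0))} x \<partial>chain n)"
      by (intro nn_integral_cong) (auto simp: A_def indicator_def chain_coord_space[of _ n] simp
          del: space_chain)
    then show ?thesis by (subst (asm) nn_integral_cmult_indicator) auto
  qed
  also have "\<dots> = (\<integral>\<^sup>+ z. ennreal (y\<^sup>2) * indicator A z \<partial>Q)"
    by (rule nn_integral_chain_coord) auto
  also have "\<dots> \<le> (\<integral>\<^sup>+ x. ?L x \<partial>Q)" by (intro nn_integral_mono le)
  finally have "ennreal (y\<^sup>2) * emeasure (chain n) {x \<in> space (chain n). y
      \<le> ln (q \<theta> (x 0) / q t (x 0))} \<le> 1"
    using L by (rule order_trans)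
  then have "y\<^sup>2 * C.prob {x \<in> space (chain n). y \<le> ln (q \<theta> (x 0) / q t (x 0))} \<le> 1"
    by (simp add: C.emeasure_eq_measure flip: ennreal_mult ennreal_1)
  then show "C.prob {x \<in> space (chain n). y \<le> ln (q \<theta> (x 0) / q t (x 0))} \<le> 1 / y\<^sup>2"
    using y by (simp add: field_simps)
qed

text \<open>Mixing coefficients may vanish, so take the maximum with a sequence whose powers with
  exponent 1 - 2/s are the geometric terms 2^(-h); they add at most 2 to the sum.\<close>

lemma mixing_majorant:
  assumes s: "2 < s" and sm: "summable (\<lambda>h. mixing h powr (1 - 2 / s))"
  obtains a where "\<And>h. 0 < a h" "\<And>h. mixing h \<le> a h"
    "\<And>N. (\<Sum>h<N. a h powr (1 - 2 / s)) \<le> (\<Sum>h. mixing h powr (1 - 2 / s)) + 2"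
proof -
  define r where "r = 1 - 2 / s"
  have r: "0 < r" using s by (simp add: r_def)
  define a where "a h = max (mixing h) (((1/2)^h) powr (1 / r))" for h
  have "(\<Sum>h<N. a h powr r) \<le> (\<Sum>h. mixing h powr r) + 2" for N
  proof -
    have "(\<Sum>h<N. a h powr r) \<le> (\<Sum>h<N. mixing h powr r + (1/2)^h)"
    proof (rule sum_mono)
      fix h
      have "a h powr r \<le> mixing h powr r + (((1/2)^h) powr (1 / r)) powr r"
        unfolding a_def using r by (intro powr_max_le mixing_nonneg) auto
      also have "(((1/2)^h :: real) powr (1 / r)) powr r = (1/2)^h"
        using r by (simp add: powr_powr)
      finally show "a h powr r \<le> mixing h powr r + (1/2)^h" .
    qed
    also have "\<dots> = (\<Sum>h<N. mixing h powr r) + (\<Sum>h<N. (1/2)^h)" by (rule sum.distrib)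
    also have "\<dots> \<le> (\<Sum>h. mixing h powr r) + (\<Sum>h. (1/2)^h)"
      using sm by (intro add_mono sum_le_suminf) (auto simp: r_def)
    also have "(\<Sum>h. (1/2)^h :: real) = 2" by (simp add: suminf_geometric)
    finally show ?thesis .
  qed
  then show thesis
    by (intro that[of a]) (auto simp: a_def r_def less_max_iff_disj)
qed

text \<open>In the degenerate case \<open>c = 0\<close> all mixing coefficients vanish and the moment condition of \<open>Bstar\<close> is
  void, but the law of a pair is then 0-1 valued, so any bound on the mean of the log ratio holds almost
  surely for the log ratio itself.\<close>

lemma transition_sum_tail:
  assumes s: "2 < s" and sm: "summable (\<lambda>h. mixing h powr (1 - 2 / s))" and e: "0 < e" and z: "0 < z"
    and t: "t \<in> Bstar mu T p q \<theta> e s" and pt: "case_prod (p t) \<in> borel_measurable (mu \<Otimes>\<^sub>M mu)"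
  defines "S \<equiv> (\<Sum>h. mixing h powr (1 - 2 / s))"
  shows "measure (chain n) {x \<in> space (chain n). real n * (e\<^sup>2 / 2) + z
      \<le> (\<Sum>i<n. ln (p \<theta> (x i) (x (Suc i)) / p t (x i) (x (Suc i))))}
     \<le> real n * e\<^sup>2 * ((42 + 20 * S) / (16 * s / (s - 2) * S)) / z\<^sup>2"
    and "AE (x, y) in pair_law. log_ratio (p \<theta> x y) (p t x y) \<noteq> \<infinity>"
proof -
  interpret C: prob_space "chain n" by (rule prob_space_chain)
  interpret R: prob_space pair_law by (rule prob_space_pair_law)
  define F where "F w = log_ratio (p \<theta> (fst w) (snd w)) (p t (fst w) (snd w))" for w
  define f where "f w = ln (p \<theta> (fst w) (snd w) / p t (fst w) (snd w))" for w
  have pt' [measurable]: "(\<lambda>w. p t (fst w) (snd w)) \<in> borel_measurable (mu \<Otimes>\<^sub>M mu)"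
    using pt by (simp add: case_prod_beta')
  have F [measurable]: "F \<in> borel_measurable (mu \<Otimes>\<^sub>M mu)" unfolding F_def by measurable
  have f [measurable]: "f \<in> borel_measurable (mu \<Otimes>\<^sub>M mu)" unfolding f_def by measurable
  have fF: "f w = real_of_ereal (F w)" for w by (simp add: f_def F_def real_log_ratio)
  have m01 [measurable]: "(\<lambda>x. (x 0, x 1)) \<in> measurable (chain 1) (mu \<Otimes>\<^sub>M mu)" by simp
  have mean: "ext_integral pair_law F \<le> ereal (e\<^sup>2 / 2)"
  proof -
    have "ext_integral pair_law F = ext_integral (chain 1) (\<lambda>x. F (x 0, x 1))"
      unfolding ext_integral_def pair_law_def by (simp add: nn_integral_distr)
    then show ?thesis using t by (simp add: Bstar_def F_def)
  qed
  have mom: "(\<integral>\<^sup>+ w. abs_powr (F w) s \<partial>pair_law) \<le> C_const mu p q \<theta> s * ennreal (e powr s)"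
  proof -
    have "(\<integral>\<^sup>+ w. abs_powr (F w) s \<partial>pair_law) = (\<integral>\<^sup>+ x. abs_powr (F (x 0, x 1)) s \<partial>chain 1)"
      unfolding pair_law_def by (simp add: nn_integral_distr)
    then show ?thesis using t by (simp add: Bstar_def F_def)
  qed
  define c where "c = 16 * s / (s - 2) * S"
  have S0: "0 \<le> S" unfolding S_def using sm by (intro suminf_nonneg) auto
  have c0: "0 \<le> c" using S0 s by (simp add: c_def)
  have rhs0: "0 \<le> real n * e\<^sup>2 * ((42 + 20 * S) / c) / z\<^sup>2" using S0 c0 by simp
  let ?A = "{x \<in> space (chain n). real n * (e\<^sup>2 / 2) + z \<le> (\<Sum>i<n. f (x i, x (Suc i)))}"
  have "C.prob ?A \<le> real n * e\<^sup>2 * ((42 + 20 * S) / c) / z\<^sup>2 \<and> (AE w in pair_law. F w \<noteq> \<infinity>)"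
  proof (cases "c = 0")
    case True
    then have "S = 0" using s by (simp add: c_def)
    then have "mixing h powr (1 - 2 / s) = 0" for h
      using suminf_eq_zero_iff[OF sm] unfolding S_def by simp
    then have mix: "mixing h = 0" for h by simp
    have "AE w in pair_law. F w \<le> ereal (e\<^sup>2 / 2)"
      by (rule R.zero_one_AE_le[OF zero_one_pair_law[OF mix] _ mean]) auto
    then have Fle: "AE w in pair_law. F w \<noteq> \<infinity> \<and> f w \<le> e\<^sup>2 / 2"
    proof eventually_elim
      case (elim w)
      then show ?case unfolding fF by (cases "F w") auto
    qed
    have "AE x in chain n. \<forall>i\<in>{..<n}. f (x i, x (Suc i)) \<le> e\<^sup>2 / 2"
    proof (rule AE_finite_allI)
      fix i assume "i \<in> {..<n}"
      then show "AE x in chain n. f (x i, x (Suc i)) \<le> e\<^sup>2 / 2"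
        using Fle by (intro AE_chain_pair[where P="\<lambda>w. f w \<le> e\<^sup>2 / 2"]) auto
    qed simp
    then have "AE x in chain n. \<not> real n * (e\<^sup>2 / 2) + z \<le> (\<Sum>i<n. f (x i, x (Suc i)))"
    proof eventually_elim
      case (elim x)
      have "(\<Sum>i<n. f (x i, x (Suc i))) \<le> (\<Sum>i<n. e\<^sup>2 / 2)" by (intro sum_mono) (use elim in auto)
      then show ?case using z by simp
    qed
    \<comment> \<open>With c = 0 the claimed bound is 0 by the convention for division by zero, so
      the probability has to vanish exactly.\<close>
    then have "C.prob ?A = 0"
      by (rule C.prob_eq_0_AE)
    then show ?thesis using Fle rhs0 by (auto elim: AE_mp)
  next
    case False
    then have cpos: "0 < c" using c0 by simp
    define m where "m = c powr (- s / 2) * e powr s"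
    have m: "0 < m" using cpos e by (simp add: m_def)
    have "C_const mu p q \<theta> s = ennreal (c powr (- s / 2))"
      using False by (simp add: C_const_def c_def S_def Let_def)
    then have mom': "(\<integral>\<^sup>+ w. abs_powr (F w) s \<partial>pair_law) \<le> ennreal m"
      using mom by (simp add: m_def ennreal_mult)
    then have "(\<integral>\<^sup>+ w. abs_powr (F w) s \<partial>pair_law) \<noteq> \<infinity>" by (auto simp: top_unique)
    then have "AE w in pair_law. abs_powr (F w) s \<noteq> \<infinity>" by (intro nn_integral_PInf_AE) auto
    then have Ffin: "AE w in pair_law. \<bar>F w\<bar> \<noteq> \<infinity>" by eventually_elim (auto simp: abs_powr_def)
    have fs: "(\<integral>\<^sup>+ w. ennreal (\<bar>f w\<bar> powr s) \<partial>pair_law) \<le> ennreal m"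
      using mom' unfolding fF by (rule order_trans[OF nn_integral_mono[OF abs_powr_ge]])
    have ints: "integrable pair_law (\<lambda>w. \<bar>f w\<bar> powr s)"
      by (rule integrableI_bounded) (use fs in \<open>auto simp: le_less_trans\<close>)
    have ms: "(\<integral>w. \<bar>f w\<bar> powr s \<partial>pair_law) \<le> m"
      using fs m by (subst (asm) nn_integral_eq_integral[OF ints]) auto
    have s2: "2 \<le> s" using s by simp
    have intf: "integrable pair_law f"
      by (rule R.moment_facts(2)[OF _ s2 zero_less_one ints ms]) measurable
    have "ext_integral pair_law F = ereal (\<integral>w. f w \<partial>pair_law)"
      using Ffin by (intro ext_integral_eq_integral intf) (auto simp: fF ereal_real' elim: AE_mp)
    then have mean': "(\<integral>w. f w \<partial>pair_law) \<le> e\<^sup>2 / 2" using mean by simp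
    \<comment> \<open>The extra 2 of the majorant turns the variance factor 2 + 20 S into 42 + 20
      S.\<close>
    obtain a where a: "\<And>h. 0 < a h" "\<And>h. mixing h \<le> a h" "\<And>N. (\<Sum>h<N. a h powr (1 - 2 / s)) \<le> S + 2"
      using mixing_majorant[OF s sm] unfolding S_def by blast
    \<comment> \<open>The exponent in \<open>C_const\<close> is made for this identity: the variance
      bound becomes a constant times n e^2.\<close>
    have "m powr (2 / s) = e\<^sup>2 / c"
    proof -
      have "m powr (2 / s) = (c powr (- s / 2)) powr (2 / s) * (e powr s) powr (2 / s)"
        using cpos e by (simp add: m_def powr_mult)
      also have "(c powr (- s / 2)) powr (2 / s) = inverse c"
        using cpos s by (simp only: powr_powr) (simp add: powr_minus)
      also have "(e powr s) powr (2 / s) = e\<^sup>2" using e s by (simp add: powr_powr powr_numeral)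
      finally show ?thesis by (simp add: divide_inverse mult.commute)
    qed
    then have "C.prob ?A \<le> real n * ((2 + 20 * (S + 2)) * (e\<^sup>2 / c)) / z\<^sup>2"
      using chain_sum_tail[OF f s m ints ms a mean' z] by simp
    also have "\<dots> = real n * e\<^sup>2 * ((42 + 20 * S) / c) / z\<^sup>2"
    proof -
      have "2 + 20 * (S + 2) = 42 + 20 * S" by simp
      then show ?thesis by (simp only: times_divide_eq_left times_divide_eq_right mult_ac)
    qed
    finally show ?thesis using Ffin by (auto elim: AE_mp)
  qed
  then show "C.prob {x \<in> space (chain n). real n * (e\<^sup>2 / 2) + z
      \<le> (\<Sum>i<n. ln (p \<theta> (x i) (x (Suc i)) / p t (x i) (x (Suc i))))}
     \<le> real n * e\<^sup>2 * ((42 + 20 * S) / (16 * s / (s - 2) * S)) / z\<^sup>2"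
    and "AE (x, y) in pair_law. log_ratio (p \<theta> x y) (p t x y) \<noteq> \<infinity>"
    by (simp_all add: f_def F_def c_def case_prod_beta')
qed

lemma likelihood_tail:
  assumes s: "2 < s" and sm: "summable (\<lambda>h. mixing h powr (1 - 2 / s))" and e: "0 < e" and L: "0 < L"
    and ne: "2 \<le> real n * e\<^sup>2"
    and t: "t \<in> Bstar mu T p q \<theta> e s"
    and pt: "transition_density mu (p t)" and qt: "stationary_density mu (p t) (q t)"
  defines "S \<equiv> (\<Sum>h. mixing h powr (1 - 2 / s))"
  shows "measure (chain n) {x \<in> space (chain n). likelihood p q n t x < exp (- (2 * (real n * e\<^sup>2)
      + L)) * likelihood p q n \<theta> x}
    \<le> (1 + (42 + 20 * S) / (16 * s / (s - 2) * S)) / L"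
proof -
  interpret C: prob_space "chain n" by (rule prob_space_chain)
  define x0 where "x0 = real n * e\<^sup>2"
  have x0: "2 \<le> x0" using ne by (simp add: x0_def)
  have qtm [measurable]: "q t \<in> borel_measurable mu"
      and ptm: "case_prod (p t) \<in> borel_measurable (mu \<Otimes>\<^sub>M mu)"
    and nonneg: "\<And>x. x \<in> space mu \<Longrightarrow> 0 \<le> q t x" "\<And>x y. x \<in> space mu \<Longrightarrow> y \<in> space mu \<Longrightarrow> 0 \<le> p t x y"
    using pt qt unfolding transition_density_def stationary_density_def by blast+
  have V: "KL_var mu (q \<theta>) (q t) \<le> 1" using t by (simp add: Bstar_def Theta1_def)
  \<comment> \<open>The budget 2 x0 + L is split three ways: x0 / 2 for the largest mean of the
    transition part, z for its fluctuation, and y1 for the initial density.\<close>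
  define y1 z where "y1 = x0 + L / 2" and "z = x0 / 2 + L / 2"
  have y1: "0 < y1" and z: "0 < z" using x0 L by (auto simp: y1_def z_def)
  define D where "D = (42 + 20 * S) / (16 * s / (s - 2) * S)"
  have S0: "0 \<le> S" unfolding S_def using sm by (intro suminf_nonneg) auto
  have D0: "0 \<le> D" using S0 s by (simp add: D_def)
  let ?h = "\<lambda>x. ln (q \<theta> (x 0) / q t (x 0))"
  let ?g = "\<lambda>x. \<Sum>i<n. ln (p \<theta> (x i) (x (Suc i)) / p t (x i) (x (Suc i)))"
  let ?A1 = "{x \<in> space (chain n). y1 \<le> ?h x}" and ?A2
      = "{x \<in> space (chain n). real n * (e\<^sup>2 / 2) + z \<le> ?g x}"
  let ?A = "{x \<in> space (chain n). likelihood p q n t x < exp (- (2 * x0 + L)) * likelihood p q n \<theta> x}"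
  note tail = transition_sum_tail[OF s sm e z t ptm, folded S_def, folded D_def x0_def]
  note init = initial_tail[OF V \<open>q t \<in> borel_measurable mu\<close> y1]
  have gm [measurable]: "?g \<in> borel_measurable (chain n)"
  proof (rule borel_measurable_sum)
    fix i assume "i \<in> {..<n}"
    then have [simp]: "i \<le> n" "Suc i \<le> n" by auto
    have [measurable]: "(\<lambda>w. p t (fst w) (snd w)) \<in> borel_measurable (mu \<Otimes>\<^sub>M mu)"
      using ptm by (simp add: case_prod_beta')
    have "(\<lambda>x. (\<lambda>w. p t (fst w) (snd w)) (x i, x (Suc i))) \<in> borel_measurable (chain n)" by measurable
    then have [measurable]: "(\<lambda>x. p t (x i) (x (Suc i))) \<in> borel_measurable (chain n)" by simp
    show "(\<lambda>x. ln (p \<theta> (x i) (x (Suc i)) / p t (x i) (x (Suc i)))) \<in> borel_measurable (chain n)"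
        by measurable
  qed
  have "(\<lambda>y. ln (q \<theta> y / q t y)) \<in> borel_measurable mu" by measurable
  then have "?h \<in> borel_measurable (chain n)"
    by (rule measurable_compose[OF chain_component_measurable[OF le0]])
  then have A1m: "?A1 \<in> sets (chain n)" by (rule borel_measurable_le[OF borel_measurable_const])
  have A2m: "?A2 \<in> sets (chain n)" by (rule borel_measurable_le[OF borel_measurable_const gm])
  have "AE x in chain n. likelihood p q n t x = likelihood p q n \<theta> x * exp (- (?h x + ?g x))"
    by (rule AE_likelihood_ratio[OF init(2) tail(2) qtm ptm]) (use nonneg in auto)
  then have "AE x in chain n. x \<in> ?A \<longrightarrow> x \<in> ?A1 \<union> ?A2"
    using AE_chain_likelihood_pos[of n]
  proof eventually_elim
    case (elim x)
    show ?case
    proof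
      assume x: "x \<in> ?A"
      then have "exp (- (?h x + ?g x)) < exp (- (2 * x0 + L))"
        using elim by (simp add: mult.commute[of _ "likelihood p q n \<theta> x"])
      then have "2 * x0 + L < ?h x + ?g x" by simp
      moreover have "2 * x0 + L = y1 + (real n * (e\<^sup>2 / 2) + z)"
        by (simp add: y1_def z_def x0_def field_simps)
      ultimately show "x \<in> ?A1 \<union> ?A2" using x by auto
    qed
  qed
  then have "C.prob ?A \<le> C.prob (?A1 \<union> ?A2)"
    by (rule C.finite_measure_mono_AE) (rule sets.Un[OF A1m A2m])
  also have "\<dots> \<le> C.prob ?A1 + C.prob ?A2"
    by (rule measure_Un_le[OF A1m A2m])
  also have "\<dots> \<le> 1 / y1\<^sup>2 + x0 * D / z\<^sup>2"
    using init(1) tail(1) by (intro add_mono) (simp_all add: x0_def)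
  also have "\<dots> \<le> 1 / L + D / L"
  proof (intro add_mono)
    have "L \<le> x0 * L" using x0 L by simp
    also have "x0 * L \<le> y1\<^sup>2" using x0 L by (simp add: y1_def power2_eq_square algebra_simps)
    finally show "1 / y1\<^sup>2 \<le> 1 / L" using L y1 by (simp add: frac_le)
    \<comment> \<open>The arithmetic-geometric mean inequality cancels the factor x0 of the variance
      and leaves a bound in \<open>L\<close> alone.\<close>
    have "x0 * L \<le> z\<^sup>2"
      using zero_le_power2[of "x0 / 2 - L / 2"] by (simp add: z_def power2_eq_square algebra_simps)
    then have "x0 * D * L \<le> D * z\<^sup>2" using D0 by (simp add: mult_left_mono mult.assoc mult.left_commute)
    then show "x0 * D / z\<^sup>2 \<le> D / L" using L z by (simp add: field_simps)
  qed
  also have "\<dots> = (1 + D) / L" by (simp add: add_divide_distrib)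
  finally show ?thesis by (simp add: D_def x0_def)
qed

end

section \<open>Posterior mass, evidence and tests\<close>

text \<open>An abstract dominated model with a jointly measurable likelihood. The Markov structure
  returns only through hypotheses of the lemmas, namely the likelihood tail and the errors of the
  tests. No sign is imposed on \<open>l\<close>, since \<open>ennreal\<close> sends negative values
  to 0.\<close>

locale bayes_model = Pr: prob_space Pr + N: sigma_finite_measure N
  for Pr :: "'p measure" and N :: "'x measure" +
  fixes l :: "'p \<Rightarrow> 'x \<Rightarrow> real" and t0 :: 'p
  assumes l_measurable: "case_prod l \<in> borel_measurable (Pr \<Otimes>\<^sub>M N)"
    and t0: "t0 \<in> space Pr"
begin

definition evidence :: "'x \<Rightarrow> ennreal" where
  "evidence x = (\<integral>\<^sup>+ t. ennreal (l t x) \<partial>Pr)"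

text \<open>The division stands inside the integral, as in \<open>posterior\<close>; the two are
  then identified without distinguishing whether \<open>evidence x\<close> is 0 or infinite.\<close>

definition post :: "'p set \<Rightarrow> 'x \<Rightarrow> ennreal" where
  "post A x = (\<integral>\<^sup>+ t. ennreal (l t x) / evidence x * indicator A t \<partial>Pr)"

definition law :: "'p \<Rightarrow> 'x measure" where
  "law t = density N (\<lambda>x. ennreal (l t x))"

lemma l_compose [measurable (raw)]:
  assumes "f \<in> measurable R Pr" "g \<in> measurable R N"
  shows "(\<lambda>w. l (f w) (g w)) \<in> borel_measurable R"
  using measurable_compose[OF measurable_Pair[OF assms] l_measurable] by simp

lemma evidence_measurable [measurable]: "evidence \<in> borel_measurable N"
  unfolding evidence_def by measurable

lemma post_measurable [measurable]:
  assumes [measurable]: "A \<in> sets Pr"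
  shows "post A \<in> borel_measurable N"
  unfolding post_def by measurable

lemma l_t0_measurable [measurable]: "l t0 \<in> borel_measurable N"
  using t0 by measurable

lemma sets_law [measurable_cong, simp]: "sets (law t) = sets N"
  by (simp add: law_def)

lemma space_law [simp]: "space (law t) = space N"
  by (simp add: law_def)

lemma nn_integral_law:
  assumes "t \<in> space Pr" "f \<in> borel_measurable N"
  shows "(\<integral>\<^sup>+ x. f x \<partial>law t) = (\<integral>\<^sup>+ x. ennreal (l t x) * f x \<partial>N)"
  unfolding law_def using assms by (intro nn_integral_density) auto

lemma post_eq:
  assumes [measurable]: "A \<in> sets Pr" and x: "x \<in> space N"
  shows "post A x = (\<integral>\<^sup>+ t. ennreal (l t x) * indicator A t \<partial>Pr) / evidence x"
proof -
  have "post A x = (\<integral>\<^sup>+ t. ennreal (l t x) * indicator A t / evidence x \<partial>Pr)"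
    unfolding post_def by (intro nn_integral_cong) (simp add: indicator_def)
  also have "\<dots> = (\<integral>\<^sup>+ t. ennreal (l t x) * indicator A t \<partial>Pr) / evidence x"
    using assms by (intro nn_integral_divide) measurable
  finally show ?thesis .
qed

lemma post_mono: "A \<subseteq> B \<Longrightarrow> post A x \<le> post B x"
  unfolding post_def by (intro nn_integral_mono mult_left_mono) (auto simp: indicator_def)

text \<open>This includes a failing normalisation: in \<open>ennreal\<close> both 0 / 0 and infinity
  / infinity are 0.\<close>

lemma post_le_1:
  assumes "A \<in> sets Pr" "x \<in> space N"
  shows "post A x \<le> 1"
proof -
  have "post A x \<le> post (space Pr) x"
    using sets.sets_into_space[OF assms(1)] by (rule post_mono)
  also have "\<dots> = evidence x / evidence x"
    using assms by (subst post_eq) (auto simp: evidence_def cong: nn_integral_cong)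
  also have "\<dots> \<le> 1"
    by (cases "evidence x = 0 \<or> evidence x = \<top>") (auto
        simp: ennreal_divide_self top.not_eq_extremum zero_less_iff_neq_zero)
  finally show ?thesis .
qed

lemma post_UN_le:
  assumes A: "A \<in> sets Pr" and Z: "Z \<in> sets Pr" and B: "\<And>j. B j \<in> sets Pr"
    and sub: "A \<subseteq> Z \<union> (\<Union>j::nat. B j)" and x: "x \<in> space N"
  shows "post A x \<le> post Z x + (\<Sum>j. post (B j) x)"
proof -
  define M where "M = density Pr (\<lambda>t. ennreal (l t x) / evidence x)"
  have em: "post C x = emeasure M C" if "C \<in> sets Pr" for C
    using that x unfolding M_def post_def by (subst emeasure_density) auto
  have sM: "sets M = sets Pr" by (simp add: M_def)
  have "emeasure M A \<le> emeasure M (Z \<union> (\<Union>j. B j))"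
    using sub Z B by (intro emeasure_mono) (auto simp: sM)
  also have "\<dots> \<le> emeasure M Z + emeasure M (\<Union>j. B j)"
    using Z B by (intro emeasure_subadditive) (auto simp: sM)
  also have "emeasure M (\<Union>j. B j) \<le> (\<Sum>j. emeasure M (B j))"
    using B by (intro emeasure_subadditive_countably) (auto simp: sM)
  finally show ?thesis using A Z B by (simp add: em add_left_mono)
qed

text \<open>The normalisation cancels: \<open>l t0 / evidence\<close> is at most \<open>1 / c\<close> on the good event.\<close>

lemma nn_integral_post_le:
  assumes A [measurable]: "A \<in> sets Pr" and psi [measurable]: "psi \<in> borel_measurable N" and c: "0 < c"
  shows "(\<integral>\<^sup>+ x. psi x * post A x * indicator {x \<in> space N. ennreal (c * l t0 x) \<le> evidence x} x \<partial>law t0)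
    \<le> (\<integral>\<^sup>+ t. (\<integral>\<^sup>+ x. psi x \<partial>law t) * indicator A t \<partial>Pr) / ennreal c"
proof -
  interpret PN: pair_sigma_finite Pr N by standard
  let ?G = "{x \<in> space N. ennreal (c * l t0 x) \<le> evidence x}"
  let ?a = "\<lambda>x. \<integral>\<^sup>+ t. ennreal (l t x) * indicator A t \<partial>Pr"
  have pt: "ennreal (l t0 x) * (psi x * post A x * indicator ?G x) \<le> psi x * ?a x / ennreal c"
    if x: "x \<in> space N" for x
  proof (cases "x \<in> ?G \<and> 0 < l t0 x")
    case True
    have inv: "ennreal (l t0 x) / evidence x \<le> 1 / ennreal c"
    proof -
      have "ennreal (l t0 x) / ennreal d \<le> ennreal (1 / c)" if "ennreal (c * l t0 x) \<le> ennreal d" "0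
          \<le> d" for d
      proof -
        have d: "c * l t0 x \<le> d" using that by (auto simp: ennreal_le_iff)
        have pos: "0 < c * l t0 x" using True c by simp
        then have "l t0 x / d \<le> l t0 x / (c * l t0 x)" using True d by (intro divide_left_mono) auto
        also have "\<dots> = 1 / c" using True by simp
        finally show ?thesis using True d pos by (subst divide_ennreal) (auto intro: ennreal_leI)
      qed
      then have "ennreal (l t0 x) / evidence x \<le> ennreal (1 / c)"
        using True by (cases "evidence x") auto
      also have "ennreal (1 / c) = 1 / ennreal c"
        using c by (simp add: divide_ennreal flip: ennreal_1)
      finally show ?thesis .
    qed
    have "ennreal (l t0 x) * (psi x * post A x * indicator ?G x)
      = psi x * ?a x * (ennreal (l t0 x) / evidence x)"
      using True x by (simp add: post_eq ennreal_times_divide divide_ennreal_def mult_ac)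
    also have "\<dots> \<le> psi x * ?a x * (1 / ennreal c)"
      by (intro mult_left_mono inv) simp
    finally show ?thesis by (simp add: divide_ennreal_def)
  next
    case False
    then have "ennreal (l t0 x) = 0 \<or> indicator ?G x = (0::ennreal)" using x by (auto simp: ennreal_neg)
    then show ?thesis by auto
  qed
  have "(\<integral>\<^sup>+ x. psi x * post A x * indicator ?G x \<partial>law t0)
      = (\<integral>\<^sup>+ x. ennreal (l t0 x) * (psi x * post A x * indicator ?G x) \<partial>N)"
    by (rule nn_integral_law[OF t0]) measurable
  also have "\<dots> \<le> (\<integral>\<^sup>+ x. psi x * ?a x / ennreal c \<partial>N)"
    by (intro nn_integral_mono pt)
  also have "\<dots> = (\<integral>\<^sup>+ x. psi x * ?a x \<partial>N) / ennreal c"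
    by (rule nn_integral_divide) measurable
  also have "(\<integral>\<^sup>+ x. psi x * ?a x \<partial>N) = (\<integral>\<^sup>+ x. (\<integral>\<^sup>+ t. ennreal (l t x) * psi x * indicator A t \<partial>Pr) \<partial>N)"
    by (intro nn_integral_cong, subst nn_integral_cmult[symmetric]) (auto simp: mult_ac)
  \<comment> \<open>Fubini exchanges the law of the true parameter for a prior average of the laws
    of \<open>t\<close>, so that \<open>psi\<close> is now integrated under the
    alternatives.\<close>
  also have "\<dots> = (\<integral>\<^sup>+ t. (\<integral>\<^sup>+ x. ennreal (l t x) * psi x * indicator A t \<partial>N) \<partial>Pr)"
    by (rule PN.Fubini') measurable
  also have "\<dots> = (\<integral>\<^sup>+ t. (\<integral>\<^sup>+ x. psi x \<partial>law t) * indicator A t \<partial>Pr)"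
    by (intro nn_integral_cong) (simp add: nn_integral_law nn_integral_multc)
  finally show ?thesis .
qed

text \<open>Markov's inequality for the prior mass of those \<open>t\<close> whose likelihood ratio is small
  replaces the usual application of Jensen's inequality to the log-likelihood.\<close>

lemma evidence_lower_bound:
  assumes P0: "prob_space (law t0)" and B [measurable]: "B \<in> sets Pr" and B0: "0 < measure Pr B"
    and c: "0 < c" and del: "0 \<le> \<delta>"
    and tail: "\<And>t. t \<in> B \<Longrightarrow> measure (law t0) {x \<in> space N. l t x < c * l t0 x} \<le> \<delta>"
  shows "emeasure (law t0) (space N - {x \<in> space N. ennreal (measure Pr B / 2 * c * l t0 x)
      \<le> evidence x})
    \<le> ennreal (2 * \<delta>)"
proof -
  interpret P0: prob_space "law t0" by (rule P0)
  interpret PN: pair_sigma_finite Pr "law t0" by standard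
  \<comment> \<open>Pairs of a parameter in \<open>B\<close> and a sample on which its likelihood
    ratio is too small; \<open>h x\<close> is the prior mass of the section at
    \<open>x\<close>.\<close>
  define E where "E = {z \<in> space (Pr \<Otimes>\<^sub>M N). fst z \<in> B \<and> l (fst z) (snd z) < c * l t0 (snd z)}"
  have E [measurable]: "E \<in> sets (Pr \<Otimes>\<^sub>M N)" unfolding E_def by measurable
  define h where "h x = (\<integral>\<^sup>+ t. indicator E (t, x) \<partial>Pr)" for x
  have hm [measurable]: "h \<in> borel_measurable N" unfolding h_def by measurable
  have "(\<integral>\<^sup>+ x. h x \<partial>law t0) = (\<integral>\<^sup>+ t. \<integral>\<^sup>+ x. indicator E (t, x) \<partial>law t0 \<partial>Pr)"
    unfolding h_def by (rule PN.Fubini') measurable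
  also have "\<dots> \<le> (\<integral>\<^sup>+ t. ennreal \<delta> * indicator B t \<partial>Pr)"
  proof (rule nn_integral_mono)
    fix t assume t: "t \<in> space Pr"
    show "(\<integral>\<^sup>+ x. indicator E (t, x) \<partial>law t0) \<le> ennreal \<delta> * indicator B t"
    proof (cases "t \<in> B")
      case True
      have "(\<integral>\<^sup>+ x. indicator E (t, x) \<partial>law t0)
          = (\<integral>\<^sup>+ x. indicator {x \<in> space N. l t x < c * l t0 x} x \<partial>law t0)"
        using True t by (intro nn_integral_cong) (auto simp: E_def indicator_def space_pair_measure)
      also have "\<dots> = emeasure (law t0) {x \<in> space N. l t x < c * l t0 x}"
        using t by (intro nn_integral_indicator) measurable
      finally show ?thesis using tail[OF True] True by (simp add: P0.emeasure_eq_measure ennreal_leI)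
    next
      case False
      then show ?thesis by (simp add: E_def)
    qed
  qed
  also have "\<dots> = ennreal (\<delta> * measure Pr B)"
    using del by (simp add: nn_integral_cmult_indicator Pr.emeasure_eq_measure ennreal_mult)
  finally have hint: "(\<integral>\<^sup>+ x. h x \<partial>law t0) \<le> ennreal (\<delta> * measure Pr B)" .
  define b where "b = measure Pr B / 2"
  have b: "0 < b" using B0 by (simp add: b_def)
  \<comment> \<open>If the evidence is too small, the parameters of \<open>B\<close> with a large
    enough likelihood ratio have prior mass below half that of \<open>B\<close>; the others then
    fill at least the other half. Markov's inequality at this half produces the factor 2 in front of
    \<delta>.\<close>
  have sub: "space N - {x \<in> space N. ennreal (b * c * l t0 x) \<le> evidence x} \<subseteq> {x \<in> space N. 1
      \<le> ennreal (1 / b) * h x}"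
  proof
    fix x assume "x \<in> space N - {x \<in> space N. ennreal (b * c * l t0 x) \<le> evidence x}"
    then have x: "x \<in> space N" and ev: "evidence x < ennreal (b * c * l t0 x)" by auto
    have l0: "0 < l t0 x"
    proof (rule ccontr)
      assume "\<not> 0 < l t0 x"
      then have "b * c * l t0 x \<le> 0" using b c by (simp add: mult_nonneg_nonpos)
      then show False using ev by (simp add: ennreal_neg)
    qed
    define g where "g = measure Pr {t \<in> space Pr. t \<in> B \<and> \<not> l t x < c * l t0 x}"
    define k where "k = measure Pr {t \<in> space Pr. t \<in> B \<and> l t x < c * l t0 x}"
    have hk: "h x = ennreal k"
    proof -
      have "h x = (\<integral>\<^sup>+ t. indicator {t \<in> space Pr. t \<in> B \<and> l t x < c * l t0 x} t \<partial>Pr)"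
        unfolding h_def using x by (intro nn_integral_cong) (auto
            simp: E_def indicator_def space_pair_measure)
      also have "\<dots> = ennreal k"
        using x unfolding k_def by (subst nn_integral_indicator) (auto simp: Pr.emeasure_eq_measure)
      finally show ?thesis .
    qed
    have gk: "g + k = measure Pr B"
    proof -
      have "measure Pr B = measure Pr ({t \<in> space Pr. t \<in> B \<and> \<not> l t x < c * l t0 x} \<union> {t \<in> space Pr.
          t \<in> B \<and> l t x < c * l t0 x})"
        using sets.sets_into_space[OF B] by (intro arg_cong[where f="measure Pr"]) auto
      also have "\<dots> = g + k"
        unfolding g_def k_def using x by (intro Pr.finite_measure_Union) auto
      finally show ?thesis by simp
    qed
    have "ennreal (c * l t0 x * g) = (\<integral>\<^sup>+ t. ennreal (c * l t0 x) * indicator {t \<in> space Pr. t \<in> B \<and>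
        \<not> l t x < c * l t0 x} t \<partial>Pr)"
      using x c l0 unfolding g_def
      by (subst nn_integral_cmult_indicator) (auto simp: Pr.emeasure_eq_measure ennreal_mult)
    also have "\<dots> \<le> evidence x"
      unfolding evidence_def by (intro nn_integral_mono) (auto simp: indicator_def intro!: ennreal_leI)
    also note ev
    finally have "c * l t0 x * g < b * c * l t0 x"
      using b c l0 by (subst (asm) ennreal_less_iff) (auto simp: g_def)
    then have "g * (c * l t0 x) < b * (c * l t0 x)" by (simp add: mult_ac)
    moreover have "0 < c * l t0 x" using c l0 by simp
    ultimately have "g < b" by (metis mult_less_cancel_right_pos)
    then have "b \<le> k" using gk by (simp add: b_def)
    then have "1 \<le> 1 / b * k" using b by (simp add: field_simps)
    then have "1 \<le> ennreal (1 / b) * h x" using b by (simp add: hk flip: ennreal_mult' ennreal_1)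
    then show "x \<in> {x \<in> space N. 1 \<le> ennreal (1 / b) * h x}" using x by simp
  qed
  have "emeasure (law t0) (space N - {x \<in> space N. ennreal (b * c * l t0 x) \<le> evidence x})
    \<le> emeasure (law t0) {x \<in> space N. 1 \<le> ennreal (1 / b) * h x}"
    by (rule emeasure_mono[OF sub]) measurable
  also have "\<dots> \<le> ennreal (1 / b) * (\<integral>\<^sup>+ x. h x * indicator (space N) x \<partial>law t0)"
    using nn_integral_Markov_inequality[of h "space N" "law t0" "ennreal (1 / b)"]
    by simp
  also have "(\<integral>\<^sup>+ x. h x * indicator (space N) x \<partial>law t0) = (\<integral>\<^sup>+ x. h x \<partial>law t0)"
    by (intro nn_integral_cong) simp
  also have "ennreal (1 / b) * (\<integral>\<^sup>+ x. h x \<partial>law t0) \<le> ennreal (1 / b) * ennreal (\<delta> * measure Pr B)"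
    by (intro mult_left_mono hint) simp
  also have "\<dots> = ennreal (2 * \<delta>)"
    using b B0 del by (subst ennreal_mult[symmetric]) (auto simp: b_def)
  finally show ?thesis by (simp add: b_def)
qed

text \<open>Each piece of the posterior is split as \<phi> post + (1 - \<phi>) post. The first
  summand is at most \<phi>, a type I error; in the second the small evidence is compensated by the
  type II error. Every \<open>B j\<close> has its own test, so the errors form a series.\<close>

lemma nn_integral_post_tests:
  assumes P0: "prob_space (law t0)" and c: "0 < c"
    and bad: "emeasure (law t0) (space N - {x \<in> space N. ennreal (c * l t0 x) \<le> evidence x}) \<le> \<delta>"
    and A: "A \<in> sets Pr" and Z [measurable]: "Z \<in> sets Pr" and B [measurable]: "\<And>j. B j \<in> sets Pr"
    and sub: "A \<subseteq> Z \<union> (\<Union>j::nat. B j)"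
    and Z1: "\<And>t. t \<in> Z \<Longrightarrow> prob_space (law t)"
    and phi [measurable]: "\<And>j. phi j \<in> borel_measurable N" and phi01: "\<And>j x. 0 \<le> phi j x \<and> phi j x
        \<le> (1::real)"
    and type1: "\<And>j. (\<integral>\<^sup>+ x. ennreal (phi j x) \<partial>law t0) \<le> a j"
    and type2: "\<And>j t. t \<in> B j \<Longrightarrow> (\<integral>\<^sup>+ x. ennreal (1 - phi j x) \<partial>law t) \<le> b j"
  shows "(\<integral>\<^sup>+ x. post A x \<partial>law t0) \<le> \<delta> + emeasure Pr Z / ennreal c + (\<Sum>j. a j
      + b j * emeasure Pr (B j) / ennreal c)"
proof -
  let ?G = "{x \<in> space N. ennreal (c * l t0 x) \<le> evidence x}"
  have [measurable]: "?G \<in> sets N" by measurable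
  have [measurable]: "space N - ?G \<in> sets N" by measurable
  let ?f = "\<lambda>j x. ennreal (phi j x) + ennreal (1 - phi j x) * post (B j) x * indicator ?G x"
  \<comment> \<open>The factor 1 in front of \<open>post Z x\<close> plays the part of
    \<open>psi\<close> in \<open>nn_integral_post_le\<close>: no test is used on \<open>Z\<close>,
    only its prior mass.\<close>
  have pt: "post A x \<le> indicator (space N - ?G) x + 1 * post Z x * indicator ?G x + (\<Sum>j. ?f j x)"
    if x: "x \<in> space N" for x
  proof (cases "x \<in> ?G")
    case True
    have "post (B j) x \<le> ?f j x" for j
    proof -
      have "post (B j) x = ennreal (phi j x) * post (B j) x + ennreal (1 - phi j x) * post (B j) x"
        using phi01[of j x] by (simp flip: distrib_right ennreal_plus)
      also have "\<dots> \<le> ennreal (phi j x) * 1 + ennreal (1 - phi j x) * post (B j) x"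
        by (intro add_mono mult_left_mono post_le_1 B x) auto
      finally show ?thesis using True by simp
    qed
    then have "(\<Sum>j. post (B j) x) \<le> (\<Sum>j. ?f j x)" by (intro suminf_le) auto
    then show ?thesis using post_UN_le[OF A Z B sub x] True by (simp add: add_left_mono order_trans)
  next
    case False
    then have "indicator (space N - ?G) x = (1::ennreal)" using x by simp
    then show ?thesis using post_le_1[OF A x] by (simp add: add_increasing2)
  qed
  have "(\<integral>\<^sup>+ x. post A x \<partial>law t0)
     \<le> (\<integral>\<^sup>+ x. indicator (space N - ?G) x + 1 * post Z x * indicator ?G x + (\<Sum>j. ?f j x) \<partial>law t0)"
    by (intro nn_integral_mono pt) simp
  also have "\<dots> = emeasure (law t0) (space N - ?G) + (\<integral>\<^sup>+ x. 1 * post Z x * indicator ?G x \<partial>law t0)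
     + (\<Sum>j. (\<integral>\<^sup>+ x. ?f j x \<partial>law t0))"
    by (simp add: nn_integral_add nn_integral_suminf)
  also have "\<dots> \<le> \<delta> + emeasure Pr Z / ennreal c + (\<Sum>j. a j + b j * emeasure Pr (B j) / ennreal c)"
  proof (intro add_mono bad suminf_le)
    have "(\<integral>\<^sup>+ x. 1 * post Z x * indicator ?G x \<partial>law t0)
        \<le> (\<integral>\<^sup>+ t. (\<integral>\<^sup>+ x. 1 \<partial>law t) * indicator Z t \<partial>Pr) / ennreal c"
      by (rule nn_integral_post_le[OF Z _ c]) measurable
    also have "(\<integral>\<^sup>+ t. (\<integral>\<^sup>+ x. 1 \<partial>law t) * indicator Z t \<partial>Pr) = (\<integral>\<^sup>+ t. indicator Z t \<partial>Pr)"
      using prob_space.emeasure_space_1[OF Z1] by (intro nn_integral_cong) (auto simp: indicator_def)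
    finally show "(\<integral>\<^sup>+ x. 1 * post Z x * indicator ?G x \<partial>law t0) \<le> emeasure Pr Z / ennreal c" by simp
  next
    fix j
    have "(\<integral>\<^sup>+ x. ennreal (1 - phi j x) * post (B j) x * indicator ?G x \<partial>law t0)
      \<le> (\<integral>\<^sup>+ t. (\<integral>\<^sup>+ x. ennreal (1 - phi j x) \<partial>law t) * indicator (B j) t \<partial>Pr) / ennreal c"
      by (rule nn_integral_post_le[OF B _ c]) measurable
    also have "\<dots> \<le> (\<integral>\<^sup>+ t. b j * indicator (B j) t \<partial>Pr) / ennreal c"
      using type2 by (intro divide_right_mono_ennreal nn_integral_mono) (auto simp: indicator_def)
    also have "\<dots> = b j * emeasure Pr (B j) / ennreal c"
      by (simp add: nn_integral_cmult_indicator)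
    finally show "(\<integral>\<^sup>+ x. ?f j x \<partial>law t0) \<le> a j + b j * emeasure Pr (B j) / ennreal c"
      using type1[of j] by (subst nn_integral_add) (auto intro!: add_mono)
  qed auto
  finally show ?thesis .
qed

end

section \<open>The Hellinger-type distance and covering numbers\<close>

text \<open>The elementary bound (u + v)^2 <= (1 + t) u^2 + (1 + 1/t) v^2 is integrated and then
  used at the t that equals the ratio of the two norms, where its right-hand side becomes the square
  of the sum of the norms.\<close>

lemma L2_triangle:
  fixes u v :: "'b \<Rightarrow> real"
  assumes [measurable]: "u \<in> borel_measurable M" "v \<in> borel_measurable M"
    and u: "integrable M (\<lambda>x. (u x)\<^sup>2)" and v: "integrable M (\<lambda>x. (v x)\<^sup>2)"
  shows "integrable M (\<lambda>x. (u x + v x)\<^sup>2)"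
    and "sqrt (\<integral>x. (u x + v x)\<^sup>2 \<partial>M) \<le> sqrt (\<integral>x. (u x)\<^sup>2 \<partial>M) + sqrt (\<integral>x. (v x)\<^sup>2 \<partial>M)"
proof -
  have le: "(u x + v x)\<^sup>2 \<le> (1 + t) * (u x)\<^sup>2 + (1 + 1 / t) * (v x)\<^sup>2" if "0 < t" for t x
  proof -
    have "0 \<le> (t * u x - v x)\<^sup>2 / t" using that by simp
    also have "\<dots> = (1 + t) * (u x)\<^sup>2 + (1 + 1 / t) * (v x)\<^sup>2 - (u x + v x)\<^sup>2"
      using that by (simp add: field_simps power2_eq_square)
    finally show ?thesis by simp
  qed
  show int: "integrable M (\<lambda>x. (u x + v x)\<^sup>2)"
    by (rule Bochner_Integration.integrable_bound[where f="\<lambda>x. (1 + 1) * (u x)\<^sup>2 + (1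
        + 1 / 1) * (v x)\<^sup>2"])
      (use u v le[of 1] in \<open>auto intro!: AE_I2\<close>)
  define a b where "a = sqrt (\<integral>x. (u x)\<^sup>2 \<partial>M)" and "b = sqrt (\<integral>x. (v x)\<^sup>2 \<partial>M)"
  have a: "0 \<le> a" "(\<integral>x. (u x)\<^sup>2 \<partial>M) = a\<^sup>2" and b: "0 \<le> b" "(\<integral>x. (v x)\<^sup>2 \<partial>M) = b\<^sup>2"
    by (auto simp: a_def b_def)
  have "sqrt (\<integral>x. (u x + v x)\<^sup>2 \<partial>M) \<le> a + b + e" if e: "0 < e" for e
  proof -
    \<comment> \<open>Padding by e / 2 keeps both norms positive, so that their ratio is a
      legitimate t even if one of the functions vanishes.\<close>
    define a' b' where "a' = a + e / 2" and "b' = b + e / 2"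
    have a': "0 < a'" "a\<^sup>2 \<le> a'\<^sup>2" and b': "0 < b'" "b\<^sup>2 \<le> b'\<^sup>2"
      using a b e by (auto simp: a'_def b'_def intro!: power_mono)
    define t where "t = b' / a'"
    have t: "0 < t" using a' b' by (simp add: t_def)
    have "(\<integral>x. (u x + v x)\<^sup>2 \<partial>M) \<le> (\<integral>x. (1 + t) * (u x)\<^sup>2 + (1 + 1 / t) * (v x)\<^sup>2 \<partial>M)"
      using int u v le[OF t] by (intro integral_mono) auto
    also have "\<dots> = (1 + t) * a\<^sup>2 + (1 + 1 / t) * b\<^sup>2"
      using u v a b by simp
    also have "\<dots> \<le> (1 + t) * a'\<^sup>2 + (1 + 1 / t) * b'\<^sup>2"
      using a' b' t by (intro add_mono mult_left_mono) auto
    also have "\<dots> = (a' + b')\<^sup>2"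
      using a' b' by (simp add: t_def field_simps power2_eq_square)
    finally have "sqrt (\<integral>x. (u x + v x)\<^sup>2 \<partial>M) \<le> a' + b'"
      using a' b' by (simp add: real_le_lsqrt)
    then show ?thesis by (simp add: a'_def b'_def)
  qed
  then show "sqrt (\<integral>x. (u x + v x)\<^sup>2 \<partial>M) \<le> sqrt (\<integral>x. (u x)\<^sup>2 \<partial>M) + sqrt (\<integral>x. (v x)\<^sup>2 \<partial>M)"
    unfolding a_def[symmetric] b_def[symmetric] by (rule field_le_epsilon)
qed

locale transition_model = mu: sigma_finite_measure mu + nu: finite_measure nu
  for mu nu :: "'a measure" +
  fixes T :: "'p measure" and p :: "'p \<Rightarrow> 'a \<Rightarrow> 'a \<Rightarrow> real"
  assumes sets_nu: "sets nu = sets mu"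
    and p_joint: "(\<lambda>(\<theta>, x, y). p \<theta> x y) \<in> borel_measurable (T \<Otimes>\<^sub>M mu \<Otimes>\<^sub>M mu)"
    and transition: "\<theta> \<in> space T \<Longrightarrow> transition_density mu (p \<theta>)"
begin

lemma p_compose [measurable (raw)]:
  assumes "f \<in> measurable N T" "g \<in> measurable N mu" "h \<in> measurable N mu"
  shows "(\<lambda>w. p (f w) (g w) (h w)) \<in> borel_measurable N"
  using measurable_compose[OF measurable_Pair[OF assms(1) measurable_Pair[OF assms(2,3)]] p_joint]
      by simp

abbreviation dist where "dist \<equiv> trans_dist mu nu p"

lemma dist_commute: "dist s t = dist t s"
  unfolding trans_dist_def by (simp add: power2_commute)

lemma dist_measurable:
  assumes s: "s \<in> space T"
  shows "(\<lambda>t. dist t s) \<in> borel_measurable T"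
proof -
  note [measurable_cong] = sets_nu
  have [measurable]: "(\<lambda>w. s) \<in> measurable N T" for N :: "'q measure" using s by simp
  have "(\<lambda>w. (sqrt (p (fst (fst w)) (snd (fst w)) (snd w)) - sqrt (p s (snd (fst w)) (snd w)))\<^sup>2)
     \<in> borel_measurable ((T \<Otimes>\<^sub>M nu) \<Otimes>\<^sub>M mu)" by measurable
  then have "(\<lambda>w. \<integral>y. (sqrt (p (fst w) (snd w) y) - sqrt (p s (snd w) y))\<^sup>2
      \<partial>mu) \<in> borel_measurable (T \<Otimes>\<^sub>M nu)"
    by (intro mu.borel_measurable_lebesgue_integral) (simp add: case_prod_beta')
  then have "(\<lambda>t. \<integral>x. (\<integral>y. (sqrt (p t x y) - sqrt (p s x y))\<^sup>2 \<partial>mu) \<partial>nu) \<in> borel_measurable T"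
    by (intro nu.borel_measurable_lebesgue_integral) (simp add: case_prod_beta')
  then show ?thesis unfolding trans_dist_def by measurable
qed

text \<open>Each section of \<open>p t\<close> integrates to 1 over \<open>mu\<close>, so the
  squared root has total integral nu (space), which is finite.\<close>

lemma sqrt_p_facts:
  assumes t: "t \<in> space T"
  shows "(\<lambda>z. sqrt (p t (fst z) (snd z))) \<in> borel_measurable (nu \<Otimes>\<^sub>M mu)"
    and "integrable (nu \<Otimes>\<^sub>M mu) (\<lambda>z. (sqrt (p t (fst z) (snd z)))\<^sup>2)"
proof -
  note [measurable_cong] = sets_nu
  interpret pair_sigma_finite nu mu by standard
  have sp: "space nu = space mu" using sets_eq_imp_space_eq[OF sets_nu] .
  have [measurable]: "(\<lambda>w. t) \<in> measurable N T" for N :: "'q measure" using t by simp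
  show m [measurable]: "(\<lambda>z. sqrt (p t (fst z) (snd z))) \<in> borel_measurable (nu \<Otimes>\<^sub>M mu)" by measurable
  have [measurable]: "(\<lambda>z. p t (fst z) (snd z)) \<in> borel_measurable (nu \<Otimes>\<^sub>M mu)" by measurable
  have td: "transition_density mu (p t)" using transition[OF t] .
  have nn: "0 \<le> p t x y" if "x \<in> space mu" "y \<in> space mu" for x y
    using td that unfolding transition_density_def by blast
  have one: "(\<integral>\<^sup>+ y. ennreal (p t x y) \<partial>mu) = 1" if x: "x \<in> space mu" for x
  proof -
    have "prob_space (density mu (\<lambda>y. ennreal (p t x y)))" using td x
        unfolding transition_density_def by blast
    then have "emeasure (density mu (\<lambda>y. ennreal (p t x y))) (space mu) = 1"
      using prob_space.emeasure_space_1 by fastforce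
    then show ?thesis using x by (subst (asm) emeasure_density) (auto cong: nn_integral_cong)
  qed
  have "(\<integral>\<^sup>+ z. ennreal (p t (fst z) (snd z)) \<partial>(nu \<Otimes>\<^sub>M mu)) = (\<integral>\<^sup>+ x. \<integral>\<^sup>+ y. ennreal (p t x y) \<partial>mu \<partial>nu)"
    by (subst mu.nn_integral_fst[symmetric]) auto
  also have "\<dots> = (\<integral>\<^sup>+ x. 1 \<partial>nu)" by (intro nn_integral_cong) (simp add: one sp)
  also have "\<dots> < \<infinity>" by (simp add: nu.emeasure_eq_measure)
  finally have fin: "(\<integral>\<^sup>+ z. ennreal (p t (fst z) (snd z)) \<partial>(nu \<Otimes>\<^sub>M mu)) < \<infinity>" .
  have "integrable (nu \<Otimes>\<^sub>M mu) (\<lambda>z. p t (fst z) (snd z))"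
  proof (rule integrableI_nonneg)
    show "AE z in nu \<Otimes>\<^sub>M mu. 0 \<le> p t (fst z) (snd z)"
      using nn sp by (intro AE_I2) (auto simp: space_pair_measure)
  qed (use fin in auto)
  then show "integrable (nu \<Otimes>\<^sub>M mu) (\<lambda>z. (sqrt (p t (fst z) (snd z)))\<^sup>2)"
    by (rule integrable_cong_AE_imp) (use nn sp in \<open>auto intro!: AE_I2 simp: space_pair_measure\<close>)
qed

text \<open>Bochner integrals are 0 by default when they diverge, so integrability is what makes the
  nested integral in \<open>trans_dist\<close> a genuine L2 distance of root densities. The triangle
  inequality depends on this form.\<close>

lemma dist_eq_L2:
  assumes s: "s \<in> space T" and t: "t \<in> space T"
  shows "dist s t = sqrt (\<integral>z. (sqrt (p s (fst z) (snd z)) - sqrt (p t (fst z) (snd z)))\<^sup>2 \<partial>(nu \<Otimes>\<^sub>M mu))"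
    and "integrable (nu \<Otimes>\<^sub>M mu) (\<lambda>z. (sqrt (p s (fst z) (snd z)) - sqrt (p t (fst z) (snd z)))\<^sup>2)"
proof -
  interpret pair_sigma_finite nu mu by standard
  show int: "integrable (nu \<Otimes>\<^sub>M mu) (\<lambda>z. (sqrt (p s (fst z) (snd z)) - sqrt (p t (fst z) (snd z)))\<^sup>2)"
    using L2_triangle(1)[of _ _ "\<lambda>z. - sqrt (p t (fst z) (snd z))",
        OF sqrt_p_facts(1)[OF s] _ sqrt_p_facts(2)[OF s]]
      sqrt_p_facts[OF t] by simp
  show "dist s t = sqrt (\<integral>z. (sqrt (p s (fst z) (snd z)) - sqrt (p t (fst z) (snd z)))\<^sup>2 \<partial>(nu \<Otimes>\<^sub>M mu))"
    unfolding trans_dist_def integral_fst'[OF int, symmetric] by simp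
qed

lemma dist_triangle:
  assumes "r \<in> space T" "s \<in> space T" "t \<in> space T"
  shows "dist r t \<le> dist r s + dist s t"
proof -
  let ?f = "\<lambda>t z. sqrt (p t (fst z) (snd z))"
  have [measurable]: "?f r \<in> borel_measurable (nu \<Otimes>\<^sub>M mu)" "?f s \<in> borel_measurable (nu \<Otimes>\<^sub>M mu)" 
    "?f t \<in> borel_measurable (nu \<Otimes>\<^sub>M mu)" using assms sqrt_p_facts(1) by auto
  have "sqrt (\<integral>z. ((?f r z - ?f s z) + (?f s z - ?f t z))\<^sup>2 \<partial>(nu \<Otimes>\<^sub>M mu))
     \<le> sqrt (\<integral>z. (?f r z - ?f s z)\<^sup>2 \<partial>(nu \<Otimes>\<^sub>M mu)) + sqrt (\<integral>z. (?f s z - ?f t z)\<^sup>2 \<partial>(nu \<Otimes>\<^sub>M mu))"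
    by (rule L2_triangle(2)) (use assms dist_eq_L2(2) in auto)
  then show ?thesis using assms by (simp add: dist_eq_L2(1))
qed

end

section \<open>Minimal covers\<close>

lemma covering_number_finite_cover:
  assumes "ln_enat (covering_number S r A d) \<le> ereal x"
  obtains F where "finite F" "F \<subseteq> S" "A \<subseteq> (\<Union>c\<in>F. {t\<in>S. d t c < r})" "real (card F) \<le> exp x"
proof -
  let ?\<F> = "{F. finite F \<and> F \<subseteq> S \<and> A \<subseteq> (\<Union>c\<in>F. {t\<in>S. d t c < r})}"
  let ?I = "(\<lambda>F. enat (card F)) ` ?\<F>"
  have "?\<F> \<noteq> {}"
  proof
    assume "?\<F> = {}"
    then have "covering_number S r A d = \<infinity>" unfolding covering_number_def
        by (simp only: image_empty Inf_empty top_enat_def)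
    then show False using assms by (simp add: ln_enat_def)
  qed
  then obtain F0 where "F0 \<in> ?\<F>" by auto
  \<comment> \<open>The extended naturals are well-ordered, so the infimum over a nonempty family is
    attained.\<close>
  then have "Inf ?I \<in> ?I" by (intro wellorder_InfI[of "enat (card F0)"] imageI)
  then obtain F where F: "F \<in> ?\<F>" and eq: "covering_number S r A d = enat (card F)"
    unfolding covering_number_def by auto
  have "real (card F) \<le> exp x"
  proof (cases "card F = 0")
    case False
    then have "ln (real (card F)) \<le> x" using assms by (simp add: eq ln_enat_def)
    then have "exp (ln (real (card F))) \<le> exp x" by simp
    then show ?thesis using False by simp
  qed simp
  then show thesis using F that by blast
qed

section \<open>Posterior contraction\<close>

locale markov_posterior = transition_model mu nu T p
  for mu nu :: "'a measure" and T :: "'p measure" and p +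
  fixes q :: "'p \<Rightarrow> 'a \<Rightarrow> real" and \<theta>0 :: 'p and s K :: real
  assumes q_joint: "(\<lambda>(\<theta>, x). q \<theta> x) \<in> borel_measurable (T \<Otimes>\<^sub>M mu)"
    and stationary: "\<theta> \<in> space T \<Longrightarrow> stationary_density mu (p \<theta>) (q \<theta>)"
    and \<theta>0: "\<theta>0 \<in> space T"
    and tests: "testing_constant mu T p q dist \<theta>0 K"
    and s: "2 < s"
    and mixing: "summable (\<lambda>h. mixing_coeff mu p q \<theta>0 h powr (1 - 2 / s))"
begin

lemma q_compose [measurable (raw)]:
  assumes "f \<in> measurable N T" "g \<in> measurable N mu"
  shows "(\<lambda>w. q (f w) (g w)) \<in> borel_measurable N"
  using measurable_compose[OF measurable_Pair[OF assms] q_joint] by simp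

lemma stationary_chain: "\<theta> \<in> space T \<Longrightarrow> stationary_chain mu p q \<theta>"
  using transition stationary by (intro stationary_chain.intro mu.sigma_finite_measure_axioms)
      (auto intro: stationary_chain_axioms.intro)

lemma K_pos: "0 < K"
  using tests by (simp add: testing_constant_def)

lemma likelihood_joint_measurable:
  assumes "sets Pr = sets T"
  shows "case_prod (likelihood p q n) \<in> borel_measurable (Pr \<Otimes>\<^sub>M Pi\<^sub>M {..n} (\<lambda>_. mu))"
proof -
  note [measurable_cong] = assms
  have [measurable]: "(\<lambda>w. snd w i) \<in> measurable (Pr \<Otimes>\<^sub>M Pi\<^sub>M {..n} (\<lambda>_. mu)) mu" if "i \<le> n" for i
    using that by (intro measurable_compose[OF measurable_snd measurable_component_singleton]) simp
  show ?thesis unfolding likelihood_lessThan case_prod_beta' by measurable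
qed

lemma sigma_finite_PiM: "sigma_finite_measure (Pi\<^sub>M {..n::nat} (\<lambda>_. mu))"
proof -
  interpret product_sigma_finite "\<lambda>_::nat. mu" by standard
  show ?thesis by (rule sigma_finite) simp
qed

text \<open>A centre whose ball of radius \<open>(j + 1) e / 16\<close> meets the annulus \<open>((j - 1) e, j e]\<close> has distance at
  least \<open>(j + 1) e / 2\<close> from \<open>\<theta>0\<close> once \<open>j \<ge> 4\<close>, so the ball lies within an eighth of that distance.\<close>

lemma annulus_test:
  assumes e: "0 < e" and j: "4 \<le> j"
    and cover: "(SUP r\<in>{e<..}. ln_enat (covering_number (space T) (r / 16) {\<theta>\<in>Th. dist \<theta> \<theta>0 < r}
        dist)) \<le> ereal x"
    and x: "x = real n * e\<^sup>2" and Th: "Th \<subseteq> space T"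
  obtains \<phi> where "\<phi> \<in> borel_measurable (Pi\<^sub>M {..n} (\<lambda>_. mu))" "\<And>z. 0 \<le> \<phi> z \<and> \<phi> z \<le> 1"
    "(\<integral>\<^sup>+ z. ennreal (\<phi> z) \<partial>chain_law mu p q n \<theta>0) \<le> ennreal (exp (x - K * x * (real j)\<^sup>2 / 4))"
    "\<And>t. t \<in> Th \<Longrightarrow> (real j - 1) * e < dist t \<theta>0 \<Longrightarrow> dist t \<theta>0 \<le> real j * e \<Longrightarrow>
      (\<integral>\<^sup>+ z. ennreal (1 - \<phi> z) \<partial>chain_law mu p q n t) \<le> ennreal (exp (- (K * x * (real j)\<^sup>2 / 4)))"
proof -
  let ?A = "{t \<in> Th. (real j - 1) * e < dist t \<theta>0 \<and> dist t \<theta>0 \<le> real j * e}"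
  \<comment> \<open>The annulus includes distance j e, whereas the covered set is an open ball of
    radius greater than e; (j + 1) e meets both demands.\<close>
  define r where "r = (real j + 1) * e"
  have r: "e < r" using e j by (simp add: r_def)
  have "ln_enat (covering_number (space T) (r / 16) {\<theta>\<in>Th. dist \<theta> \<theta>0 < r} dist) \<le> ereal x"
    by (rule order_trans[OF SUP_upper cover]) (use r in simp)
  then obtain F where F: "finite F" "F \<subseteq> space T" "real (card F) \<le> exp x"
    and cov: "{\<theta>\<in>Th. dist \<theta> \<theta>0 < r} \<subseteq> (\<Union>c\<in>F. {t\<in>space T. dist t c < r / 16})"
    by (rule covering_number_finite_cover) blast
  \<comment> \<open>Centres whose balls miss the annulus are dropped: they could lie close to
    \<theta>0, where the tests have no power.\<close>
  define F' where "F' = {c \<in> F. \<exists>t\<in>?A. dist t c < r / 16}"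
  have F': "finite F'" "F' \<subseteq> space T" "F' \<subseteq> F" using F by (auto simp: F'_def)
  have far: "r / 2 \<le> dist \<theta>0 c" if cF: "c \<in> F'" for c
  proof -
    obtain t where t: "t \<in> ?A" "dist t c < r / 16" using cF unfolding F'_def by blast
    have "dist t \<theta>0 \<le> dist t c + dist c \<theta>0"
      by (rule dist_triangle) (use t Th F' cF \<theta>0 in auto)
    then have "(real j - 1) * e - r / 16 \<le> dist \<theta>0 c" using t by (simp add: dist_commute)
    moreover have "r / 2 \<le> (real j - 1) * e - r / 16"
    proof -
      \<comment> \<open>The claim 9 (j + 1) / 16 <= j - 1 is 25 <= 7 j, which is where j >= 4 comes
        from.\<close>
      have "25 * e \<le> 7 * real j * e" using e j by (intro mult_right_mono) auto
      moreover have "r = real j * e + e" "(real j - 1) * e = real j * e - e"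
        by (simp_all add: r_def algebra_simps)
      ultimately show ?thesis by linarith
    qed
    ultimately show ?thesis by simp
  qed
  \<comment> \<open>The 4 is the square of the 2 in \<open>far\<close>, after r is lowered to j
    e.\<close>
  define E where "E = exp (- (K * x * (real j)\<^sup>2 / 4))"
  have small: "exp (- K * real n * (dist \<theta>0 c)\<^sup>2) \<le> E" if "c \<in> F'" for c
  proof -
    have "(real j * e)\<^sup>2 / 4 \<le> (r / 2)\<^sup>2"
      using e by (simp add: r_def power_divide power_mono)
    also have "\<dots> \<le> (dist \<theta>0 c)\<^sup>2"
      using far[OF that] e by (intro power_mono) (auto simp: r_def)
    finally have "K * real n * ((real j * e)\<^sup>2 / 4) \<le> K * real n * (dist \<theta>0 c)\<^sup>2"
      using K_pos by (intro mult_left_mono) auto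
    then show ?thesis by (simp add: E_def x power_mult_distrib mult_ac)
  qed
  define test where "test c \<phi> \<longleftrightarrow> \<phi> \<in> borel_measurable (Pi\<^sub>M {..n} (\<lambda>_. mu)) \<and>
        (\<forall>z. 0 \<le> \<phi> z \<and> \<phi> z \<le> 1) \<and>
        (\<integral>z. \<phi> z \<partial>chain_law mu p q n \<theta>0) \<le> exp (- K * real n * (dist \<theta>0 c)\<^sup>2) \<and>
        (\<forall>\<theta>\<in>space T. dist \<theta> c \<le> dist \<theta>0 c / 8 \<longrightarrow>
           (\<integral>z. 1 - \<phi> z \<partial>chain_law mu p q n \<theta>) \<le> exp (- K * real n * (dist \<theta>0 c)\<^sup>2))" for c \<phi>
  have "\<forall>c\<in>F'. \<exists>\<phi>. test c \<phi>"
    using tests F'(2) unfolding testing_constant_def test_def by blast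
  then obtain \<psi> where \<psi>: "\<forall>c\<in>F'. test c (\<psi> c)" by (auto dest: bchoice)
  have \<psi>m: "\<psi> c \<in> borel_measurable (Pi\<^sub>M {..n} (\<lambda>_. mu))" and \<psi>01: "0 \<le> \<psi> c z \<and> \<psi> c z \<le> 1"
    and \<psi>1: "(\<integral>z. \<psi> c z \<partial>chain_law mu p q n \<theta>0) \<le> exp (- K * real n * (dist \<theta>0 c)\<^sup>2)"
    and \<psi>2: "t \<in> space T \<Longrightarrow> dist t c \<le> dist \<theta>0 c / 8 \<Longrightarrow>
       (\<integral>z. 1 - \<psi> c z \<partial>chain_law mu p q n t) \<le> exp (- K * real n * (dist \<theta>0 c)\<^sup>2)" if "c \<in> F'" for c z t
    using bspec[OF \<psi> that] unfolding test_def by blast+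
  have nn: "(\<integral>\<^sup>+ z. ennreal (f z) \<partial>chain_law mu p q n t) \<le> ennreal b"
    if t: "t \<in> space T" and f: "f \<in> borel_measurable (Pi\<^sub>M {..n} (\<lambda>_. mu))" and f01: "\<And>z. 0
        \<le> f z \<and> f z \<le> 1"
      and le: "(\<integral>z. f z \<partial>chain_law mu p q n t) \<le> b" for f t b
  proof -
    interpret stationary_chain mu p q t by (rule stationary_chain[OF t])
    interpret C: prob_space "chain n" by (rule prob_space_chain)
    have "integrable (chain n) f"
      using f f01 by (intro C.integrable_bdd[where c=1]) (auto
          simp: measurable_cong_sets[OF sets_chain refl])
    then show ?thesis using f01 le by (subst nn_integral_eq_integral) (auto intro: ennreal_leI)
  qed
  \<comment> \<open>The capped sum dominates every single test, so type II errors do not grow, while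
    its type I error is at most the sum over the at most exp x centres.\<close>
  define \<phi> where "\<phi> z = min 1 (\<Sum>c\<in>F'. \<psi> c z)" for z
  have \<phi>m: "\<phi> \<in> borel_measurable (Pi\<^sub>M {..n} (\<lambda>_. mu))"
    unfolding \<phi>_def using \<psi>m by measurable
  have \<phi>01: "0 \<le> \<phi> z \<and> \<phi> z \<le> 1" for z
    unfolding \<phi>_def using \<psi>01 by (auto intro!: sum_nonneg)
  have \<phi>ge: "\<psi> c z \<le> \<phi> z" if "c \<in> F'" for c z
    unfolding \<phi>_def using \<psi>01 that F'(1) by (auto intro!: member_le_sum[of c F' "\<lambda>c. \<psi> c z"])
  have "(\<integral>\<^sup>+ z. ennreal (\<phi> z) \<partial>chain_law mu p q n \<theta>0)
      \<le> (\<integral>\<^sup>+ z. (\<Sum>c\<in>F'. ennreal (\<psi> c z)) \<partial>chain_law mu p q n \<theta>0)"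
  proof (rule nn_integral_mono)
    fix z
    have "ennreal (\<phi> z) \<le> ennreal (\<Sum>c\<in>F'. \<psi> c z)"
      unfolding \<phi>_def by (intro ennreal_leI) simp
    then show "ennreal (\<phi> z) \<le> (\<Sum>c\<in>F'. ennreal (\<psi> c z))"
      using \<psi>01 by (simp add: sum_ennreal)
  qed
  also have "\<dots> = (\<Sum>c\<in>F'. \<integral>\<^sup>+ z. ennreal (\<psi> c z) \<partial>chain_law mu p q n \<theta>0)"
    using \<psi>m by (intro nn_integral_sum) (simp add: chain_law_def)
  also have "\<dots> \<le> (\<Sum>c\<in>F'. ennreal E)"
    by (intro sum_mono nn \<theta>0 \<psi>m \<psi>01 order_trans[OF \<psi>1 small])
  also have "\<dots> = ennreal (real (card F') * E)"
    by (simp add: E_def ennreal_mult' ennreal_of_nat_eq_real_of_nat)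
  also have "\<dots> \<le> ennreal (exp x * E)"
    proof (intro ennreal_leI mult_right_mono)
      have "real (card F') \<le> real (card F)" using card_mono[OF F(1) F'(3)] by simp
      then show "real (card F') \<le> exp x" using F(3) by (rule order_trans)
    qed (simp add: E_def)
  also have "exp x * E = exp (x - K * x * (real j)\<^sup>2 / 4)" by (simp add: E_def flip: exp_add)
  finally have type1: "(\<integral>\<^sup>+ z. ennreal (\<phi> z) \<partial>chain_law mu p q n \<theta>0)
      \<le> ennreal (exp (x - K * x * (real j)\<^sup>2 / 4))" .
  have type2: "(\<integral>\<^sup>+ z. ennreal (1 - \<phi> z) \<partial>chain_law mu p q n t) \<le> ennreal E" if t: "t \<in> ?A" for t
  proof -
    have tT: "t \<in> space T" using t Th by auto
    have "real j * e < r" using e by (simp add: r_def)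
    then obtain c where c: "c \<in> F" "dist t c < r / 16" using t cov by force
    then have cF: "c \<in> F'" using t by (auto simp: F'_def)
    have "dist t c \<le> dist \<theta>0 c / 8" using c far[OF cF] by simp
    note le = order_trans[OF \<psi>2[OF cF tT this] small[OF cF]]
    have "(\<integral>\<^sup>+ z. ennreal (1 - \<phi> z) \<partial>chain_law mu p q n t)
        \<le> (\<integral>\<^sup>+ z. ennreal (1 - \<psi> c z) \<partial>chain_law mu p q n t)"
      using \<phi>ge[OF cF] by (intro nn_integral_mono ennreal_leI) simp
    also have "\<dots> \<le> ennreal E"
      by (rule nn[OF tT _ _ le]) (use \<psi>m[OF cF] \<psi>01[OF cF] in auto)
    finally show ?thesis .
  qed
  show thesis
    by (rule that[OF \<phi>m \<phi>01 type1]) (use type2 in \<open>auto simp: E_def\<close>)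
qed

text \<open>The constant C of the overview, independent of n and of the prior: 1 pays for the
  initial density and the quotient for the transitions. If all mixing coefficients vanish, division
  by zero makes the quotient 0, in accordance with \<open>transition_sum_tail\<close>.\<close>

definition tail_constant :: real where
  "tail_constant = 1 + (42 + 20 * (\<Sum>h. mixing_coeff mu p q \<theta>0 h powr (1 - 2 / s)))
     / (16 * s / (s - 2) * (\<Sum>h. mixing_coeff mu p q \<theta>0 h powr (1 - 2 / s)))"

text \<open>Put y = K j^2. Since y >= 32, the term 2 x uses up at most half of x y / 8; since x >=
  2, the other half is at least y / 8, and y >= K j. The exponents thus become linear in j, which
  yields a geometric series of ratio exp (- K / 8).\<close>

lemma exponent_bound:
  fixes j x L :: real
  assumes x: "2 \<le> x" and j: "32 \<le> K * j\<^sup>2" "1 \<le> j"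
  shows "2 * x - K * x * j\<^sup>2 / 8 \<le> - (K / 8 * j)" and "x - K * x * j\<^sup>2 / 4 \<le> - (K / 8 * j)"
proof -
  define y where "y = K * j\<^sup>2"
  have "32 * x \<le> y * x" using x j by (intro mult_right_mono) (auto simp: y_def)
  moreover have "2 * y \<le> x * y" using x K_pos by (intro mult_right_mono) (auto simp: y_def)
  moreover have "K * j \<le> y" using K_pos j by (simp add: power2_eq_square y_def)
  moreover have "K * x * j\<^sup>2 = y * x" "K / 8 * j = K * j / 8" by (auto simp: y_def)
  ultimately show "2 * x - K * x * j\<^sup>2 / 8 \<le> - (K / 8 * j)" and "x - K * x * j\<^sup>2 / 4 \<le> - (K / 8 * j)"
    using x by (simp_all only: mult.commute[of y x])
qed

text \<open>A bound at fixed n whose three summands are: failure of the evidence bound, posterior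
  mass outside \<open>Th\<close>, and the annuli from \<open>J\<close> on. The factor 2 exp L comes
  from the reciprocal of the evidence bound.\<close>

lemma posterior_expectation_bound:
  assumes Pr: "prob_space Pr" and sets_Pr: "sets Pr = sets T"
    and e: "0 < e" and ne: "2 \<le> real n * e\<^sup>2" and Th: "Th \<in> sets T"
    and B: "0 < measure Pr (Bstar mu T p q \<theta>0 e s)"
    and cover: "(SUP r\<in>{e<..}. ln_enat (covering_number (space T) (r / 16) {\<theta>\<in>Th. dist \<theta> \<theta>0 < r}
        dist)) \<le> ereal (real n * e\<^sup>2)"
    and L: "0 < L" and J: "4 \<le> J" "32 \<le> K * (real J)\<^sup>2" "real J \<le> M"
    and annuli: "\<And>j. J \<le> j \<Longrightarrow>
      measure Pr {\<theta>\<in>Th. (real j - 1) * e < dist \<theta> \<theta>0 \<and> dist \<theta> \<theta>0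
          \<le> real j * e} / measure Pr (Bstar mu T p q \<theta>0 e s)
        \<le> exp (K * real n * e\<^sup>2 * (real j)\<^sup>2 / 8)"
  shows "(\<integral>\<^sup>+ x. emeasure (posterior p q Pr n x) {\<theta>\<in>space T. M * e \<le> dist \<theta> \<theta>0} \<partial>chain_law mu p q n \<theta>0)
    \<le> ennreal (2 * (tail_constant / L)
      + 2 * exp L * (exp (2 * (real n * e\<^sup>2)) * (measure Pr (space T
          - Th) / measure Pr (Bstar mu T p q \<theta>0 e s)))
      + (1 + 2 * exp L) * (exp (- K / 8) ^ J / (1 - exp (- K / 8))))"
proof -
  define x where "x = real n * e\<^sup>2"
  have x: "2 \<le> x" using ne by (simp add: x_def)
  let ?B = "Bstar mu T p q \<theta>0 e s"
  interpret Pr: prob_space Pr by (rule Pr)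
  have space_Pr: "space Pr = space T" by (rule sets_eq_imp_space_eq[OF sets_Pr])
  interpret bayes_model Pr "Pi\<^sub>M {..n} (\<lambda>_. mu)" "likelihood p q n" \<theta>0
    by (intro bayes_model.intro bayes_model_axioms.intro Pr sigma_finite_PiM
        likelihood_joint_measurable sets_Pr)
      (simp add: space_Pr \<theta>0)
  interpret S: stationary_chain mu p q \<theta>0 by (rule stationary_chain[OF \<theta>0])
  have law: "law t = chain_law mu p q n t" for t by (simp add: law_def chain_law_def)
  have prob_law: "prob_space (law t)" if "t \<in> space T" for t
    unfolding law by (rule stationary_chain.prob_space_chain[OF stationary_chain[OF that]])
  \<comment> \<open>A set outside the sigma-algebra has \<open>measure\<close> 0 by default, so
    positive mass yields measurability.\<close>
  have Bs: "?B \<in> sets Pr" using B measure_notin_sets by force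
  have BT: "?B \<subseteq> space T" by (auto simp: Bstar_def Theta1_def)
  define c where "c = measure Pr ?B / 2 * exp (- (2 * x + L))"
  have c: "0 < c" using B by (simp add: c_def)
  have inv_c: "a / c = 2 * exp (2 * x + L) * (a / measure Pr ?B)" for a
    unfolding c_def exp_minus using B by (simp add: field_simps)
  have S0: "0 \<le> (\<Sum>h. mixing_coeff mu p q \<theta>0 h powr (1 - 2 / s))"
    using mixing by (intro suminf_nonneg) auto
  have tc: "0 \<le> tail_constant" unfolding tail_constant_def using S0 s by simp
  have bad: "emeasure (law \<theta>0) (space (Pi\<^sub>M {..n} (\<lambda>_. mu)) - {y \<in> space (Pi\<^sub>M {..n} (\<lambda>_. mu)).
      ennreal (c * likelihood p q n \<theta>0 y) \<le> evidence y}) \<le> ennreal (2 * (tail_constant / L))"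
    unfolding c_def
  proof (rule evidence_lower_bound[OF prob_law[OF \<theta>0] Bs B])
    fix t assume t: "t \<in> ?B"
    then have tT: "t \<in> space T" using BT by auto
    show "measure (law \<theta>0) {y \<in> space (Pi\<^sub>M {..n} (\<lambda>_. mu)). likelihood p q n t y < exp (- (2 * x
        + L)) * likelihood p q n \<theta>0 y}
      \<le> tail_constant / L"
      using S.likelihood_tail[OF s mixing e L ne t transition[OF tT] stationary[OF tT]]
      unfolding law x_def tail_constant_def S.space_chain .
  qed (use tc L in auto)
  let ?A = "{\<theta>\<in>space T. M * e \<le> dist \<theta> \<theta>0}"
  define R where "R j = {\<theta>\<in>Th. (real j - 1) * e < dist \<theta> \<theta>0 \<and> dist \<theta> \<theta>0 \<le> real j * e}" for j :: nat
  have ThT: "Th \<subseteq> space T" using sets.sets_into_space[OF Th] .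
  note [measurable] = dist_measurable[OF \<theta>0] Th
  have As: "?A \<in> sets Pr" unfolding sets_Pr by measurable
  have Rs: "R j \<in> sets Pr" for j
  proof -
    have "R j = {\<theta>\<in>space T. \<theta> \<in> Th \<and> (real j - 1) * e < dist \<theta> \<theta>0 \<and> dist \<theta> \<theta>0 \<le> real j * e}"
      using ThT by (auto simp: R_def)
    also have "\<dots> \<in> sets T" by measurable
    finally show ?thesis by (simp add: sets_Pr)
  qed
  have Zs: "space T - Th \<in> sets Pr" unfolding sets_Pr by measurable
  have sub: "?A \<subseteq> (space T - Th) \<union> (\<Union>j. R (J + j))"
  proof
    fix t assume t: "t \<in> ?A"
    \<comment> \<open>Rounding up fits the annuli, which are open below and closed above;
      \<open>J\<close> is an integer below the quotient, so no annulus before \<open>J\<close>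
      occurs.\<close>
    define i where "i = nat \<lceil>dist t \<theta>0 / e\<rceil>"
    have "M \<le> dist t \<theta>0 / e" using t e by (simp add: field_simps)
    then have Jd: "real J \<le> dist t \<theta>0 / e" using J(3) by linarith
    then have i: "real i - 1 < dist t \<theta>0 / e" "dist t \<theta>0 / e \<le> real i" "J \<le> i"
      unfolding i_def by linarith+
    then have "(real i - 1) * e < dist t \<theta>0" "dist t \<theta>0 \<le> real i * e" using e
        by (simp_all add: field_simps)
    moreover obtain j where "i = J + j" using i(3) le_Suc_ex by blast
    ultimately show "t \<in> (space T - Th) \<union> (\<Union>j. R (J + j))" using t by (auto simp: R_def)
  qed
  have "\<exists>\<phi>. \<phi> \<in> borel_measurable (Pi\<^sub>M {..n} (\<lambda>_. mu)) \<and> (\<forall>z. 0 \<le> \<phi> z \<and> \<phi> z \<le> 1) \<and>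
    (\<integral>\<^sup>+ z. ennreal (\<phi> z) \<partial>law \<theta>0) \<le> ennreal (exp (x - K * x * (real (J + j))\<^sup>2 / 4)) \<and>
    (\<forall>t\<in>R (J + j). (\<integral>\<^sup>+ z. ennreal (1 - \<phi> z) \<partial>law t)
        \<le> ennreal (exp (- (K * x * (real (J + j))\<^sup>2 / 4))))" for j
  proof -
    have j4: "4 \<le> J + j" using J by simp
    show ?thesis
      by (rule annulus_test[OF e j4 cover[folded x_def] x_def ThT]) (auto simp: R_def law)
  qed
  then obtain \<phi> where \<phi>: "\<And>j. \<phi> j \<in> borel_measurable (Pi\<^sub>M {..n} (\<lambda>_. mu))" "\<And>j z. 0 \<le> \<phi> j z \<and> \<phi> j z \<le> 1"
    "\<And>j. (\<integral>\<^sup>+ z. ennreal (\<phi> j z) \<partial>law \<theta>0) \<le> ennreal (exp (x - K * x * (real (J + j))\<^sup>2 / 4))"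
    "\<And>j t. t \<in> R (J + j) \<Longrightarrow> (\<integral>\<^sup>+ z. ennreal (1 - \<phi> j z) \<partial>law t)
        \<le> ennreal (exp (- (K * x * (real (J + j))\<^sup>2 / 4)))"
    by metis
  define \<rho> where "\<rho> = exp (- K / 8)"
  have \<rho>: "0 < \<rho>" "\<rho> < 1" using K_pos by (auto simp: \<rho>_def)
  have \<rho>pow: "\<rho> ^ j = exp (- (K / 8 * real j))" for j
    by (simp add: \<rho>_def exp_of_nat_mult[symmetric] mult.commute)
  \<comment> \<open>The exponents are 2 x from the evidence, - K x j^2 / 4 from the test and K x j^2
    / 8 from the prior ratio; \<open>exponent_bound\<close> estimates their sum.\<close>
  have annulus_term: "ennreal (exp (x - K * x * (real j)\<^sup>2 / 4))
      + ennreal (exp (- (K * x * (real j)\<^sup>2 / 4))) * emeasure Pr (R j) / ennreal c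
     \<le> ennreal ((1 + 2 * exp L) * \<rho> ^ j)" if j: "J \<le> j" for j
  proof -
    have "(real J)\<^sup>2 \<le> (real j)\<^sup>2" using j by simp
    then have "K * (real J)\<^sup>2 \<le> K * (real j)\<^sup>2" using K_pos by (intro mult_left_mono) auto
    then have j32: "32 \<le> K * (real j)\<^sup>2" and j1: "1 \<le> real j" using J j by auto
    note ex = exponent_bound[OF x j32 j1]
    have "exp (- (K * x * (real j)\<^sup>2 / 4)) * measure Pr (R j) / c
      = 2 * exp (2 * x + L) * exp (- (K * x * (real j)\<^sup>2 / 4)) * (measure Pr (R j) / measure Pr ?B)"
      unfolding inv_c by simp
    also have "\<dots> \<le> 2 * exp (2 * x + L) * exp (- (K * x * (real j)\<^sup>2 / 4)) * exp (K * x * (real j)\<^sup>2 / 8)"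
      using annuli[OF j] by (intro mult_left_mono) (auto simp: R_def x_def mult_ac)
    also have "\<dots> = 2 * exp L * exp (2 * x - K * x * (real j)\<^sup>2 / 8)"
      by (simp add: exp_add[symmetric])
    also have "\<dots> \<le> 2 * exp L * \<rho> ^ j"
      using ex by (simp add: \<rho>pow)
    finally have 2: "exp (- (K * x * (real j)\<^sup>2 / 4)) * measure Pr (R j) / c \<le> 2 * exp L * \<rho> ^ j" .
    have 1: "exp (x - K * x * (real j)\<^sup>2 / 4) \<le> \<rho> ^ j" using ex by (simp add: \<rho>pow)
    have "ennreal (exp (x - K * x * (real j)\<^sup>2 / 4))
        + ennreal (exp (- (K * x * (real j)\<^sup>2 / 4))) * emeasure Pr (R j) / ennreal c
      = ennreal (exp (x - K * x * (real j)\<^sup>2 / 4)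
          + exp (- (K * x * (real j)\<^sup>2 / 4)) * measure Pr (R j) / c)"
      using c by (simp add: Pr.emeasure_eq_measure divide_ennreal flip: ennreal_mult)
    also have "\<dots> \<le> ennreal ((1 + 2 * exp L) * \<rho> ^ j)"
      using 1 2 by (intro ennreal_leI) (simp add: distrib_right)
    finally show ?thesis .
  qed
  have post: "emeasure (posterior p q Pr n y) ?A = post ?A y"
      if y: "y \<in> space (Pi\<^sub>M {..n} (\<lambda>_. mu))" for y
  proof -
    have "(\<lambda>t. ennreal (likelihood p q n t y) / evidence y) \<in> borel_measurable Pr"
      using y by measurable
    then show ?thesis
      unfolding posterior_def post_def evidence_def[symmetric] by (rule emeasure_density) (rule As)
  qed
  have "(\<integral>\<^sup>+ y. emeasure (posterior p q Pr n y) ?A \<partial>chain_law mu p q n \<theta>0) = (\<integral>\<^sup>+ y. post ?A y \<partial>law \<theta>0)"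
    unfolding law by (intro nn_integral_cong post) simp
  also have "\<dots> \<le> ennreal (2 * (tail_constant / L)) + emeasure Pr (space T - Th) / ennreal c
     + (\<Sum>j. ennreal (exp (x - K * x * (real (J + j))\<^sup>2 / 4))
         + ennreal (exp (- (K * x * (real (J + j))\<^sup>2 / 4))) * emeasure Pr (R (J + j)) / ennreal c)"
    by (rule nn_integral_post_tests[OF prob_law[OF \<theta>0] c bad As Zs Rs sub _ \<phi>(1,2,3,4)])
        (auto intro: prob_law)
  also have "(\<Sum>j. ennreal (exp (x - K * x * (real (J + j))\<^sup>2 / 4))
         + ennreal (exp (- (K * x * (real (J + j))\<^sup>2 / 4))) * emeasure Pr (R (J + j)) / ennreal c)
     \<le> (\<Sum>j. ennreal ((1 + 2 * exp L) * \<rho> ^ (J + j)))"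
    by (intro suminf_le annulus_term) auto
  also have "\<dots> = ennreal ((1 + 2 * exp L) * (\<rho> ^ J / (1 - \<rho>)))"
  proof (rule suminf_ennreal_eq)
    have "(\<lambda>j. (1 + 2 * exp L) * \<rho> ^ J * \<rho> ^ j) sums ((1 + 2 * exp L) * \<rho> ^ J * (1 / (1 - \<rho>)))"
      using \<rho> by (intro sums_mult geometric_sums) auto
    then show "(\<lambda>j. (1 + 2 * exp L) * \<rho> ^ (J + j)) sums ((1 + 2 * exp L) * (\<rho> ^ J / (1 - \<rho>)))"
      by (simp add: power_add mult_ac)
  qed (use \<rho> in simp)
  also have "emeasure Pr (space T - Th) / ennreal c
    = ennreal (2 * exp L * (exp (2 * x) * (measure Pr (space T - Th) / measure Pr ?B)))"
    using c by (simp add: Pr.emeasure_eq_measure divide_ennreal inv_c exp_add mult_ac)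
  also have "ennreal (2 * (tail_constant / L)) + \<dots> + ennreal ((1 + 2 * exp L) * (\<rho> ^ J / (1 - \<rho>)))
    = ennreal (2 * (tail_constant / L) + 2 * exp L * (exp (2 * x) * (measure Pr (space T
        - Th) / measure Pr ?B))
       + (1 + 2 * exp L) * (\<rho> ^ J / (1 - \<rho>)))"
    using tc L \<rho> by (simp add: ennreal_plus add_nonneg_nonneg del: ennreal_plus flip: ennreal_plus)
  finally show ?thesis by (simp add: add_left_mono x_def \<rho>_def)
qed

end

section \<open>The limit in n\<close>

lemma ennreal_tendsto_0I:
  assumes "\<And>e::real. 0 < e \<Longrightarrow> \<forall>\<^sub>F n in F. f n \<le> ennreal e"
  shows "(f \<longlongrightarrow> (0::ennreal)) F"
proof (rule order_tendstoI)
  fix a :: ennreal assume "0 < a"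
  then obtain b where b: "0 < b" "b < a" using dense by blast
  then have "0 < enn2real b" "ennreal (enn2real b) = b"
    by (auto simp: enn2real_positive_iff less_top[symmetric] ennreal_enn2real_if)
  then show "\<forall>\<^sub>F n in F. f n < a" using assms[of "enn2real b"] b by (auto elim!: eventually_mono)
qed simp

theorem theorem5:
  fixes mu nu :: "'a measure"
    and T :: "'p measure"
    and p :: "'p \<Rightarrow> 'a \<Rightarrow> 'a \<Rightarrow> real"
    and q :: "'p \<Rightarrow> 'a \<Rightarrow> real"
    and Pr :: "nat \<Rightarrow> 'p measure"
    and Th :: "nat \<Rightarrow> 'p set"
    and eps M :: "nat \<Rightarrow> real"
    and \<theta>0 :: 'p
    and k l :: nat
    and s K :: real
    and d :: "'p \<Rightarrow> 'p \<Rightarrow> real"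
  defines "d \<equiv> trans_dist mu nu p"
  assumes "sigma_finite_measure mu"
    and "(\<lambda>(\<theta>, x, y). p \<theta> x y) \<in> borel_measurable (T \<Otimes>\<^sub>M mu \<Otimes>\<^sub>M mu)"
    and "(\<lambda>(\<theta>, x). q \<theta> x) \<in> borel_measurable (T \<Otimes>\<^sub>M mu)"
    and "\<And>\<theta>. \<theta> \<in> space T \<Longrightarrow> transition_density mu (p \<theta>)"
    and "\<And>\<theta>. \<theta> \<in> space T \<Longrightarrow> stationary_density mu (p \<theta>) (q \<theta>)"
    and "\<theta>0 \<in> space T"
    and "\<And>n. prob_space (Pr n)" and "\<And>n. sets (Pr n) = sets T"
    and "finite_measure nu" and "sets nu = sets mu"
    and "1 \<le> k" and "1 \<le> l"
    and "\<exists>C1 C2. \<forall>\<theta>\<in>space T. \<forall>x\<in>space mu. \<forall>A\<in>sets mu.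
           measure (trans_law mu (p \<theta>) l x) A \<le> C1 * measure nu A \<and>
           measure nu A \<le> C2 * (1 / real k * (\<Sum>j=1..k. measure (trans_law mu (p \<theta>) j x) A))"
    and "testing_constant mu T p q d \<theta>0 K"
    and "2 < s"
    and "summable (\<lambda>h. mixing_coeff mu p q \<theta>0 h powr (1 - 2 / s))"
    and "eps \<longlonglongrightarrow> 0"
    and "\<And>n. 1 \<le> n \<Longrightarrow> 0 < eps n"
    and "\<And>n. 1 \<le> n \<Longrightarrow> 2 \<le> real n * (eps n)\<^sup>2"
    and "\<And>n. Th n \<in> sets T"
    and "\<And>n. 1 \<le> n \<Longrightarrow> 0 < measure (Pr n) (Bstar mu T p q \<theta>0 (eps n) s)"
    and "\<And>n. 1 \<le> n \<Longrightarrow>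
           (SUP e\<in>{eps n<..}. ln_enat (covering_number (space T) (e / 16) {\<theta>\<in>Th n. d \<theta> \<theta>0 < e} d))
             \<le> ereal (real n * (eps n)\<^sup>2)"
    and "(\<lambda>n. measure (Pr n) (space T - Th n) / measure (Pr n) (Bstar mu T p q \<theta>0 (eps n) s))
           \<in> o(\<lambda>n. exp (- 2 * real n * (eps n)\<^sup>2))"
    and "\<forall>\<^sub>F j in sequentially. \<forall>n\<ge>1.
           measure (Pr n) {\<theta>\<in>Th n. (real j - 1) * eps n < d \<theta> \<theta>0 \<and> d \<theta> \<theta>0 \<le> real j * eps n}
             / measure (Pr n) (Bstar mu T p q \<theta>0 (eps n) s)
           \<le> exp (K * real n * (eps n)\<^sup>2 * (real j)\<^sup>2 / 8)"
    and "filterlim M at_top sequentially"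
  shows "(\<lambda>n. \<integral>\<^sup>+ x. emeasure (posterior p q (Pr n) n x) {\<theta>\<in>space T. M n * eps n \<le> d \<theta> \<theta>0}
              \<partial>chain_law mu p q n \<theta>0) \<longlonglongrightarrow> 0"
proof -
  interpret mu: sigma_finite_measure mu by fact
  interpret nu: finite_measure nu by fact
  interpret markov_posterior mu nu T p q \<theta>0 s K
    by (intro markov_posterior.intro transition_model.intro transition_model_axioms.intro
        markov_posterior_axioms.intro)
      (use assms in auto)
  let ?B = "\<lambda>n. measure (Pr n) (Bstar mu T p q \<theta>0 (eps n) s)"
  let ?f = "\<lambda>n. \<integral>\<^sup>+ x. emeasure (posterior p q (Pr n) n x) {\<theta>\<in>space T. M n * eps n
      \<le> d \<theta> \<theta>0} \<partial>chain_law mu p q n \<theta>0"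
  define \<rho> where "\<rho> = exp (- K / 8)"
  have \<rho>: "0 < \<rho>" "\<rho> < 1" using K_pos by (auto simp: \<rho>_def)
  \<comment> \<open>Starting the annuli at the integer part of \<open>M n\<close> makes the
    geometric tail vanish with growing \<open>M n\<close>, and every threshold on j is passed for
    large n.\<close>
  define J where "J n = nat \<lfloor>M n\<rfloor>" for n
  have J_top: "filterlim J at_top sequentially"
    unfolding J_def using assms(26)
    by (intro filterlim_compose[OF filterlim_nat_sequentially] filterlim_compose[OF
        filterlim_floor_sequentially])
  obtain j0 where j0: "\<And>j n. j0 \<le> j \<Longrightarrow> 1 \<le> n \<Longrightarrow>
      measure (Pr n) {\<theta>\<in>Th n. (real j - 1) * eps n < d \<theta> \<theta>0 \<and> d \<theta> \<theta>0 \<le> real j * eps n} / ?B n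
      \<le> exp (K * real n * (eps n)\<^sup>2 * (real j)\<^sup>2 / 8)"
    using assms(25) unfolding eventually_sequentially by blast
  \<comment> \<open>The little-o condition says precisely that this quotient by exp (- 2 n eps^2)
    tends to 0.\<close>
  define g where "g n = exp (2 * (real n * (eps n)\<^sup>2)) * (measure (Pr n) (space T - Th n) / ?B n)" for n
  have g0: "g \<longlonglongrightarrow> 0"
  proof -
    have "g = (\<lambda>n. (measure (Pr n) (space T - Th n) / ?B n) / exp (- 2 * real n * (eps n)\<^sup>2))"
      by (rule ext) (simp add: g_def exp_minus divide_inverse mult_ac)
    then show ?thesis using smalloD_tendsto[OF assms(24)] by simp
  qed
  have \<rho>0: "(\<lambda>n. \<rho> ^ J n / (1 - \<rho>)) \<longlonglongrightarrow> 0"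
    using filterlim_compose[OF LIMSEQ_power_zero J_top, of \<rho>] \<rho> by (auto intro: tendsto_divide_zero)
  show ?thesis
  proof (rule ennreal_tendsto_0I)
    fix \<eta> :: real assume \<eta>: "0 < \<eta>"
    \<comment> \<open>Chosen so that the evidence failure costs less than half of \<eta>; the
      absolute value and the added 1 give positivity of \<open>L\<close> without any sign condition
      on \<open>tail_constant\<close>.\<close>
    define L where "L = 4 * (\<bar>tail_constant\<bar> + 1) / \<eta>"
    have L: "0 < L" using \<eta> by (simp add: L_def)
    have "tail_constant * 4 < \<eta> * L" using \<eta> by (simp add: L_def)
    then have tcL: "2 * (tail_constant / L) < \<eta> / 2" using L by (simp add: field_simps)
    have "(\<lambda>n. 2 * exp L * g n + (1 + 2 * exp L) * (\<rho> ^ J n / (1 - \<rho>))) \<longlonglongrightarrow> 2 * exp L * 0 + (1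
        + 2 * exp L) * 0"
      by (intro tendsto_intros g0 \<rho>0)
    then have small: "\<forall>\<^sub>F n in sequentially. 2 * exp L * g n + (1 + 2 * exp L) * (\<rho> ^ J n / (1
        - \<rho>)) < \<eta> / 2"
      using \<eta> by (intro order_tendstoD(2)) auto
    \<comment> \<open>The thresholds come from \<open>annulus_test\<close> (4), the prior ratio
      condition (\<open>j0\<close>) and \<open>exponent_bound\<close>: J >= 32 / K gives K J^2 >= K
      J >= 32.\<close>
    have large: "\<forall>\<^sub>F n in sequentially. max (max 4 j0) (nat \<lceil>32 / K\<rceil>) \<le> J n"
      using J_top unfolding filterlim_at_top by blast
    have "\<forall>\<^sub>F n in sequentially. 1 \<le> n" by (rule eventually_ge_at_top)
    with small large show "\<forall>\<^sub>F n in sequentially. ?f n \<le> ennreal \<eta>"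
    proof eventually_elim
      case (elim n)
      have J4: "4 \<le> J n" and Jj0: "j0 \<le> J n" and JK: "32 / K \<le> real (J n)" using elim(2) by linarith+
      have "32 \<le> K * real (J n)" using JK K_pos by (simp add: field_simps)
      also have "\<dots> \<le> K * (real (J n))\<^sup>2" using J4 K_pos by (simp add: power2_eq_square)
      finally have J32: "32 \<le> K * (real (J n))\<^sup>2" .
      \<comment> \<open>For negative \<open>M n\<close> the truncation by \<open>nat\<close> would
        give 0, which exceeds \<open>M n\<close>; \<open>J4\<close> excludes this.\<close>
      have JM: "real (J n) \<le> M n" using J4 unfolding J_def by linarith
      have "?f n \<le> ennreal (2 * (tail_constant / L) + 2 * exp L * g n + (1
          + 2 * exp L) * (\<rho> ^ J n / (1 - \<rho>)))"
        unfolding g_def \<rho>_def assms(1)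
        using assms(8,9,19,20,21,22,23) elim(3) L J4 J32 JM j0 Jj0 unfolding assms(1)
        by (intro posterior_expectation_bound) auto
      also have "\<dots> \<le> ennreal \<eta>" using elim(1) tcL by (intro ennreal_leI) linarith
      finally show ?case .
    qed
  qed
qed

end
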